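(* Let $(\mathcal N,P,h)$ be a 2-dimensional almost paracomplex Riemannian manifold with sectional (Gaussian) curvature $k'$, and let $(\mathcal C(\mathcal N),\phi,\xi,\eta,g)$ be the 3-dimensional apapR manifold with $\mathcal C(\mathcal N)=\mathbb R^+\times\mathcal N$, $g\big((x',a\tfrac{d}{dt}),(y',b\tfrac{d}{dt})\big)=t^2h(x',y')+ab$, $\phi(x',a\tfrac{d}{dt})=(Px',0)$, $\xi=\tfrac{d}{dt}$, $\eta=dt$. Then the following properties of $(\mathcal C(\mathcal N),\phi,\xi,\eta,g)$ are valid: (1) its sectional curvatures of $\xi$-sections (2-planes containing $\xi$) vanish; (2) it is $*$-scalar flat, i.e. $\tau^*=0$; (3) $\tau<0$ if and only if $k'<1$; (4) $\tau>0$ if and only if $k'>1$.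
   Context: An almost paracomplex Riemannian manifold $(\mathcal N,P,h)$ of dimension $2n$ is a differentiable manifold with an endomorphism $P$ of $T\mathcal N$ satisfying $P^2=I$, $P\neq I$, $\operatorname{tr}P=0$ and a Riemannian metric $h$ with $h(Px',Py')=h(x',y')$. When $\dim\mathcal N=2$, the curvature tensor of $h$ has the form $R'=k'\pi_1'$, where $\pi_1'(x',y')z'=h(y',z')x'-h(x',z')y'$ and $k'$ is the pointwise constant sectional curvature of $h$ (a function on $\mathcal N$, regarded also as a function on $\mathbb R^+\times\mathcal N$; inequalities are understood pointwise). An almost paracontact almost paracomplex Riemannian manifold (apapR manifold) $(\mathcal M,\phi,\xi,\eta,g)$ is a $(2n+1)$-dimensional differentiable manifold with an endomorphism $\phi$ of $T\mathcal M$, a vector field $\xi$, a 1-form $\eta$ and a Riemannian metric $g$ such that $\phi^2=\mathcal I-\eta\otimes\xi$, $\eta(\xi)=1$, $\eta\circ\phi=0$, $\phi\xi=0$, $\operatorname{tr}\phi=0$, $g(\phi x,\phi y)=g(x,y)-\eta(x)\eta(y)$. Curvature conventions for $g$ with Levi-Civita connection $\nabla$: $R(x,y)=[\nabla_x,\nabla_y]-\nabla_{[x,y]}$, $R(x,y,z,w)=g(R(x,y)z,w)$; $\rho(y,z)=g^{ij}R(e_i,y,z,e_j)$, $\tau=g^{ij}\rho(e_i,e_j)$, $\rho^*(y,z)=g^{ij}R(e_i,y,z,\phi e_j)$, $\tau^*=g^{ij}\rho^*(e_i,e_j)$ for any basis $\{e_i\}$ of the tangent space. The sectional curvature of a 2-plane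 with basis $\{x,y\}$ is $R(x,y,y,x)/\big(g(x,x)g(y,y)-g(x,y)^2\big)$. $\mathbb R^+$ is the set of positive reals, $t$ is its coordinate; tangent vectors of $\mathbb R^+\times\mathcal N$ are written $(x',a\tfrac{d}{dt})$ with $x'$ tangent to $\mathcal N$. *)

theory Defs
  imports "HOL-Analysis.Analysis"
begin

section \<open>Smooth manifolds\<close>

text \<open>\<open>Ck k S f\<close>: on the open set \<open>S\<close> the map \<open>f\<close> is \<open>k\<close> times continuously differentiable
  (all iterated directional derivatives of order at most \<open>k\<close> exist and are continuous).\<close>

primrec Ck :: "nat \<Rightarrow> 'e::euclidean_space set \<Rightarrow> ('e \<Rightarrow> 'f::real_normed_vector) \<Rightarrow> bool" where
  "Ck 0 S f \<longleftrightarrow> continuous_on S f"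
| "Ck (Suc k) S f \<longleftrightarrow>
     (\<forall>x\<in>S. f differentiable (at x)) \<and> (\<forall>v. Ck k S (\<lambda>x. frechet_derivative f (at x) v))"

definition smooth_on :: "'e::euclidean_space set \<Rightarrow> ('e \<Rightarrow> 'f::real_normed_vector) \<Rightarrow> bool" where
  "smooth_on S f \<longleftrightarrow> (\<forall>k. Ck k S f)"

text \<open>A chart is a pair of an open domain and a coordinate map into the model space; only the values
  of the coordinate map on the domain matter.\<close>

type_synonym ('a, 'e) chart = "'a set \<times> ('a \<Rightarrow> 'e)"
type_synonym ('a, 'e) atlas = "('a, 'e) chart set"

definition is_chart :: "('a::topological_space, 'e::euclidean_space) chart \<Rightarrow> bool" where
  "is_chart c \<longleftrightarrow> (case c of (U, \<phi>) \<Rightarrow>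
     open U \<and> open (\<phi> ` U) \<and> inj_on \<phi> U \<and> continuous_on U \<phi> \<and> continuous_on (\<phi> ` U) (inv_into U \<phi>))"

definition smooth_atlas :: "('a::topological_space, 'e::euclidean_space) atlas \<Rightarrow> bool" where
  "smooth_atlas A \<longleftrightarrow> (\<forall>c\<in>A. is_chart c) \<and>
     (\<forall>(U, \<phi>)\<in>A. \<forall>(V, \<psi>)\<in>A. smooth_on (\<phi> ` (U \<inter> V)) (\<psi> \<circ> inv_into U \<phi>))"

text \<open>An atlas on an open subset of a topological space; where manifolds are considered the ambient
  space is Hausdorff and second countable.\<close>

definition points :: "('a, 'e) atlas \<Rightarrow> 'a set" where
  "points A = \<Union> (fst ` A)"

definition smooth_fun :: "('a::topological_space, 'e::euclidean_space) atlas \<Rightarrow> 'a set \<Rightarrow> ('a \<Rightarrow> real) \<Rightarrow> bool" where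
  "smooth_fun A V f \<longleftrightarrow> (\<forall>(U, \<phi>)\<in>A. smooth_on (\<phi> ` (U \<inter> V)) (f \<circ> inv_into U \<phi>))"

definition open_in :: "('a::topological_space, 'e) atlas \<Rightarrow> 'a set \<Rightarrow> bool" where
  "open_in A U \<longleftrightarrow> open U \<and> U \<subseteq> points A"

definition smooth_near :: "('a::topological_space, 'e::euclidean_space) atlas \<Rightarrow> 'a \<Rightarrow> ('a \<Rightarrow> real) \<Rightarrow> bool" where
  "smooth_near A p f \<longleftrightarrow> (\<exists>V. open_in A V \<and> p \<in> V \<and> smooth_fun A V f)"


section \<open>Tangent vectors and tensor fields\<close>

text \<open>Tangent vectors act on functions as directional derivatives. The type below contains all
  functionals, and has the pointwise vector space structure; the tangent space at a point is
  singled out afterwards.\<close>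

typedef 'a tvec = "UNIV :: (('a \<Rightarrow> real) \<Rightarrow> real) set"
  morphisms act Tvec by simp

instantiation tvec :: (type) real_vector
begin
definition "0 = Tvec (\<lambda>f. 0)"
definition "v + w = Tvec (\<lambda>f. act v f + act w f)"
definition "v - w = Tvec (\<lambda>f. act v f - act w f)"
definition "- v = Tvec (\<lambda>f. - act v f)"
definition "r *\<^sub>R v = Tvec (\<lambda>f. r * act v f)"
instance
  by standard
    (simp_all add: zero_tvec_def plus_tvec_def minus_tvec_def uminus_tvec_def scaleR_tvec_def
      act_inject[symmetric] Tvec_inverse algebra_simps)
end

text \<open>The tangent vectors at \<open>p\<close> are \<open>\<Sum>\<^sub>i w\<^sup>i \<partial>/\<partial>x\<^sup>i\<close> in a chart \<open>x\<close> around \<open>p\<close>. Functions that are not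
  smooth near \<open>p\<close> are sent to \<open>0\<close>, which makes a tangent vector a unique functional.\<close>

definition coord_vec ::
    "('a::topological_space, 'e::euclidean_space) atlas \<Rightarrow> 'a \<Rightarrow> ('a, 'e) chart \<Rightarrow> 'e \<Rightarrow> 'a tvec" where
  "coord_vec A p c w = (case c of (U, \<phi>) \<Rightarrow> Tvec (\<lambda>f.
     if smooth_near A p f then frechet_derivative (f \<circ> inv_into U \<phi>) (at (\<phi> p)) w else 0))"

definition tangent_space :: "('a::topological_space, 'e::euclidean_space) atlas \<Rightarrow> 'a \<Rightarrow> 'a tvec set" where
  "tangent_space A p = {coord_vec A p c w | c w. c \<in> A \<and> p \<in> fst c}"

type_synonym 'a vfield = "'a \<Rightarrow> 'a tvec"
type_synonym 'a endo = "'a \<Rightarrow> 'a tvec \<Rightarrow> 'a tvec"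
type_synonym 'a one_form = "'a \<Rightarrow> 'a tvec \<Rightarrow> real"
type_synonym 'a metric = "'a \<Rightarrow> 'a tvec \<Rightarrow> 'a tvec \<Rightarrow> real"

definition smooth_field :: "('a::topological_space, 'e::euclidean_space) atlas \<Rightarrow> 'a set \<Rightarrow> 'a vfield \<Rightarrow> bool" where
  "smooth_field A U X \<longleftrightarrow> (\<forall>p\<in>U. X p \<in> tangent_space A p) \<and>
     (\<forall>V f. open_in A V \<and> V \<subseteq> U \<and> smooth_fun A V f \<longrightarrow> smooth_fun A V (\<lambda>p. act (X p) f))"

definition field_near :: "('a::topological_space, 'e::euclidean_space) atlas \<Rightarrow> 'a \<Rightarrow> 'a vfield \<Rightarrow> bool" where
  "field_near A p X \<longleftrightarrow> (\<exists>U. open_in A U \<and> p \<in> U \<and> smooth_field A U X)"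

definition lie_bracket :: "('a::topological_space, 'e::euclidean_space) atlas \<Rightarrow> 'a vfield \<Rightarrow> 'a vfield \<Rightarrow> 'a vfield" where
  "lie_bracket A X Y p = Tvec (\<lambda>f. if smooth_near A p f
     then act (X p) (\<lambda>q. act (Y q) f) - act (Y p) (\<lambda>q. act (X q) f) else 0)"

definition smooth_endo :: "('a::topological_space, 'e::euclidean_space) atlas \<Rightarrow> 'a endo \<Rightarrow> bool" where
  "smooth_endo A P \<longleftrightarrow>
     (\<forall>p\<in>points A. \<forall>x\<in>tangent_space A p. P p x \<in> tangent_space A p \<and>
        (\<forall>y\<in>tangent_space A p. P p (x + y) = P p x + P p y) \<and>
        (\<forall>a. P p (a *\<^sub>R x) = a *\<^sub>R P p x)) \<and>
     (\<forall>U X. open_in A U \<and> smooth_field A U X \<longrightarrow> smooth_field A U (\<lambda>p. P p (X p)))"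

definition smooth_one_form :: "('a::topological_space, 'e::euclidean_space) atlas \<Rightarrow> 'a one_form \<Rightarrow> bool" where
  "smooth_one_form A \<alpha> \<longleftrightarrow>
     (\<forall>p\<in>points A. \<forall>x\<in>tangent_space A p.
        (\<forall>y\<in>tangent_space A p. \<alpha> p (x + y) = \<alpha> p x + \<alpha> p y) \<and>
        (\<forall>a. \<alpha> p (a *\<^sub>R x) = a * \<alpha> p x)) \<and>
     (\<forall>U X. open_in A U \<and> smooth_field A U X \<longrightarrow> smooth_fun A U (\<lambda>p. \<alpha> p (X p)))"

definition riemannian_metric :: "('a::topological_space, 'e::euclidean_space) atlas \<Rightarrow> 'a metric \<Rightarrow> bool" where
  "riemannian_metric A g \<longleftrightarrow>
     (\<forall>p\<in>points A. \<forall>x\<in>tangent_space A p. \<forall>y\<in>tangent_space A p.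
        g p x y = g p y x \<and>
        (\<forall>z\<in>tangent_space A p. g p (x + y) z = g p x z + g p y z) \<and>
        (\<forall>a. g p (a *\<^sub>R x) y = a * g p x y) \<and>
        (x \<noteq> 0 \<longrightarrow> g p x x > 0)) \<and>
     (\<forall>U X Y. open_in A U \<and> smooth_field A U X \<and> smooth_field A U Y \<longrightarrow>
        smooth_fun A U (\<lambda>p. g p (X p) (Y p)))"


section \<open>Traces\<close>

text \<open>Both traces are computed in some basis of the finite-dimensional subspace \<open>S\<close>; the result does
  not depend on the basis. In the second one \<open>H\<close> is the inverse \<open>(g\<^sup>i\<^sup>j)\<close> of the Gram matrix.\<close>

definition some_basis :: "'v::real_vector set \<Rightarrow> 'v set" where
  "some_basis S = (SOME B. independent B \<and> span B = S)"

definition endo_trace :: "'v::real_vector set \<Rightarrow> ('v \<Rightarrow> 'v) \<Rightarrow> real" where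
  "endo_trace S L = (\<Sum>b\<in>some_basis S. representation (some_basis S) (L b) b)"

definition inverse_gram :: "('v::real_vector \<Rightarrow> 'v \<Rightarrow> real) \<Rightarrow> 'v set \<Rightarrow> 'v \<Rightarrow> 'v \<Rightarrow> real" where
  "inverse_gram g B = (SOME H. \<forall>b\<in>B. \<forall>c\<in>B. (\<Sum>d\<in>B. H b d * g d c) = (if b = c then 1 else 0))"

definition metric_trace :: "('v::real_vector \<Rightarrow> 'v \<Rightarrow> real) \<Rightarrow> 'v set \<Rightarrow> ('v \<Rightarrow> 'v \<Rightarrow> real) \<Rightarrow> real" where
  "metric_trace g S T = (\<Sum>b\<in>some_basis S. \<Sum>c\<in>some_basis S. inverse_gram g (some_basis S) b c * T b c)"


section \<open>Levi-Civita connection and curvature\<close>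

text \<open>\<open>D p x Y\<close> is \<open>\<nabla>\<^sub>x Y\<close> at \<open>p\<close>, for \<open>x\<close> tangent at \<open>p\<close> and \<open>Y\<close> a vector field defined near \<open>p\<close>.
  Allowing local fields is the usual localization of a connection on globally defined fields. Values of \<open>D\<close>
  on other arguments are irrelevant.\<close>

type_synonym 'a connection = "'a \<Rightarrow> 'a tvec \<Rightarrow> 'a vfield \<Rightarrow> 'a tvec"

definition affine_connection ::
    "('a::topological_space, 'e::euclidean_space) atlas \<Rightarrow> 'a connection \<Rightarrow> bool" where
  "affine_connection A D \<longleftrightarrow>
     (\<forall>p\<in>points A. \<forall>x\<in>tangent_space A p. \<forall>Y. field_near A p Y \<longrightarrow>
        D p x Y \<in> tangent_space A p \<and>
        (\<forall>y\<in>tangent_space A p. D p (x + y) Y = D p x Y + D p y Y) \<and>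
        (\<forall>a. D p (a *\<^sub>R x) Y = a *\<^sub>R D p x Y) \<and>
        (\<forall>Z. field_near A p Z \<longrightarrow> D p x (\<lambda>q. Y q + Z q) = D p x Y + D p x Z) \<and>
        (\<forall>f. smooth_near A p f \<longrightarrow>
           D p x (\<lambda>q. f q *\<^sub>R Y q) = act x f *\<^sub>R Y p + f p *\<^sub>R D p x Y)) \<and>
     (\<forall>U X Y. open_in A U \<and> smooth_field A U X \<and> smooth_field A U Y \<longrightarrow>
        smooth_field A U (\<lambda>p. D p (X p) Y))"

definition levi_civita ::
    "('a::topological_space, 'e::euclidean_space) atlas \<Rightarrow> 'a metric \<Rightarrow> 'a connection \<Rightarrow> bool" where
  "levi_civita A g D \<longleftrightarrow> affine_connection A D \<and>
     (\<forall>p\<in>points A. \<forall>X Y. field_near A p X \<and> field_near A p Y \<longrightarrow>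
        D p (X p) Y - D p (Y p) X = lie_bracket A X Y p) \<and>
     (\<forall>p\<in>points A. \<forall>x\<in>tangent_space A p. \<forall>Y Z. field_near A p Y \<and> field_near A p Z \<longrightarrow>
        act x (\<lambda>q. g q (Y q) (Z q)) = g p (D p x Y) (Z p) + g p (Y p) (D p x Z))"

definition curvature_fields ::
    "('a::topological_space, 'e::euclidean_space) atlas \<Rightarrow> 'a connection \<Rightarrow>
     'a vfield \<Rightarrow> 'a vfield \<Rightarrow> 'a vfield \<Rightarrow> 'a vfield" where
  "curvature_fields A D X Y Z p =
     D p (X p) (\<lambda>q. D q (Y q) Z) - D p (Y p) (\<lambda>q. D q (X q) Z) - D p (lie_bracket A X Y p) Z"

text \<open>The curvature is a tensor, so its value on tangent vectors at \<open>p\<close> may be computed with any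
  extensions of these to vector fields near \<open>p\<close>.\<close>

definition extension :: "('a::topological_space, 'e::euclidean_space) atlas \<Rightarrow> 'a \<Rightarrow> 'a tvec \<Rightarrow> 'a vfield" where
  "extension A p x = (SOME X. field_near A p X \<and> X p = x)"

definition curvature ::
    "('a::topological_space, 'e::euclidean_space) atlas \<Rightarrow> 'a connection \<Rightarrow> 'a \<Rightarrow>
     'a tvec \<Rightarrow> 'a tvec \<Rightarrow> 'a tvec \<Rightarrow> 'a tvec" where
  "curvature A D p x y z =
     curvature_fields A D (extension A p x) (extension A p y) (extension A p z) p"

definition curvature4 ::
    "('a::topological_space, 'e::euclidean_space) atlas \<Rightarrow> 'a metric \<Rightarrow> 'a connection \<Rightarrow> 'a \<Rightarrow>
     'a tvec \<Rightarrow> 'a tvec \<Rightarrow> 'a tvec \<Rightarrow> 'a tvec \<Rightarrow> real" where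
  "curvature4 A g D p x y z w = g p (curvature A D p x y z) w"

definition ricci ::
    "('a::topological_space, 'e::euclidean_space) atlas \<Rightarrow> 'a metric \<Rightarrow> 'a connection \<Rightarrow> 'a \<Rightarrow>
     'a tvec \<Rightarrow> 'a tvec \<Rightarrow> real" where
  "ricci A g D p y z = metric_trace (g p) (tangent_space A p) (\<lambda>u v. curvature4 A g D p u y z v)"

definition scalar_curvature ::
    "('a::topological_space, 'e::euclidean_space) atlas \<Rightarrow> 'a metric \<Rightarrow> 'a connection \<Rightarrow> 'a \<Rightarrow> real" where
  "scalar_curvature A g D p = metric_trace (g p) (tangent_space A p) (ricci A g D p)"

definition star_ricci ::
    "('a::topological_space, 'e::euclidean_space) atlas \<Rightarrow> 'a endo \<Rightarrow> 'a metric \<Rightarrow> 'a connection \<Rightarrow> 'a \<Rightarrow>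
     'a tvec \<Rightarrow> 'a tvec \<Rightarrow> real" where
  "star_ricci A F g D p y z =
     metric_trace (g p) (tangent_space A p) (\<lambda>u v. curvature4 A g D p u y z (F p v))"

definition star_scalar_curvature ::
    "('a::topological_space, 'e::euclidean_space) atlas \<Rightarrow> 'a endo \<Rightarrow> 'a metric \<Rightarrow> 'a connection \<Rightarrow> 'a \<Rightarrow> real" where
  "star_scalar_curvature A F g D p = metric_trace (g p) (tangent_space A p) (star_ricci A F g D p)"

text \<open>\<open>is_plane_basis A p x y\<close>: \<open>x, y\<close> form a basis of a 2-plane in the tangent space at \<open>p\<close>.\<close>

definition is_plane_basis ::
    "('a::topological_space, 'e::euclidean_space) atlas \<Rightarrow> 'a \<Rightarrow> 'a tvec \<Rightarrow> 'a tvec \<Rightarrow> bool" where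
  "is_plane_basis A p x y \<longleftrightarrow>
     x \<in> tangent_space A p \<and> y \<in> tangent_space A p \<and> x \<noteq> y \<and> independent {x, y}"

definition sectional_curvature ::
    "('a::topological_space, 'e::euclidean_space) atlas \<Rightarrow> 'a metric \<Rightarrow> 'a connection \<Rightarrow> 'a \<Rightarrow>
     'a tvec \<Rightarrow> 'a tvec \<Rightarrow> real" where
  "sectional_curvature A g D p x y =
     curvature4 A g D p x y y x / (g p x x * g p y y - (g p x y)\<^sup>2)"

text \<open>\<open>k\<close> is the pointwise constant sectional curvature (on a surface: the Gaussian curvature).\<close>

definition pointwise_sectional_curvature ::
    "('a::topological_space, 'e::euclidean_space) atlas \<Rightarrow> 'a metric \<Rightarrow> 'a connection \<Rightarrow> ('a \<Rightarrow> real) \<Rightarrow> bool" where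
  "pointwise_sectional_curvature A g D k \<longleftrightarrow>
     (\<forall>p\<in>points A. \<forall>x y. is_plane_basis A p x y \<longrightarrow> sectional_curvature A g D p x y = k p)"


section \<open>Almost paracomplex and almost paracontact almost paracomplex Riemannian manifolds\<close>

definition almost_paracomplex_riemannian ::
    "('a::{t2_space,second_countable_topology}, 'e::euclidean_space) atlas \<Rightarrow> 'a endo \<Rightarrow> 'a metric \<Rightarrow> bool" where
  "almost_paracomplex_riemannian A P h \<longleftrightarrow>
     smooth_atlas A \<and> even (DIM('e)) \<and> smooth_endo A P \<and> riemannian_metric A h \<and>
     (\<forall>p\<in>points A.
        (\<forall>x\<in>tangent_space A p. P p (P p x) = x) \<and>
        (\<exists>x\<in>tangent_space A p. P p x \<noteq> x) \<and>
        endo_trace (tangent_space A p) (P p) = 0 \<and>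
        (\<forall>x\<in>tangent_space A p. \<forall>y\<in>tangent_space A p. h p (P p x) (P p y) = h p x y))"

definition apapR_manifold ::
    "('a::{t2_space,second_countable_topology}, 'e::euclidean_space) atlas \<Rightarrow> 'a endo \<Rightarrow> 'a vfield \<Rightarrow>
     'a one_form \<Rightarrow> 'a metric \<Rightarrow> bool" where
  "apapR_manifold A F \<xi> \<eta> g \<longleftrightarrow>
     smooth_atlas A \<and> odd (DIM('e)) \<and> smooth_endo A F \<and> smooth_field A (points A) \<xi> \<and>
     smooth_one_form A \<eta> \<and> riemannian_metric A g \<and>
     (\<forall>p\<in>points A.
        (\<forall>x\<in>tangent_space A p. F p (F p x) = x - \<eta> p x *\<^sub>R \<xi> p) \<and>
        \<eta> p (\<xi> p) = 1 \<and>
        (\<forall>x\<in>tangent_space A p. \<eta> p (F p x) = 0) \<and>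
        F p (\<xi> p) = 0 \<and>
        endo_trace (tangent_space A p) (F p) = 0 \<and>
        (\<forall>x\<in>tangent_space A p. \<forall>y\<in>tangent_space A p.
           g p (F p x) (F p y) = g p x y - \<eta> p x * \<eta> p y))"


section \<open>The cone\<close>

definition cone_atlas :: "('a, 'e) atlas \<Rightarrow> (real \<times> 'a, real \<times> 'e) atlas" where
  "cone_atlas A = (\<lambda>(U, \<phi>). ({0<..} \<times> U, map_prod id \<phi>)) ` A"

text \<open>The tangent vector \<open>(x', a d/dt)\<close> at \<open>(t, p)\<close>. The components of a tangent vector are recovered as
  \<open>horizontal\<close> (its image under the differential of the projection to the base) and \<open>radial\<close>
  (its action on the coordinate \<open>t\<close>).\<close>

definition cone_vec ::
    "('a::topological_space, 'e::euclidean_space) atlas \<Rightarrow> real \<times> 'a \<Rightarrow> 'a tvec \<Rightarrow> real \<Rightarrow> (real \<times> 'a) tvec" where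
  "cone_vec A z x a = (case z of (t, p) \<Rightarrow> Tvec (\<lambda>f. if smooth_near (cone_atlas A) (t, p) f
     then act x (\<lambda>q. f (t, q)) + a * deriv (\<lambda>s. f (s, p)) t else 0))"

definition horizontal :: "(real \<times> 'a) tvec \<Rightarrow> 'a tvec" where
  "horizontal v = Tvec (\<lambda>f. act v (f \<circ> snd))"

definition radial :: "(real \<times> 'a) tvec \<Rightarrow> real" where
  "radial v = act v fst"

definition cone_metric :: "'a metric \<Rightarrow> (real \<times> 'a) metric" where
  "cone_metric h z v w =
     (fst z)\<^sup>2 * h (snd z) (horizontal v) (horizontal w) + radial v * radial w"

definition cone_endo :: "('a::topological_space, 'e::euclidean_space) atlas \<Rightarrow> 'a endo \<Rightarrow> (real \<times> 'a) endo" where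
  "cone_endo A P z v = cone_vec A z (P (snd z) (horizontal v)) 0"

definition cone_xi :: "('a::topological_space, 'e::euclidean_space) atlas \<Rightarrow> (real \<times> 'a) vfield" where
  "cone_xi A z = cone_vec A z 0 1"

definition cone_eta :: "(real \<times> 'a) one_form" where
  "cone_eta z v = radial v"

end

theory Submission
  imports Defs
begin

text \<open>
  The Levi-Civita connection \<open>D\<close> of the cone metric \<open>g = dt\<^sup>2 + t\<^sup>2 h\<close> is governed by the Koszul formula. With \<open>D'\<close> the
  connection of \<open>h\<close>, \<open>\<xi> = d/dt\<close> and lifts \<open>X\<close>, \<open>Y\<close> of vector fields of the base,

    \<open>D\<^sub>X Y = D'\<^sub>X Y - t h(X,Y) \<xi>\<close>,  \<open>D\<^sub>X \<xi> = D\<^sub>\<xi> X = X / t\<close>,  \<open>D\<^sub>\<xi> \<xi> = 0\<close>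

  (\<open>D_lift_lift\<close>, \<open>D_lift_xi\<close>, \<open>D_xi_lift\<close>, \<open>D_xi_xi\<close>). Differentiating once more shows that the curvature is horizontal:
  it vanishes as soon as one argument is \<open>\<xi>\<close>, and otherwise
  \<open>R(X,Y)Z = R'(X,Y)Z - (h(Y,Z) X - h(X,Z) Y)\<close> (\<open>curvature_cone_vec\<close>). Since the correction is the curvature of the
  unit sphere, over a surface of Gaussian curvature \<open>k'\<close> this is \<open>k' - 1\<close> times \<open>h(Y,Z) X - h(X,Z) Y\<close>.

  A plane containing \<open>\<xi>\<close> has horizontal parts that are linearly dependent, so its sectional curvature is \<open>0\<close>. For the
  scalar curvatures, \<open>P\<close> has at each point an orthonormal eigenbasis \<open>e\<^sub>1, e\<^sub>2\<close> with eigenvalues \<open>1, -1\<close>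
  (\<open>paracomplex_frame\<close>), and \<open>\<xi>, e\<^sub>1/t, e\<^sub>2/t\<close> is an orthonormal frame of the cone in which both traces can be evaluated
  (\<open>metric_trace_metric_trace_eq\<close>). Only the plane of \<open>e\<^sub>1\<close> and \<open>e\<^sub>2\<close> contributes, with sectional curvature
  \<open>(k' - 1)/t\<^sup>2\<close>: twice with the same sign to \<open>\<tau>\<close>, which is therefore \<open>2(k' - 1)/t\<^sup>2\<close>, and with the opposite signs
  \<open>1\<close> and \<open>-1\<close> to \<open>\<tau>\<^sup>*\<close>, which is therefore \<open>0\<close>.

  Curvature is defined through an arbitrary choice of fields extending three tangent vectors. That lifts may be used
  instead rests on tensoriality (\<open>R_pointwise\<close>): an operator that is linear over the smooth functions sees only the
  value of a field at the point.
\<close>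

section \<open>Calculus of smooth maps between Euclidean spaces\<close>

lemma Ck_subset: "Ck k S f \<Longrightarrow> T \<subseteq> S \<Longrightarrow> Ck k T f"
  by (induction k arbitrary: f) (auto intro: continuous_on_subset)

lemma Ck_Suc_imp_Ck: "Ck (Suc k) S f \<Longrightarrow> Ck k S f"
proof (induction k arbitrary: f)
  case 0
  then show ?case
    by (auto intro!: continuous_at_imp_continuous_on differentiable_imp_continuous_within)
next
  case (Suc k)
  have "Ck k S (\<lambda>x. frechet_derivative f (at x) v)" for v
    by (rule Suc.IH) (use Suc.prems in simp)
  then show ?case using Suc.prems by simp
qed

lemma Ck_local:
  assumes "\<And>x. x \<in> S \<Longrightarrow> \<exists>T. open T \<and> x \<in> T \<and> Ck k T f"
  shows "Ck k S f"
  using assms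
proof (induction k arbitrary: f)
  case 0
  have "isCont f x" if "x \<in> S" for x
    using 0[OF that] by (auto simp: continuous_on_eq_continuous_at)
  then show ?case by (simp add: continuous_at_imp_continuous_on)
next
  case (Suc k)
  have "f differentiable (at x)" if "x \<in> S" for x
    using Suc.prems[OF that] by auto
  moreover have "Ck k S (\<lambda>x. frechet_derivative f (at x) v)" for v
  proof (rule Suc.IH)
    fix x assume "x \<in> S"
    with Suc.prems obtain T where "open T" "x \<in> T" "Ck (Suc k) T f" by blast
    then show "\<exists>T. open T \<and> x \<in> T \<and> Ck k T (\<lambda>x. frechet_derivative f (at x) v)" by auto
  qed
  ultimately show ?case by simp
qed

lemma frechet_derivative_worksI:
  "f differentiable F \<Longrightarrow> (f has_derivative frechet_derivative f F) F"
  using frechet_derivative_works by blast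

lemma Ck_cong:
  assumes "open S" "\<And>x. x \<in> S \<Longrightarrow> f x = g x"
  shows "Ck k S f = Ck k S g"
proof -
  have *: "Ck k S g" if "Ck k S f" "\<And>x. x \<in> S \<Longrightarrow> f x = g x" for f g :: "'a \<Rightarrow> 'b"
    using that
  proof (induction k arbitrary: f g)
    case 0
    have "continuous_on S f = continuous_on S g"
      by (rule continuous_on_cong[OF refl 0(2)])
    with 0(1) show ?case by simp
  next
    case (Suc k)
    have d: "(g has_derivative frechet_derivative f (at x)) (at x)" if "x \<in> S" for x
    proof (rule has_derivative_transform_within_open[OF _ assms(1) that Suc.prems(2)])
      show "(f has_derivative frechet_derivative f (at x)) (at x)"
        by (rule frechet_derivative_worksI) (use Suc.prems(1) that in simp)
    qed
    have eq: "frechet_derivative f (at x) v = frechet_derivative g (at x) v" if "x \<in> S" for x v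
      using frechet_derivative_at[OF d[OF that]] by (rule arg_cong)
    have "Ck k S (\<lambda>x. frechet_derivative f (at x) v)" for v
      using Suc.prems(1) by (auto simp only: Ck.simps)
    then have "Ck k S (\<lambda>x. frechet_derivative g (at x) v)" for v
      by (rule Suc.IH) (rule eq)
    moreover have "g differentiable (at x)" if "x \<in> S" for x
      using d[OF that] unfolding differentiable_def by blast
    ultimately show ?case by simp
  qed
  show ?thesis by (rule iffI) (erule *, simp add: assms(2))+
qed

lemma Ck_const: "Ck k S (\<lambda>x. c)"
  by (induction k arbitrary: c) auto

lemma Ck_bounded_linear:
  assumes "bounded_linear L"
  shows "Ck k S L"
proof (cases k)
  case 0
  then show ?thesis using assms by (simp add: linear_continuous_on)
next
  case (Suc m)
  have "frechet_derivative L (at x) = L" for x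
    using frechet_derivative_at[OF bounded_linear_imp_has_derivative[OF assms, of "at x"]] by simp
  then show ?thesis
    using Suc bounded_linear_imp_differentiable[OF assms] by (auto simp: Ck_const)
qed

text \<open>The functions computing the derivative on \<open>S\<close> may differ from it elsewhere, so formulas such as the product rule
  can be used for \<open>f'\<close>.\<close>

lemma Ck_SucI:
  assumes "open S" "\<And>x. x \<in> S \<Longrightarrow> (f has_derivative f' x) (at x)"
    "\<And>v. Ck k S (\<lambda>x. f' x v)"
  shows "Ck (Suc k) S f"
proof -
  have "frechet_derivative f (at x) v = f' x v" if "x \<in> S" for x v
    using frechet_derivative_at[OF assms(2)[OF that]] by simp
  then have "Ck k S (\<lambda>x. frechet_derivative f (at x) v)" for v
    using Ck_cong[OF assms(1), of "\<lambda>x. frechet_derivative f (at x) v" "\<lambda>x. f' x v"] assms(3) by auto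
  then show ?thesis using assms(2) by (auto simp: differentiable_def)
qed

lemma Ck_SucD: "Ck (Suc k) S f \<Longrightarrow> x \<in> S \<Longrightarrow> (f has_derivative frechet_derivative f (at x)) (at x)"
  by (simp add: frechet_derivative_works)

lemma Ck_add:
  assumes "open S" "Ck k S f" "Ck k S g"
  shows "Ck k S (\<lambda>x. f x + g x)"
  using assms(2,3)
proof (induction k arbitrary: f g)
  case 0
  then show ?case by (auto intro: continuous_intros)
next
  case (Suc k)
  show ?case
    by (rule Ck_SucI[OF assms(1) has_derivative_add]) (use Suc in \<open>auto intro: Ck_SucD\<close>)
qed

lemma Ck_scaleR:
  assumes "open S" "Ck k S r" "Ck k S f"
  shows "Ck k S (\<lambda>x. r x *\<^sub>R f x)"
  using assms(2,3)
proof (induction k arbitrary: r f)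
  case 0
  then show ?case by (auto intro: continuous_intros)
next
  case (Suc k)
  have "Ck k S r" "Ck k S f" using Suc.prems Ck_Suc_imp_Ck by blast+
  with Suc show ?case
    by (intro Ck_SucI[OF assms(1) has_derivative_scaleR] Ck_add[OF assms(1)])
      (auto intro: Ck_SucD)
qed

lemma Ck_sum:
  assumes "open S" "\<And>i. i \<in> I \<Longrightarrow> Ck k S (f i)"
  shows "Ck k S (\<lambda>x. \<Sum>i\<in>I. f i x)"
  using assms(2)
  by (induction I rule: infinite_finite_induct) (auto simp: Ck_const intro: Ck_add[OF assms(1)])

lemma Ck_Pair:
  assumes "open S" "Ck k S f" "Ck k S g"
  shows "Ck k S (\<lambda>x. (f x, g x))"
  using assms(2,3)
proof (induction k arbitrary: f g)
  case 0
  then show ?case by (auto intro: continuous_intros)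
next
  case (Suc k)
  show ?case
    by (rule Ck_SucI[OF assms(1) has_derivative_Pair]) (use Suc in \<open>auto intro: Ck_SucD\<close>)
qed

lemma Ck_bounded_linear_compose:
  assumes "open S" "bounded_linear L" "Ck k S f"
  shows "Ck k S (\<lambda>x. L (f x))"
  using assms(3)
proof (induction k arbitrary: f)
  case 0
  then show ?case using assms(2) by (simp add: bounded_linear.continuous_on)
next
  case (Suc k)
  show ?case
    by (rule Ck_SucI[OF assms(1) bounded_linear.has_derivative[OF assms(2)]])
      (use Suc in \<open>auto intro: Ck_SucD\<close>)
qed

lemma linear_euclidean_expand:
  fixes L :: "'e::euclidean_space \<Rightarrow> 'f::real_vector"
  assumes "linear L"
  shows "L v = (\<Sum>b\<in>Basis. (v \<bullet> b) *\<^sub>R L b)"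
proof -
  have "L v = L (\<Sum>b\<in>Basis. (v \<bullet> b) *\<^sub>R b)" by (simp add: euclidean_representation)
  also have "\<dots> = (\<Sum>b\<in>Basis. (v \<bullet> b) *\<^sub>R L b)"
    by (simp add: linear_sum[OF assms] linear_cmul[OF assms])
  finally show ?thesis .
qed

text \<open>By the chain rule the derivative of \<open>f \<circ> u\<close> in direction \<open>v\<close> is
  \<open>\<Sum>\<^sub>b (\<partial>\<^sub>v u \<bullet> b) (\<partial>\<^sub>b f \<circ> u)\<close>, in which the compositions \<open>\<partial>\<^sub>b f \<circ> u\<close> are of lower order.\<close>

lemma Ck_compose:
  fixes u :: "'e::euclidean_space \<Rightarrow> 'f::euclidean_space"
  assumes "open S" "open T" "u ` S \<subseteq> T" "Ck k S u" "Ck k T f"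
  shows "Ck k S (\<lambda>x. f (u x))"
  using assms(4,5)
proof (induction k arbitrary: f)
  case 0
  then show ?case
    using continuous_on_compose2[of T f S u] assms(3) by simp
next
  case (Suc k)
  let ?f' = "\<lambda>y. frechet_derivative f (at y)" and ?u' = "\<lambda>x. frechet_derivative u (at x)"
  have f': "(f has_derivative ?f' (u x)) (at (u x))" if "x \<in> S" for x
    by (rule Ck_SucD[OF Suc.prems(2)]) (use that assms(3) in auto)
  have "((\<lambda>x. f (u x)) has_derivative (\<lambda>v. \<Sum>b\<in>Basis. (?u' x v \<bullet> b) *\<^sub>R ?f' (u x) b)) (at x)"
    if "x \<in> S" for x
  proof -
    have "((\<lambda>x. f (u x)) has_derivative (\<lambda>v. ?f' (u x) (?u' x v))) (at x)"
      using has_derivative_compose[OF Ck_SucD[OF Suc.prems(1) that] f'[OF that]] .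
    also have "(\<lambda>v. ?f' (u x) (?u' x v)) = (\<lambda>v. \<Sum>b\<in>Basis. (?u' x v \<bullet> b) *\<^sub>R ?f' (u x) b)"
      by (rule ext) (rule linear_euclidean_expand[OF has_derivative_linear[OF f'[OF that]]])
    finally show ?thesis .
  qed
  moreover have "Ck k S (\<lambda>x. (?u' x v \<bullet> b) *\<^sub>R ?f' (u x) b)" for v b
  proof (rule Ck_scaleR[OF assms(1)])
    show "Ck k S (\<lambda>x. ?u' x v \<bullet> b)"
      using Suc.prems(1) by (intro Ck_bounded_linear_compose[OF assms(1) bounded_linear_inner_left]) auto
    show "Ck k S (\<lambda>x. ?f' (u x) b)"
      by (rule Suc.IH[OF Ck_Suc_imp_Ck[OF Suc.prems(1)]]) (use Suc.prems(2) in simp)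
  qed
  then have "Ck k S (\<lambda>x. \<Sum>b\<in>Basis. (?u' x v \<bullet> b) *\<^sub>R ?f' (u x) b)" for v
    by (rule Ck_sum[OF assms(1)])
  ultimately show ?case by (rule Ck_SucI[OF assms(1)])
qed

lemma smooth_on_subset: "smooth_on S f \<Longrightarrow> T \<subseteq> S \<Longrightarrow> smooth_on T f"
  by (auto simp: smooth_on_def intro: Ck_subset)

lemma smooth_on_local:
  "(\<And>x. x \<in> S \<Longrightarrow> \<exists>T. open T \<and> x \<in> T \<and> smooth_on T f) \<Longrightarrow> smooth_on S f"
  unfolding smooth_on_def by (meson Ck_local)

lemma smooth_on_cong:
  "open S \<Longrightarrow> (\<And>x. x \<in> S \<Longrightarrow> f x = g x) \<Longrightarrow> smooth_on S f = smooth_on S g"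
  by (simp add: smooth_on_def Ck_cong[of S f g])

lemma smooth_on_const: "smooth_on S (\<lambda>x. c)"
  by (simp add: smooth_on_def Ck_const)

lemma smooth_on_linear: "bounded_linear L \<Longrightarrow> smooth_on S L"
  by (simp add: smooth_on_def Ck_bounded_linear)

lemma smooth_on_add: "open S \<Longrightarrow> smooth_on S f \<Longrightarrow> smooth_on S g \<Longrightarrow> smooth_on S (\<lambda>x. f x + g x)"
  by (simp add: smooth_on_def Ck_add)

lemma smooth_on_mult:
  fixes f g :: "_ \<Rightarrow> real"
  shows "open S \<Longrightarrow> smooth_on S f \<Longrightarrow> smooth_on S g \<Longrightarrow> smooth_on S (\<lambda>x. f x * g x)"
  using Ck_scaleR[of S _ f g] by (simp add: smooth_on_def)

lemma smooth_on_Pair: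
  "open S \<Longrightarrow> smooth_on S f \<Longrightarrow> smooth_on S g \<Longrightarrow> smooth_on S (\<lambda>x. (f x, g x))"
  by (simp add: smooth_on_def Ck_Pair)

lemma smooth_on_linear_compose:
  "open S \<Longrightarrow> bounded_linear L \<Longrightarrow> smooth_on S f \<Longrightarrow> smooth_on S (\<lambda>x. L (f x))"
  by (simp add: smooth_on_def Ck_bounded_linear_compose)

lemma smooth_on_compose:
  fixes u :: "'e::euclidean_space \<Rightarrow> 'f::euclidean_space"
  shows "open S \<Longrightarrow> open T \<Longrightarrow> u ` S \<subseteq> T \<Longrightarrow> smooth_on S u \<Longrightarrow> smooth_on T f \<Longrightarrow>
    smooth_on S (\<lambda>x. f (u x))"
  by (simp add: smooth_on_def Ck_compose)

lemma smooth_on_derivative: "smooth_on S f \<Longrightarrow> smooth_on S (\<lambda>x. frechet_derivative f (at x) v)"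
  using Ck.simps(2)[of _ S f] by (simp add: smooth_on_def del: Ck.simps)

lemma smooth_on_has_derivative:
  "smooth_on S f \<Longrightarrow> x \<in> S \<Longrightarrow> (f has_derivative frechet_derivative f (at x)) (at x)"
  using Ck_SucD[of 0 S f x] by (simp add: smooth_on_def del: Ck.simps)

section \<open>Smooth functions, tangent vectors and vector fields\<close>

lemma tvec_eqI: "(\<And>f. act v f = act w f) \<Longrightarrow> v = w"
  by (simp add: act_inject[symmetric] ext)

lemma act_simps [simp]:
  "act 0 f = 0" "act (v + w) f = act v f + act w f" "act (v - w) f = act v f - act w f"
  "act (- v) f = - act v f" "act (r *\<^sub>R v) f = r * act v f"
  by (simp_all add: zero_tvec_def plus_tvec_def minus_tvec_def uminus_tvec_def scaleR_tvec_def
      Tvec_inverse)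

lemma act_sum [simp]: "act (\<Sum>i\<in>I. v i) f = (\<Sum>i\<in>I. act (v i) f)"
  by (induction I rule: infinite_finite_induct) auto

lemma act_Tvec [simp]: "act (Tvec F) = F"
  by (simp add: Tvec_inverse)

locale manifold =
  fixes A :: "('a::topological_space, 'e::euclidean_space) atlas"
  assumes smooth_atlas: "smooth_atlas A"
begin

lemma chart:
  assumes "(U, \<phi>) \<in> A"
  shows "open U" "open (\<phi> ` U)" "inj_on \<phi> U" "continuous_on (\<phi> ` U) (inv_into U \<phi>)"
    "continuous_on U \<phi>"
  using smooth_atlas assms unfolding smooth_atlas_def is_chart_def by auto

lemma transition:
  "(U, \<phi>) \<in> A \<Longrightarrow> (V, \<psi>) \<in> A \<Longrightarrow> smooth_on (\<phi> ` (U \<inter> V)) (\<psi> \<circ> inv_into U \<phi>)"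
  using smooth_atlas unfolding smooth_atlas_def by auto

lemma open_points: "open (points A)"
  unfolding points_def using chart(1) by auto

lemma point_in_chart:
  assumes "p \<in> points A"
  obtains U \<phi> where "(U, \<phi>) \<in> A" "p \<in> U"
  using assms unfolding points_def by auto

lemma chart_subset_points: "(U, \<phi>) \<in> A \<Longrightarrow> U \<subseteq> points A"
  unfolding points_def by force

lemma inv_chart [simp]: "(U, \<phi>) \<in> A \<Longrightarrow> p \<in> U \<Longrightarrow> inv_into U \<phi> (\<phi> p) = p"
  using chart(3) by simp

lemma open_chart_image:
  assumes "(U, \<phi>) \<in> A" "open V"
  shows "open (\<phi> ` (U \<inter> V))"
proof -
  have "\<phi> ` (U \<inter> V) = \<phi> ` U \<inter> inv_into U \<phi> -` V"
    using chart(3)[OF assms(1)] by (auto simp: inj_on_def)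
  then show ?thesis
    using continuous_on_open_vimage[OF chart(2)[OF assms(1)]] chart(4)[OF assms(1)] assms(2)
    by (metis Int_commute)
qed

lemma smooth_funI:
  "(\<And>U \<phi>. (U, \<phi>) \<in> A \<Longrightarrow> smooth_on (\<phi> ` (U \<inter> V)) (f \<circ> inv_into U \<phi>)) \<Longrightarrow> smooth_fun A V f"
  unfolding smooth_fun_def by auto

lemma smooth_funD:
  "smooth_fun A V f \<Longrightarrow> (U, \<phi>) \<in> A \<Longrightarrow> smooth_on (\<phi> ` (U \<inter> V)) (f \<circ> inv_into U \<phi>)"
  unfolding smooth_fun_def by auto

lemma smooth_fun_subset: "smooth_fun A V f \<Longrightarrow> W \<subseteq> V \<Longrightarrow> smooth_fun A W f"
  by (meson Int_mono image_mono order_refl smooth_funD smooth_funI smooth_on_subset)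

lemma smooth_fun_local:
  assumes "\<And>p. p \<in> V \<Longrightarrow> \<exists>W. open W \<and> p \<in> W \<and> smooth_fun A W f"
  shows "smooth_fun A V f"
proof (rule smooth_funI)
  fix U \<phi> assume c: "(U, \<phi>) \<in> A"
  show "smooth_on (\<phi> ` (U \<inter> V)) (f \<circ> inv_into U \<phi>)"
  proof (rule smooth_on_local)
    fix x assume "x \<in> \<phi> ` (U \<inter> V)"
    then obtain p where "p \<in> U" "p \<in> V" "x = \<phi> p" by auto
    moreover then obtain W where "open W" "p \<in> W" "smooth_fun A W f" using assms by blast
    ultimately show "\<exists>T. open T \<and> x \<in> T \<and> smooth_on T (f \<circ> inv_into U \<phi>)"
      using open_chart_image[OF c] smooth_funD[OF _ c] by (metis Int_iff imageI)
  qed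
qed

lemma smooth_fun_cong:
  assumes "open V" "\<And>p. p \<in> V \<Longrightarrow> f p = g p"
  shows "smooth_fun A V f = smooth_fun A V g"
proof -
  have "smooth_on (\<phi> ` (U \<inter> V)) (f \<circ> inv_into U \<phi>) = smooth_on (\<phi> ` (U \<inter> V)) (g \<circ> inv_into U \<phi>)"
    if "(U, \<phi>) \<in> A" for U \<phi>
    by (rule smooth_on_cong[OF open_chart_image[OF that assms(1)]]) (use that assms(2) in auto)
  then show ?thesis unfolding smooth_fun_def by auto
qed

lemma smooth_fun_const: "smooth_fun A V (\<lambda>p. c)"
  by (rule smooth_funI) (simp add: comp_def smooth_on_const)

lemma smooth_fun_add:
  assumes V: "open V" and f: "smooth_fun A V f" and g: "smooth_fun A V g"
  shows "smooth_fun A V (\<lambda>p. f p + g p)"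
proof (rule smooth_funI)
  fix U \<phi> assume c: "(U, \<phi>) \<in> A"
  show "smooth_on (\<phi> ` (U \<inter> V)) ((\<lambda>p. f p + g p) \<circ> inv_into U \<phi>)"
    using smooth_on_add[OF open_chart_image[OF c V] smooth_funD[OF f c] smooth_funD[OF g c]]
    by (simp add: comp_def)
qed

lemma smooth_fun_mult:
  assumes V: "open V" and f: "smooth_fun A V f" and g: "smooth_fun A V g"
  shows "smooth_fun A V (\<lambda>p. f p * g p)"
proof (rule smooth_funI)
  fix U \<phi> assume c: "(U, \<phi>) \<in> A"
  show "smooth_on (\<phi> ` (U \<inter> V)) ((\<lambda>p. f p * g p) \<circ> inv_into U \<phi>)"
    using smooth_on_mult[OF open_chart_image[OF c V] smooth_funD[OF f c] smooth_funD[OF g c]]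
    by (simp add: comp_def)
qed

lemma smooth_fun_sum:
  "open V \<Longrightarrow> (\<And>i. i \<in> I \<Longrightarrow> smooth_fun A V (f i)) \<Longrightarrow> smooth_fun A V (\<lambda>p. \<Sum>i\<in>I. f i p)"
  by (induction I rule: infinite_finite_induct) (auto simp: smooth_fun_const intro: smooth_fun_add)

lemma smooth_fun_coordinate:
  assumes "(U, \<phi>) \<in> A" "V \<subseteq> U" "open V"
  shows "smooth_fun A V (\<lambda>q. \<phi> q \<bullet> b)"
proof (rule smooth_funI)
  fix W \<psi> assume "(W, \<psi>) \<in> A"
  with assms show "smooth_on (\<psi> ` (W \<inter> V)) ((\<lambda>q. \<phi> q \<bullet> b) \<circ> inv_into W \<psi>)"
    using smooth_on_linear_compose[OF open_chart_image bounded_linear_inner_left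
        smooth_on_subset[OF transition], of W \<psi> V W \<psi> U \<phi> b]
    by (auto simp: comp_def)
qed

text \<open>In another chart \<open>\<psi>\<close> the partial derivative with respect to \<open>\<phi>\<close> is
  \<open>\<partial>\<^sub>b(f \<circ> \<phi>\<inverse>) \<circ> (\<phi> \<circ> \<psi>\<inverse>)\<close>, a composition with a transition map.\<close>

lemma smooth_fun_partial_derivative:
  assumes c: "(U, \<phi>) \<in> A" and V: "V \<subseteq> U" "open V" and f: "smooth_fun A V f"
  shows "smooth_fun A V (\<lambda>q. frechet_derivative (f \<circ> inv_into U \<phi>) (at (\<phi> q)) b)"
proof (rule smooth_funI)
  fix W \<psi> assume d: "(W, \<psi>) \<in> A"
  have "smooth_on (\<phi> ` (U \<inter> V)) (\<lambda>y. frechet_derivative (f \<circ> inv_into U \<phi>) (at y) b)"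
    by (rule smooth_on_derivative[OF smooth_funD[OF f c]])
  moreover have "smooth_on (\<psi> ` (W \<inter> V)) (\<phi> \<circ> inv_into W \<psi>)"
    by (rule smooth_on_subset[OF transition[OF d c]]) (use V in auto)
  moreover have "(\<phi> \<circ> inv_into W \<psi>) ` \<psi> ` (W \<inter> V) \<subseteq> \<phi> ` (U \<inter> V)"
    using V d by auto
  ultimately show "smooth_on (\<psi> ` (W \<inter> V))
      ((\<lambda>q. frechet_derivative (f \<circ> inv_into U \<phi>) (at (\<phi> q)) b) \<circ> inv_into W \<psi>)"
    using smooth_on_compose[OF open_chart_image[OF d V(2)] open_chart_image[OF c V(2)]]
    by (fastforce simp: comp_def)
qed

lemma smooth_nearI: "open V \<Longrightarrow> V \<subseteq> points A \<Longrightarrow> p \<in> V \<Longrightarrow> smooth_fun A V f \<Longrightarrow> smooth_near A p f"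
  unfolding smooth_near_def open_in_def by auto

lemma smooth_nearE:
  assumes "smooth_near A p f"
  obtains V where "open V" "V \<subseteq> points A" "p \<in> V" "smooth_fun A V f"
  using assms unfolding smooth_near_def open_in_def by auto

lemma smooth_near_nearby: "smooth_near A p f \<Longrightarrow> \<forall>\<^sub>F q in nhds p. smooth_near A q f"
  unfolding eventually_nhds by (metis smooth_nearE smooth_nearI)

lemma smooth_near_cong:
  assumes "\<forall>\<^sub>F q in nhds p. f q = g q"
  shows "smooth_near A p f = smooth_near A p g"
proof -
  have *: "smooth_near A p g" if f: "smooth_near A p f" and eq: "\<forall>\<^sub>F q in nhds p. f q = g q" for f g
  proof -
    obtain V where V: "open V" "V \<subseteq> points A" "p \<in> V" "smooth_fun A V f"
      by (rule smooth_nearE[OF f])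
    obtain W where W: "open W" "p \<in> W" "\<And>q. q \<in> W \<Longrightarrow> f q = g q"
      using eq unfolding eventually_nhds by blast
    show ?thesis
      by (rule smooth_nearI[of "V \<inter> W"])
        (use V W smooth_fun_subset[OF V(4), of "V \<inter> W"] smooth_fun_cong[of "V \<inter> W" f g] in auto)
  qed
  show ?thesis using *[of f g] *[of g f] assms by (auto simp: eq_commute)
qed

lemma smooth_near_const: "p \<in> points A \<Longrightarrow> smooth_near A p (\<lambda>q. c)"
  by (rule smooth_nearI[OF open_points]) (auto simp: smooth_fun_const)

lemma smooth_near_mult:
  assumes "smooth_near A p f" "smooth_near A p g"
  shows "smooth_near A p (\<lambda>q. f q * g q)"
proof -
  obtain V W where "open V" "V \<subseteq> points A" "p \<in> V" "smooth_fun A V f"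
    "open W" "p \<in> W" "smooth_fun A W g"
    using assms smooth_nearE by metis
  then show ?thesis
    by (intro smooth_nearI[of "V \<inter> W"] smooth_fun_mult) (auto intro: smooth_fun_subset)
qed

lemma smooth_near_coordinate: "(U, \<phi>) \<in> A \<Longrightarrow> p \<in> U \<Longrightarrow> smooth_near A p (\<lambda>q. \<phi> q \<bullet> b)"
  using chart(1) chart_subset_points by (intro smooth_nearI[of U] smooth_fun_coordinate) auto

lemma smooth_near_has_derivative:
  assumes f: "smooth_near A p f" and c: "(U, \<phi>) \<in> A" and p: "p \<in> U"
  shows "((f \<circ> inv_into U \<phi>) has_derivative frechet_derivative (f \<circ> inv_into U \<phi>) (at (\<phi> p))) (at (\<phi> p))"
proof -
  obtain V where V: "p \<in> V" "smooth_fun A V f" by (rule smooth_nearE[OF f])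
  show ?thesis
    by (rule smooth_on_has_derivative[OF smooth_funD[OF V(2) c]]) (use V p in auto)
qed

lemma act_coord_vec:
  "smooth_near A p f \<Longrightarrow>
    act (coord_vec A p (U, \<phi>) w) f = frechet_derivative (f \<circ> inv_into U \<phi>) (at (\<phi> p)) w"
  by (simp add: coord_vec_def)

lemma coord_vec_linear:
  assumes c: "(U, \<phi>) \<in> A" and p: "p \<in> U"
  shows "linear (coord_vec A p (U, \<phi>))"
proof
  fix v w r
  note L = has_derivative_linear[OF smooth_near_has_derivative[OF _ c p]]
  show "coord_vec A p (U, \<phi>) (v + w) = coord_vec A p (U, \<phi>) v + coord_vec A p (U, \<phi>) w"
    by (rule tvec_eqI) (simp add: coord_vec_def linear_add[OF L])
  show "coord_vec A p (U, \<phi>) (r *\<^sub>R v) = r *\<^sub>R coord_vec A p (U, \<phi>) v"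
    by (rule tvec_eqI) (simp add: coord_vec_def linear_cmul[OF L])
qed

lemma coord_vec_change_chart:
  assumes c: "(U, \<phi>) \<in> A" "p \<in> U" and d: "(V, \<psi>) \<in> A" "p \<in> V"
  shows "coord_vec A p (U, \<phi>) w =
    coord_vec A p (V, \<psi>) (frechet_derivative (\<psi> \<circ> inv_into U \<phi>) (at (\<phi> p)) w)"
proof (rule tvec_eqI)
  fix f
  let ?T = "\<psi> \<circ> inv_into U \<phi>"
  show "act (coord_vec A p (U, \<phi>) w) f =
    act (coord_vec A p (V, \<psi>) (frechet_derivative ?T (at (\<phi> p)) w)) f"
  proof (cases "smooth_near A p f")
    case True
    have T: "(?T has_derivative frechet_derivative ?T (at (\<phi> p))) (at (\<phi> p))"
      by (rule smooth_on_has_derivative[OF transition[OF c(1) d(1)]]) (use c d in auto)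
    have "(f \<circ> inv_into V \<psi> has_derivative frechet_derivative (f \<circ> inv_into V \<psi>) (at (\<psi> p))) (at (?T (\<phi> p)))"
      using smooth_near_has_derivative[OF True d] c by simp
    from diff_chain_at[OF T this]
    have D: "((f \<circ> inv_into V \<psi>) \<circ> ?T has_derivative
      frechet_derivative (f \<circ> inv_into V \<psi>) (at (\<psi> p)) \<circ> frechet_derivative ?T (at (\<phi> p))) (at (\<phi> p))" .
    have "(f \<circ> inv_into U \<phi> has_derivative
      frechet_derivative (f \<circ> inv_into V \<psi>) (at (\<psi> p)) \<circ> frechet_derivative ?T (at (\<phi> p))) (at (\<phi> p))"
      by (rule has_derivative_transform_within_open[OF D open_chart_image[OF c(1) chart(1)[OF d(1)]]])
        (use c d in auto)
    from frechet_derivative_at[OF this, symmetric] show ?thesis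
      by (simp add: act_coord_vec[OF True])
  qed (simp add: coord_vec_def)
qed

text \<open>A single chart around \<open>p\<close> gives all tangent vectors, which makes the tangent space a linear image.\<close>

lemma tangent_space_chart:
  assumes "(U, \<phi>) \<in> A" "p \<in> U"
  shows "tangent_space A p = range (coord_vec A p (U, \<phi>))"
proof
  show "tangent_space A p \<subseteq> range (coord_vec A p (U, \<phi>))"
    using coord_vec_change_chart[OF _ _ assms] by (auto simp: tangent_space_def)
  show "range (coord_vec A p (U, \<phi>)) \<subseteq> tangent_space A p"
    using assms by (force simp: tangent_space_def)
qed

lemma coord_vec_tangent: "(U, \<phi>) \<in> A \<Longrightarrow> p \<in> U \<Longrightarrow> coord_vec A p (U, \<phi>) w \<in> tangent_space A p"
  by (simp add: tangent_space_chart)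

lemma tangent_points: "v \<in> tangent_space A p \<Longrightarrow> p \<in> points A"
  unfolding tangent_space_def points_def by force

lemma tangentE:
  assumes "v \<in> tangent_space A p"
  obtains U \<phi> w where "(U, \<phi>) \<in> A" "p \<in> U" "v = coord_vec A p (U, \<phi>) w"
  using assms unfolding tangent_space_def by auto

lemma subspace_tangent_space: "p \<in> points A \<Longrightarrow> subspace (tangent_space A p)"
  by (metis coord_vec_linear linear_subspace_image point_in_chart subspace_UNIV tangent_space_chart)

lemma tangent_closed [intro, simp]:
  "p \<in> points A \<Longrightarrow> 0 \<in> tangent_space A p"
  "v \<in> tangent_space A p \<Longrightarrow> w \<in> tangent_space A p \<Longrightarrow> v + w \<in> tangent_space A p"
  "v \<in> tangent_space A p \<Longrightarrow> w \<in> tangent_space A p \<Longrightarrow> v - w \<in> tangent_space A p"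
  "v \<in> tangent_space A p \<Longrightarrow> r *\<^sub>R v \<in> tangent_space A p"
  by (metis subspace_tangent_space tangent_points subspace_0 subspace_add subspace_diff subspace_scale)+

lemma tangent_sum: "p \<in> points A \<Longrightarrow> (\<And>i. i \<in> I \<Longrightarrow> v i \<in> tangent_space A p) \<Longrightarrow> (\<Sum>i\<in>I. v i) \<in> tangent_space A p"
  by (simp add: subspace_sum subspace_tangent_space)

lemma act_not_smooth: "v \<in> tangent_space A p \<Longrightarrow> \<not> smooth_near A p f \<Longrightarrow> act v f = 0"
  by (auto elim!: tangentE simp: coord_vec_def)

lemma act_cong:
  assumes v: "v \<in> tangent_space A p" and eq: "\<forall>\<^sub>F q in nhds p. f q = g q"
  shows "act v f = act v g"
proof (cases "smooth_near A p f")
  case True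
  then have g: "smooth_near A p g" using smooth_near_cong[OF eq] by simp
  obtain U \<phi> w where c: "(U, \<phi>) \<in> A" "p \<in> U" and v': "v = coord_vec A p (U, \<phi>) w"
    using v tangentE by blast
  obtain W where W: "open W" "p \<in> W" "\<And>q. q \<in> W \<Longrightarrow> f q = g q"
    using eq unfolding eventually_nhds by blast
  have "frechet_derivative (f \<circ> inv_into U \<phi>) (at (\<phi> p)) = frechet_derivative (g \<circ> inv_into U \<phi>) (at (\<phi> p))"
    by (rule frechet_derivative_transform_within_open[OF _ open_chart_image[OF c(1) W(1)]])
      (use W c smooth_near_has_derivative[OF True c] in \<open>auto simp: differentiable_def\<close>)
  then show ?thesis by (simp add: v' act_coord_vec True g)
next
  case False
  then show ?thesis using act_not_smooth[OF v] smooth_near_cong[OF eq] by simp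
qed

lemma act_mult:
  assumes v: "v \<in> tangent_space A p" and f: "smooth_near A p f" and g: "smooth_near A p g"
  shows "act v (\<lambda>q. f q * g q) = act v f * g p + f p * act v g"
proof -
  obtain U \<phi> w where c: "(U, \<phi>) \<in> A" "p \<in> U" and v': "v = coord_vec A p (U, \<phi>) w"
    using v tangentE by blast
  have "(\<lambda>q. f q * g q) \<circ> inv_into U \<phi> = (\<lambda>y. (f \<circ> inv_into U \<phi>) y * (g \<circ> inv_into U \<phi>) y)"
    by auto
  then show ?thesis
    using frechet_derivative_at[OF has_derivative_mult[OF smooth_near_has_derivative[OF f c]
          smooth_near_has_derivative[OF g c]], symmetric] c
    by (simp add: v' act_coord_vec f g smooth_near_mult del: comp_apply) simp
qed

lemma act_const: "v \<in> tangent_space A p \<Longrightarrow> act v (\<lambda>q. c) = 0"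
  by (auto elim!: tangentE simp: coord_vec_def comp_def)

lemma act_coordinate:
  assumes c: "(U, \<phi>) \<in> A" and p: "p \<in> U"
  shows "act (coord_vec A p (U, \<phi>) w) (\<lambda>q. \<phi> q \<bullet> b) = w \<bullet> b"
proof -
  have D: "((\<lambda>y. y \<bullet> b) has_derivative (\<lambda>w. w \<bullet> b)) (at (\<phi> p))"
    by (rule bounded_linear_imp_has_derivative[OF bounded_linear_inner_left])
  have "((\<lambda>q. \<phi> q \<bullet> b) \<circ> inv_into U \<phi> has_derivative (\<lambda>w. w \<bullet> b)) (at (\<phi> p))"
    by (rule has_derivative_transform_within_open[OF D chart(2)[OF c]])
      (use p c in \<open>auto simp: f_inv_into_f\<close>)
  from frechet_derivative_at[OF this, symmetric] show ?thesis
    by (simp add: act_coord_vec smooth_near_coordinate[OF c p])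
qed

lemma tangent_expand:
  assumes c: "(U, \<phi>) \<in> A" "p \<in> U" and v: "v \<in> tangent_space A p"
  shows "v = (\<Sum>b\<in>Basis. act v (\<lambda>q. \<phi> q \<bullet> b) *\<^sub>R coord_vec A p (U, \<phi>) b)"
proof -
  obtain w where w: "v = coord_vec A p (U, \<phi>) w" using v tangent_space_chart[OF c] by auto
  show ?thesis
    unfolding w act_coordinate[OF c] by (rule linear_euclidean_expand[OF coord_vec_linear[OF c]])
qed

lemma smooth_field_tangent: "smooth_field A V X \<Longrightarrow> p \<in> V \<Longrightarrow> X p \<in> tangent_space A p"
  unfolding smooth_field_def by auto

lemma smooth_field_act:
  "smooth_field A V X \<Longrightarrow> open W \<Longrightarrow> W \<subseteq> V \<Longrightarrow> smooth_fun A W f \<Longrightarrow> smooth_fun A W (\<lambda>p. act (X p) f)"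
  unfolding smooth_field_def open_in_def by (metis subset_iff tangent_points)

lemma smooth_field_subset: "smooth_field A V X \<Longrightarrow> W \<subseteq> V \<Longrightarrow> smooth_field A W X"
  unfolding smooth_field_def by (meson subset_iff subset_trans)

lemma smooth_field_local:
  assumes "\<And>p. p \<in> V \<Longrightarrow> \<exists>W. open W \<and> p \<in> W \<and> smooth_field A W X"
  shows "smooth_field A V X"
  unfolding smooth_field_def
proof (intro conjI allI impI ballI)
  show "X p \<in> tangent_space A p" if "p \<in> V" for p
    using assms[OF that] smooth_field_tangent by blast
next
  fix W f assume W: "open_in A W \<and> W \<subseteq> V \<and> smooth_fun A W f"
  show "smooth_fun A W (\<lambda>p. act (X p) f)"
  proof (rule smooth_fun_local)
    fix p assume p: "p \<in> W"
    then obtain W' where W': "open W'" "p \<in> W'" "smooth_field A W' X" using assms W by blast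
    have "smooth_fun A (W \<inter> W') (\<lambda>p. act (X p) f)"
      by (rule smooth_field_act[OF W'(3)])
        (use W W' smooth_fun_subset[of W f "W \<inter> W'"] in \<open>auto simp: open_in_def\<close>)
    then show "\<exists>W'. open W' \<and> p \<in> W' \<and> smooth_fun A W' (\<lambda>p. act (X p) f)"
      using W W' p by (metis Int_iff open_Int open_in_def)
  qed
qed

text \<open>Within a chart \<open>X f = \<Sum>\<^sub>b X(\<phi>\<^sup>b) \<partial>\<^sub>b f\<close>, so it suffices to test \<open>X\<close> on the coordinate functions.\<close>

lemma smooth_field_chartI:
  assumes c: "(U, \<phi>) \<in> A" and V: "V \<subseteq> U" "open V"
    and X: "\<And>p. p \<in> V \<Longrightarrow> X p \<in> tangent_space A p"
    and coord: "\<And>b. b \<in> Basis \<Longrightarrow> smooth_fun A V (\<lambda>p. act (X p) (\<lambda>q. \<phi> q \<bullet> b))"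
  shows "smooth_field A V X"
  unfolding smooth_field_def
proof (intro conjI allI impI ballI X)
  fix W f assume "open_in A W \<and> W \<subseteq> V \<and> smooth_fun A W f"
  then have W: "open W" "W \<subseteq> points A" "W \<subseteq> V" "smooth_fun A W f" by (auto simp: open_in_def)
  have "smooth_fun A W (\<lambda>p. \<Sum>b\<in>Basis. act (X p) (\<lambda>q. \<phi> q \<bullet> b) *
      frechet_derivative (f \<circ> inv_into U \<phi>) (at (\<phi> p)) b)"
    using V W by (intro smooth_fun_sum smooth_fun_mult smooth_fun_partial_derivative[OF c])
      (auto intro: smooth_fun_subset coord)
  moreover have "(\<Sum>b\<in>Basis. act (X p) (\<lambda>q. \<phi> q \<bullet> b) *
      frechet_derivative (f \<circ> inv_into U \<phi>) (at (\<phi> p)) b) = act (X p) f" if "p \<in> W" for p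
  proof -
    have p: "p \<in> U" "p \<in> V" using that V W by auto
    have f: "smooth_near A p f" using W that by (intro smooth_nearI) auto
    show ?thesis
      by (subst (2) tangent_expand[OF c p(1) X[OF p(2)]]) (simp add: act_coord_vec[OF f])
  qed
  ultimately show "smooth_fun A W (\<lambda>p. act (X p) f)"
    using smooth_fun_cong[OF W(1)] by (metis (no_types, lifting))
qed

lemma smooth_field_coord_vec: "(U, \<phi>) \<in> A \<Longrightarrow> smooth_field A U (\<lambda>p. coord_vec A p (U, \<phi>) w)"
proof (rule smooth_field_chartI, assumption)
  fix b assume c: "(U, \<phi>) \<in> A"
  show "smooth_fun A U (\<lambda>p. act (coord_vec A p (U, \<phi>) w) (\<lambda>q. \<phi> q \<bullet> b))"
    using smooth_fun_cong[OF chart(1)[OF c], of _ "\<lambda>p. w \<bullet> b"] smooth_fun_const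
    by (simp add: act_coordinate[OF c])
qed (auto intro: coord_vec_tangent chart)

lemma smooth_field_add:
  assumes "open V" "smooth_field A V X" "smooth_field A V Y"
  shows "smooth_field A V (\<lambda>p. X p + Y p)"
  using assms unfolding smooth_field_def by (auto simp: open_in_def intro: smooth_fun_add)

lemma smooth_field_scaleR:
  assumes "open V" "smooth_fun A V f" "smooth_field A V X"
  shows "smooth_field A V (\<lambda>p. f p *\<^sub>R X p)"
  using assms unfolding smooth_field_def
  by (auto simp: open_in_def intro: smooth_fun_mult smooth_fun_subset)

lemma field_nearI: "open V \<Longrightarrow> p \<in> V \<Longrightarrow> smooth_field A V X \<Longrightarrow> field_near A p X"
  unfolding field_near_def open_in_def by (meson smooth_field_tangent subsetI tangent_points)

lemma field_nearE:
  assumes "field_near A p X"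
  obtains V where "open V" "p \<in> V" "smooth_field A V X"
  using assms unfolding field_near_def open_in_def by auto

lemma field_near_tangent: "field_near A p X \<Longrightarrow> X p \<in> tangent_space A p"
  by (metis field_nearE smooth_field_tangent)

lemma field_near_points: "field_near A p X \<Longrightarrow> p \<in> points A"
  by (rule tangent_points[OF field_near_tangent])

lemma field_near_nearby: "field_near A p X \<Longrightarrow> \<forall>\<^sub>F q in nhds p. field_near A q X"
  unfolding eventually_nhds by (metis field_nearE field_nearI)

lemma field_near_add:
  assumes "field_near A p X" "field_near A p Y"
  shows "field_near A p (\<lambda>q. X q + Y q)"
proof -
  obtain V W where "open V" "p \<in> V" "smooth_field A V X" "open W" "p \<in> W" "smooth_field A W Y"
    using assms field_nearE by metis
  then show ?thesis
    by (intro field_nearI[of "V \<inter> W"] smooth_field_add) (auto intro: smooth_field_subset)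
qed

lemma field_near_scaleR:
  assumes "smooth_near A p f" "field_near A p X"
  shows "field_near A p (\<lambda>q. f q *\<^sub>R X q)"
proof -
  obtain V W where "open V" "p \<in> V" "smooth_fun A V f" "open W" "p \<in> W" "smooth_field A W X"
    using assms field_nearE smooth_nearE by metis
  then show ?thesis
    by (intro field_nearI[of "V \<inter> W"] smooth_field_scaleR)
      (auto intro: smooth_field_subset smooth_fun_subset)
qed

lemma field_near_zero: "p \<in> points A \<Longrightarrow> field_near A p (\<lambda>q. 0)"
  by (rule field_nearI[OF open_points]) (auto simp: smooth_field_def smooth_fun_const)

lemma field_near_diff:
  assumes "field_near A p X" "field_near A p Y"
  shows "field_near A p (\<lambda>q. X q - Y q)"
  using field_near_add[OF assms(1) field_near_scaleR[OF smooth_near_const assms(2)], of "- 1"]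
    tangent_points[OF field_near_tangent[OF assms(1)]] by simp

lemma field_near_sum:
  "p \<in> points A \<Longrightarrow> (\<And>i. i \<in> I \<Longrightarrow> field_near A p (X i)) \<Longrightarrow> field_near A p (\<lambda>q. \<Sum>i\<in>I. X i q)"
  by (induction I rule: infinite_finite_induct) (auto intro: field_near_zero field_near_add)

lemma smooth_near_act:
  assumes "field_near A p X" "smooth_near A p f"
  shows "smooth_near A p (\<lambda>q. act (X q) f)"
proof -
  obtain V W where *: "open V" "p \<in> V" "V \<subseteq> points A" "smooth_fun A V f" "open W" "p \<in> W" "smooth_field A W X"
    using assms field_nearE smooth_nearE by metis
  have "smooth_fun A (V \<inter> W) (\<lambda>q. act (X q) f)"
    by (rule smooth_field_act[OF *(7)]) (use * smooth_fun_subset in auto)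
  with * show ?thesis by (intro smooth_nearI[of "V \<inter> W"]) auto
qed

lemma field_near_cong:
  assumes X: "field_near A p X" and eq: "\<forall>\<^sub>F q in nhds p. X q = Y q"
  shows "field_near A p Y"
proof -
  obtain V where V: "open V" "p \<in> V" "smooth_field A V X" using X field_nearE by blast
  obtain W where W: "open W" "p \<in> W" "\<And>q. q \<in> W \<Longrightarrow> X q = Y q"
    using eq unfolding eventually_nhds by blast
  have "smooth_field A (V \<inter> W) Y"
    unfolding smooth_field_def
  proof (intro conjI ballI allI impI)
    show "Y q \<in> tangent_space A q" if "q \<in> V \<inter> W" for q
      using that smooth_field_tangent[OF V(3)] W(3) by (metis IntE)
    fix S f assume S: "open_in A S \<and> S \<subseteq> V \<inter> W \<and> smooth_fun A S f"
    then have "smooth_fun A S (\<lambda>p. act (X p) f)"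
      using V by (intro smooth_field_act[OF V(3)]) (auto simp: open_in_def)
    then show "smooth_fun A S (\<lambda>p. act (Y p) f)"
      using smooth_fun_cong[of S "\<lambda>p. act (X p) f" "\<lambda>p. act (Y p) f"] S W(3)
      by (auto simp: open_in_def subset_iff)
  qed
  then show ?thesis using V W by (intro field_nearI[of "V \<inter> W"]) auto
qed

lemma extension:
  assumes "x \<in> tangent_space A p"
  shows "field_near A p (extension A p x)" "extension A p x p = x"
proof -
  obtain U \<phi> w where c: "(U, \<phi>) \<in> A" "p \<in> U" "x = coord_vec A p (U, \<phi>) w"
    using assms tangentE by blast
  then have "\<exists>X. field_near A p X \<and> X p = x"
    using field_nearI[OF chart(1)[OF c(1)] c(2) smooth_field_coord_vec[OF c(1), of w]] by blast
  then show "field_near A p (extension A p x)" "extension A p x p = x"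
    unfolding extension_def by (metis (mono_tags, lifting) someI_ex)+
qed

text \<open>A field vanishing at \<open>p\<close> is \<open>\<Sum>\<^sub>b f\<^sub>b E\<^sub>b\<close> near \<open>p\<close> for coordinate fields \<open>E\<^sub>b\<close> and smooth functions \<open>f\<^sub>b\<close>
  vanishing at \<open>p\<close>. Hence an operator that is linear over the smooth functions depends only on the
  value of its argument at \<open>p\<close>. The operator must also be local, since the expansion is.\<close>

lemma function_linear_pointwise:
  fixes T :: "'a vfield \<Rightarrow> 'v::real_vector"
  assumes local: "\<And>X Y. field_near A p X \<Longrightarrow> field_near A p Y \<Longrightarrow> \<forall>\<^sub>F q in nhds p. X q = Y q \<Longrightarrow> T X = T Y"
    and add: "\<And>X Y. field_near A p X \<Longrightarrow> field_near A p Y \<Longrightarrow> T (\<lambda>q. X q + Y q) = T X + T Y"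
    and scale: "\<And>f X. smooth_near A p f \<Longrightarrow> field_near A p X \<Longrightarrow> T (\<lambda>q. f q *\<^sub>R X q) = f p *\<^sub>R T X"
    and X: "field_near A p X" and Y: "field_near A p Y" and eq: "X p = Y p"
  shows "T X = T Y"
proof -
  have p: "p \<in> points A" using X field_near_tangent tangent_points by blast
  then obtain U \<phi> where c: "(U, \<phi>) \<in> A" "p \<in> U" using point_in_chart by blast
  define E where "E b q = coord_vec A q (U, \<phi>) b" for b q
  define f where "f Z b q = act (Z q) (\<lambda>q. \<phi> q \<bullet> b)" for Z :: "'a vfield" and b q
  have E: "field_near A p (E b)" for b
    unfolding E_def using field_nearI[OF chart(1)[OF c(1)] c(2) smooth_field_coord_vec[OF c(1)]] .
  have zero: "T (\<lambda>q. 0) = 0"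
    using scale[OF smooth_near_const[OF p, of 0] X] by simp
  have *: "T Z = (\<Sum>b\<in>Basis. f Z b p *\<^sub>R T (E b))" if Z: "field_near A p Z" for Z
  proof -
    have f: "smooth_near A p (f Z b)" for b
      unfolding f_def by (rule smooth_near_act[OF Z smooth_near_coordinate[OF c]])
    have fE: "field_near A p (\<lambda>q. f Z b q *\<^sub>R E b q)" for b
      by (rule field_near_scaleR[OF f E])
    have "T (\<lambda>q. \<Sum>b\<in>B. f Z b q *\<^sub>R E b q) = (\<Sum>b\<in>B. f Z b p *\<^sub>R T (E b))" if "finite B" for B
      using that
    proof (induction B)
      case (insert b B)
      then show ?case
        using add[OF fE[of b] field_near_sum[OF p fE, where I=B]] scale[OF f E] by simp
    qed (simp add: zero)
    moreover have "\<forall>\<^sub>F q in nhds p. Z q = (\<Sum>b\<in>Basis. f Z b q *\<^sub>R E b q)"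
    proof -
      have "\<forall>\<^sub>F q in nhds p. q \<in> U" using c chart(1) by (simp add: eventually_nhds_in_open)
      with field_near_nearby[OF Z] show ?thesis
        by eventually_elim (simp add: E_def f_def tangent_expand[OF c(1), symmetric] field_near_tangent)
    qed
    ultimately show ?thesis
      using local[OF Z field_near_sum[where X="\<lambda>b q. f Z b q *\<^sub>R E b q" and I=Basis, OF p fE]] by simp
  qed
  show ?thesis using *[OF X] *[OF Y] eq by (simp add: f_def)
qed

end

section \<open>The Levi-Civita connection and its curvature\<close>

locale levi_civita_connection = manifold A
  for A :: "('a::topological_space, 'e::euclidean_space) atlas" +
  fixes g :: "'a metric" and D :: "'a connection"
  assumes levi_civita: "levi_civita A g D"
begin

lemma affine: "affine_connection A D"
  using levi_civita unfolding levi_civita_def by simp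

lemma D_tangent [simp]: "x \<in> tangent_space A p \<Longrightarrow> field_near A p Y \<Longrightarrow> D p x Y \<in> tangent_space A p"
  and D_add_vec: "x \<in> tangent_space A p \<Longrightarrow> y \<in> tangent_space A p \<Longrightarrow> field_near A p Y \<Longrightarrow>
    D p (x + y) Y = D p x Y + D p y Y"
  and D_scaleR_vec: "x \<in> tangent_space A p \<Longrightarrow> field_near A p Y \<Longrightarrow> D p (a *\<^sub>R x) Y = a *\<^sub>R D p x Y"
  and D_add: "x \<in> tangent_space A p \<Longrightarrow> field_near A p Y \<Longrightarrow> field_near A p Z \<Longrightarrow>
    D p x (\<lambda>q. Y q + Z q) = D p x Y + D p x Z"
  and D_scaleR: "x \<in> tangent_space A p \<Longrightarrow> field_near A p Y \<Longrightarrow> smooth_near A p f \<Longrightarrow>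
    D p x (\<lambda>q. f q *\<^sub>R Y q) = act x f *\<^sub>R Y p + f p *\<^sub>R D p x Y"
  using affine tangent_points unfolding affine_connection_def by blast+

lemma D_diff_vec:
  assumes "x \<in> tangent_space A p" "y \<in> tangent_space A p" "field_near A p Y"
  shows "D p (x - y) Y = D p x Y - D p y Y"
  using D_add_vec[OF assms(1) tangent_closed(4)[OF assms(2), of "-1"] assms(3)]
    D_scaleR_vec[OF assms(2,3), of "-1"] by simp

lemma field_near_D:
  assumes "field_near A p X" "field_near A p Y"
  shows "field_near A p (\<lambda>q. D q (X q) Y)"
proof -
  obtain V where V: "open V" "p \<in> V" "smooth_field A V X" by (rule field_nearE[OF assms(1)])
  obtain W where W: "open W" "p \<in> W" "smooth_field A W Y" by (rule field_nearE[OF assms(2)])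
  have X: "smooth_field A (V \<inter> W) X" and Y: "smooth_field A (V \<inter> W) Y"
    using V W smooth_field_subset by blast+
  have "open_in A (V \<inter> W)"
    using V W smooth_field_tangent[OF X] tangent_points by (auto simp: open_in_def)
  with X Y have "smooth_field A (V \<inter> W) (\<lambda>q. D q (X q) Y)"
    using affine unfolding affine_connection_def by blast
  then show ?thesis using V W by (intro field_nearI[of "V \<inter> W"]) auto
qed

text \<open>If \<open>Y\<close> and \<open>Y'\<close> agree near \<open>p\<close>, their difference \<open>Z\<close> equals \<open>f Z\<close> for the function \<open>f\<close> that is \<open>0\<close>
  where they agree and \<open>1\<close> elsewhere. It is locally constant at \<open>p\<close>, so the Leibniz rule applies there, and it gives
  \<open>\<nabla>\<^sub>x Z = 0\<close> because \<open>Z\<close> and \<open>f\<close> vanish at \<open>p\<close>.\<close>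

lemma D_local:
  assumes x: "x \<in> tangent_space A p" and Y: "field_near A p Y" and Y': "field_near A p Y'"
    and eq: "\<forall>\<^sub>F q in nhds p. Y q = Y' q"
  shows "D p x Y = D p x Y'"
proof -
  define f where "f q = (if Y q = Y' q then 0 else 1 :: real)" for q
  define Z where "Z q = Y q - Y' q" for q
  have "\<forall>\<^sub>F q in nhds p. f q = 0"
    using eq by eventually_elim (simp add: f_def)
  then have f: "smooth_near A p f"
    using smooth_near_cong[of f "\<lambda>q. 0" p] smooth_near_const tangent_points[OF x] by simp
  have Z: "field_near A p Z"
    unfolding Z_def by (rule field_near_diff[OF Y Y'])
  have fZ: "(\<lambda>q. f q *\<^sub>R Z q) = Z"
    by (auto simp: f_def Z_def)
  have p: "Y p = Y' p"
    using eq by (rule eventually_nhds_x_imp_x)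
  have "D p x Z = act x f *\<^sub>R Z p + f p *\<^sub>R D p x Z"
    using D_scaleR[OF x Z f] unfolding fZ .
  then have "D p x Z = 0"
    by (simp add: f_def Z_def p)
  moreover have "D p x (\<lambda>q. Y' q + Z q) = D p x Y' + D p x Z"
    by (rule D_add[OF x Y' Z])
  ultimately show ?thesis by (simp add: Z_def)
qed

lemma D_scaleR_const:
  assumes "x \<in> tangent_space A p" "field_near A p Y"
  shows "D p x (\<lambda>q. c *\<^sub>R Y q) = c *\<^sub>R D p x Y"
  using D_scaleR[OF assms smooth_near_const[OF tangent_points[OF assms(1)], of c]]
  by (simp add: act_const[OF assms(1)])

lemma D_diff:
  assumes x: "x \<in> tangent_space A p" and Y: "field_near A p Y" and Z: "field_near A p Z"
  shows "D p x (\<lambda>q. Y q - Z q) = D p x Y - D p x Z"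
proof -
  have "field_near A p (\<lambda>q. (-1) *\<^sub>R Z q)"
    by (rule field_near_scaleR[OF smooth_near_const[OF tangent_points[OF x]] Z])
  from D_add[OF x Y this] D_scaleR_const[OF x Z, of "-1"] show ?thesis by simp
qed

lemma lie_bracket_eq:
  "field_near A p X \<Longrightarrow> field_near A p Y \<Longrightarrow> lie_bracket A X Y p = D p (X p) Y - D p (Y p) X"
  using levi_civita field_near_tangent tangent_points unfolding levi_civita_def by metis

lemma metric_compatible:
  "x \<in> tangent_space A p \<Longrightarrow> field_near A p Y \<Longrightarrow> field_near A p Z \<Longrightarrow>
    act x (\<lambda>q. g q (Y q) (Z q)) = g p (D p x Y) (Z p) + g p (Y p) (D p x Z)"
  using levi_civita tangent_points unfolding levi_civita_def by blast

lemma lie_bracket_tangent: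
  "field_near A p X \<Longrightarrow> field_near A p Y \<Longrightarrow> lie_bracket A X Y p \<in> tangent_space A p"
  by (simp add: lie_bracket_eq field_near_tangent)

lemma field_near_lie_bracket:
  assumes X: "field_near A p X" and Y: "field_near A p Y"
  shows "field_near A p (lie_bracket A X Y)"
proof (rule field_near_cong)
  show "field_near A p (\<lambda>q. D q (X q) Y - D q (Y q) X)"
    by (intro field_near_diff field_near_D X Y)
  show "\<forall>\<^sub>F q in nhds p. D q (X q) Y - D q (Y q) X = lie_bracket A X Y q"
    using field_near_nearby[OF X] field_near_nearby[OF Y]
    by eventually_elim (simp add: lie_bracket_eq)
qed

abbreviation R :: "'a vfield \<Rightarrow> 'a vfield \<Rightarrow> 'a vfield \<Rightarrow> 'a vfield" where
  "R \<equiv> curvature_fields A D"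

lemma R_tangent:
  assumes "field_near A p X" "field_near A p Y" "field_near A p Z"
  shows "R X Y Z p \<in> tangent_space A p"
  unfolding curvature_fields_def using assms
  by (intro tangent_closed(3) D_tangent lie_bracket_tangent field_near_D) (auto intro: field_near_tangent)

lemma R_antisym:
  assumes X: "field_near A p X" and Y: "field_near A p Y" and Z: "field_near A p Z"
  shows "R X Y Z p = - R Y X Z p"
proof -
  have "lie_bracket A X Y p = (-1) *\<^sub>R lie_bracket A Y X p"
    by (simp add: lie_bracket_eq X Y)
  then have "D p (lie_bracket A X Y p) Z = - D p (lie_bracket A Y X p) Z"
    using D_scaleR_vec[OF lie_bracket_tangent[OF Y X] Z, of "-1"] by simp
  then show ?thesis by (simp add: curvature_fields_def)
qed

lemma R_local_1:
  assumes X: "field_near A p X" and X': "field_near A p X'" and Y: "field_near A p Y" and Z: "field_near A p Z"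
    and eq: "\<forall>\<^sub>F q in nhds p. X q = X' q"
  shows "R X Y Z p = R X' Y Z p"
proof -
  have p: "X p = X' p" using eq by (rule eventually_nhds_x_imp_x)
  have "\<forall>\<^sub>F q in nhds p. D q (X q) Z = D q (X' q) Z"
    using eq by eventually_elim simp
  then have "D p (Y p) (\<lambda>q. D q (X q) Z) = D p (Y p) (\<lambda>q. D q (X' q) Z)"
    by (intro D_local field_near_D X X' Z field_near_tangent[OF Y])
  moreover have "D p (Y p) X = D p (Y p) X'"
    by (rule D_local[OF field_near_tangent[OF Y] X X' eq])
  ultimately show ?thesis
    by (simp add: curvature_fields_def lie_bracket_eq X X' Y p)
qed

lemma R_local_3:
  assumes X: "field_near A p X" and Y: "field_near A p Y" and Z: "field_near A p Z" and Z': "field_near A p Z'"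
    and eq: "\<forall>\<^sub>F q in nhds p. Z q = Z' q"
  shows "R X Y Z p = R X Y Z' p"
proof -
  have near: "\<forall>\<^sub>F q in nhds p. D q (X q) Z = D q (X q) Z'" if X: "field_near A p X" for X
    using field_near_nearby[OF X] field_near_nearby[OF Z] field_near_nearby[OF Z']
      eventually_eventually[THEN iffD2, OF eq]
    by eventually_elim (rule D_local, auto intro: field_near_tangent)
  have "D p (Y p) (\<lambda>q. D q (X q) Z) = D p (Y p) (\<lambda>q. D q (X q) Z')"
    if "field_near A p X" "field_near A p Y" for X Y
    using that by (intro D_local field_near_D Z Z' near field_near_tangent)
  moreover have "D p (lie_bracket A X Y p) Z = D p (lie_bracket A X Y p) Z'"
    by (rule D_local[OF lie_bracket_tangent[OF X Y] Z Z' eq])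
  ultimately show ?thesis using X Y by (simp add: curvature_fields_def)
qed

lemma R_add_1:
  assumes X: "field_near A p X" and X': "field_near A p X'" and Y: "field_near A p Y" and Z: "field_near A p Z"
  shows "R (\<lambda>q. X q + X' q) Y Z p = R X Y Z p + R X' Y Z p"
proof -
  note t = field_near_tangent[OF X] field_near_tangent[OF X'] field_near_tangent[OF Y]
  have XX': "field_near A p (\<lambda>q. X q + X' q)" by (rule field_near_add[OF X X'])
  have DXZ: "field_near A p (\<lambda>q. D q (X q) Z)" "field_near A p (\<lambda>q. D q (X' q) Z)"
    by (intro field_near_D X X' Z)+
  have "\<forall>\<^sub>F q in nhds p. D q (X q + X' q) Z = D q (X q) Z + D q (X' q) Z"
    using field_near_nearby[OF X] field_near_nearby[OF X'] field_near_nearby[OF Z]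
    by eventually_elim (simp add: D_add_vec field_near_tangent)
  then have "D p (Y p) (\<lambda>q. D q (X q + X' q) Z) = D p (Y p) (\<lambda>q. D q (X q) Z + D q (X' q) Z)"
    by (intro D_local t field_near_D[OF XX' Z] field_near_add DXZ)
  also have "\<dots> = D p (Y p) (\<lambda>q. D q (X q) Z) + D p (Y p) (\<lambda>q. D q (X' q) Z)"
    by (rule D_add[OF t(3) DXZ])
  finally have 1: "D p (Y p) (\<lambda>q. D q (X q + X' q) Z) = \<dots>" .
  have "lie_bracket A (\<lambda>q. X q + X' q) Y p = lie_bracket A X Y p + lie_bracket A X' Y p"
    by (simp add: lie_bracket_eq X X' Y XX' D_add_vec D_add t)
  then have 2: "D p (lie_bracket A (\<lambda>q. X q + X' q) Y p) Z =
      D p (lie_bracket A X Y p) Z + D p (lie_bracket A X' Y p) Z"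
    by (simp add: D_add_vec lie_bracket_tangent X X' Y Z)
  have 3: "D p (X p + X' p) (\<lambda>q. D q (Y q) Z) = D p (X p) (\<lambda>q. D q (Y q) Z) + D p (X' p) (\<lambda>q. D q (Y q) Z)"
    by (intro D_add_vec t field_near_D Y Z)
  show ?thesis unfolding curvature_fields_def 1 2 3 by simp
qed

text \<open>The term \<open>(Y f) \<nabla>\<^sub>X Z\<close> coming from \<open>\<nabla>\<^sub>Y (f \<nabla>\<^sub>X Z)\<close> is cancelled by \<open>[f X, Y] = f [X, Y] - (Y f) X\<close>.\<close>

lemma R_scaleR_1:
  assumes f: "smooth_near A p f" and X: "field_near A p X" and Y: "field_near A p Y" and Z: "field_near A p Z"
  shows "R (\<lambda>q. f q *\<^sub>R X q) Y Z p = f p *\<^sub>R R X Y Z p"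
proof -
  note t = field_near_tangent[OF X] field_near_tangent[OF Y]
  have fX: "field_near A p (\<lambda>q. f q *\<^sub>R X q)" by (rule field_near_scaleR[OF f X])
  have DXZ: "field_near A p (\<lambda>q. D q (X q) Z)" by (rule field_near_D[OF X Z])
  have "\<forall>\<^sub>F q in nhds p. D q (f q *\<^sub>R X q) Z = f q *\<^sub>R D q (X q) Z"
    using field_near_nearby[OF X] field_near_nearby[OF Z]
    by eventually_elim (simp add: D_scaleR_vec field_near_tangent)
  then have "D p (Y p) (\<lambda>q. D q (f q *\<^sub>R X q) Z) = D p (Y p) (\<lambda>q. f q *\<^sub>R D q (X q) Z)"
    by (intro D_local t field_near_D[OF fX Z] field_near_scaleR f DXZ)
  also have "\<dots> = act (Y p) f *\<^sub>R D p (X p) Z + f p *\<^sub>R D p (Y p) (\<lambda>q. D q (X q) Z)"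
    by (rule D_scaleR[OF t(2) DXZ f])
  finally have 1: "D p (Y p) (\<lambda>q. D q (f q *\<^sub>R X q) Z) = \<dots>" .
  have "lie_bracket A (\<lambda>q. f q *\<^sub>R X q) Y p = f p *\<^sub>R lie_bracket A X Y p - act (Y p) f *\<^sub>R X p"
    by (simp add: lie_bracket_eq X Y fX D_scaleR_vec D_scaleR f t scaleR_diff_right)
  then have 2: "D p (lie_bracket A (\<lambda>q. f q *\<^sub>R X q) Y p) Z =
      f p *\<^sub>R D p (lie_bracket A X Y p) Z - act (Y p) f *\<^sub>R D p (X p) Z"
    by (simp add: D_diff_vec D_scaleR_vec lie_bracket_tangent X Y Z t)
  have 3: "D p (f p *\<^sub>R X p) (\<lambda>q. D q (Y q) Z) = f p *\<^sub>R D p (X p) (\<lambda>q. D q (Y q) Z)"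
    by (intro D_scaleR_vec t field_near_D Y Z)
  show ?thesis unfolding curvature_fields_def 1 2 3 by (simp add: scaleR_diff_right)
qed

lemma R_add_3:
  assumes X: "field_near A p X" and Y: "field_near A p Y" and Z: "field_near A p Z" and Z': "field_near A p Z'"
  shows "R X Y (\<lambda>q. Z q + Z' q) p = R X Y Z p + R X Y Z' p"
proof -
  have ZZ': "field_near A p (\<lambda>q. Z q + Z' q)" by (rule field_near_add[OF Z Z'])
  have *: "D p (X p) (\<lambda>q. D q (Y q) (\<lambda>q. Z q + Z' q)) =
      D p (X p) (\<lambda>q. D q (Y q) Z) + D p (X p) (\<lambda>q. D q (Y q) Z')"
    if X: "field_near A p X" and Y: "field_near A p Y" for X Y
  proof -
    have "\<forall>\<^sub>F q in nhds p. D q (Y q) (\<lambda>q. Z q + Z' q) = D q (Y q) Z + D q (Y q) Z'"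
      using field_near_nearby[OF Y] field_near_nearby[OF Z] field_near_nearby[OF Z']
      by eventually_elim (simp add: D_add field_near_tangent)
    then have "D p (X p) (\<lambda>q. D q (Y q) (\<lambda>q. Z q + Z' q)) = D p (X p) (\<lambda>q. D q (Y q) Z + D q (Y q) Z')"
      by (intro D_local field_near_tangent X field_near_D Y ZZ' field_near_add Z Z')
    also have "\<dots> = D p (X p) (\<lambda>q. D q (Y q) Z) + D p (X p) (\<lambda>q. D q (Y q) Z')"
      by (intro D_add field_near_tangent X field_near_D Y Z Z')
    finally show ?thesis .
  qed
  show ?thesis
    unfolding curvature_fields_def *[OF X Y] *[OF Y X] D_add[OF lie_bracket_tangent[OF X Y] Z Z'] by simp
qed

text \<open>The second-order terms \<open>X (Y f) - Y (X f)\<close> are cancelled by \<open>[X, Y] f\<close>, the first-order ones by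
  symmetry.\<close>

lemma R_scaleR_3:
  assumes f: "smooth_near A p f" and X: "field_near A p X" and Y: "field_near A p Y" and Z: "field_near A p Z"
  shows "R X Y (\<lambda>q. f q *\<^sub>R Z q) p = f p *\<^sub>R R X Y Z p"
proof -
  have fZ: "field_near A p (\<lambda>q. f q *\<^sub>R Z q)" by (rule field_near_scaleR[OF f Z])
  have *: "D p (X p) (\<lambda>q. D q (Y q) (\<lambda>q. f q *\<^sub>R Z q)) =
      act (X p) (\<lambda>q. act (Y q) f) *\<^sub>R Z p + act (Y p) f *\<^sub>R D p (X p) Z +
      (act (X p) f *\<^sub>R D p (Y p) Z + f p *\<^sub>R D p (X p) (\<lambda>q. D q (Y q) Z))"
    if X: "field_near A p X" and Y: "field_near A p Y" for X Y
  proof -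
    have Yf: "smooth_near A p (\<lambda>q. act (Y q) f)" by (rule smooth_near_act[OF Y f])
    have DYZ: "field_near A p (\<lambda>q. D q (Y q) Z)" by (rule field_near_D[OF Y Z])
    have "\<forall>\<^sub>F q in nhds p. D q (Y q) (\<lambda>q. f q *\<^sub>R Z q) = act (Y q) f *\<^sub>R Z q + f q *\<^sub>R D q (Y q) Z"
      using field_near_nearby[OF Y] field_near_nearby[OF Z] smooth_near_nearby[OF f]
      by eventually_elim (simp add: D_scaleR field_near_tangent)
    then have "D p (X p) (\<lambda>q. D q (Y q) (\<lambda>q. f q *\<^sub>R Z q)) =
        D p (X p) (\<lambda>q. act (Y q) f *\<^sub>R Z q + f q *\<^sub>R D q (Y q) Z)"
      by (intro D_local field_near_tangent X field_near_D Y fZ field_near_add field_near_scaleR Yf f Z)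
    also have "\<dots> = D p (X p) (\<lambda>q. act (Y q) f *\<^sub>R Z q) + D p (X p) (\<lambda>q. f q *\<^sub>R D q (Y q) Z)"
      by (intro D_add field_near_tangent X field_near_scaleR Yf f Z DYZ)
    also have "D p (X p) (\<lambda>q. act (Y q) f *\<^sub>R Z q) =
        act (X p) (\<lambda>q. act (Y q) f) *\<^sub>R Z p + act (Y p) f *\<^sub>R D p (X p) Z"
      by (rule D_scaleR[OF field_near_tangent[OF X] Z Yf])
    also have "D p (X p) (\<lambda>q. f q *\<^sub>R D q (Y q) Z) =
        act (X p) f *\<^sub>R D p (Y p) Z + f p *\<^sub>R D p (X p) (\<lambda>q. D q (Y q) Z)"
      by (rule D_scaleR[OF field_near_tangent[OF X] DYZ f])
    finally show ?thesis .
  qed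
  have "act (lie_bracket A X Y p) f = act (X p) (\<lambda>q. act (Y q) f) - act (Y p) (\<lambda>q. act (X q) f)"
    by (simp add: lie_bracket_def f)
  then show ?thesis
    unfolding curvature_fields_def *[OF X Y] *[OF Y X] D_scaleR[OF lie_bracket_tangent[OF X Y] Z f]
    by (simp only:) (simp add: algebra_simps)
qed

text \<open>The operator is linear over the smooth functions in its first and third arguments, and the second one is
  exchanged with the first by antisymmetry.\<close>

lemma R_pointwise:
  assumes X: "field_near A p X" "field_near A p X'" and Y: "field_near A p Y" "field_near A p Y'"
    and Z: "field_near A p Z" "field_near A p Z'"
    and eq: "X p = X' p" "Y p = Y' p" "Z p = Z' p"
  shows "R X Y Z p = R X' Y' Z' p"
proof -
  have 1: "R X Y Z p = R X' Y Z p"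
    if "field_near A p X" "field_near A p X'" "field_near A p Y" "field_near A p Z" "X p = X' p" for X X' Y Z
    by (rule function_linear_pointwise[of p "\<lambda>X. R X Y Z p"])
      (use that in \<open>auto intro: R_local_1 R_add_1 R_scaleR_1\<close>)
  have 3: "R X Y Z p = R X Y Z' p"
    if "field_near A p X" "field_near A p Y" "field_near A p Z" "field_near A p Z'" "Z p = Z' p" for X Y Z Z'
    by (rule function_linear_pointwise[of p "\<lambda>Z. R X Y Z p"])
      (use that in \<open>auto intro: R_local_3 R_add_3 R_scaleR_3\<close>)
  have "R X Y Z p = R X' Y Z p" by (rule 1[OF X Y(1) Z(1) eq(1)])
  also have "\<dots> = - R Y X' Z p" by (rule R_antisym[OF X(2) Y(1) Z(1)])
  also have "R Y X' Z p = R Y' X' Z p" by (rule 1[OF Y X(2) Z(1) eq(2)])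
  also have "- R Y' X' Z p = R X' Y' Z p" by (rule R_antisym[OF X(2) Y(2) Z(1), symmetric])
  also have "\<dots> = R X' Y' Z' p" by (rule 3[OF X(2) Y(2) Z eq(3)])
  finally show ?thesis .
qed

lemma curvature_eq:
  assumes "field_near A p X" "field_near A p Y" "field_near A p Z"
  shows "curvature A D p (X p) (Y p) (Z p) = R X Y Z p"
  unfolding curvature_def
  by (rule R_pointwise) (use assms extension[OF field_near_tangent] in auto)

lemma curvature_tangent:
  "x \<in> tangent_space A p \<Longrightarrow> y \<in> tangent_space A p \<Longrightarrow> z \<in> tangent_space A p \<Longrightarrow>
    curvature A D p x y z \<in> tangent_space A p"
  unfolding curvature_def by (intro R_tangent extension)

lemma curvature_antisym:
  "x \<in> tangent_space A p \<Longrightarrow> y \<in> tangent_space A p \<Longrightarrow> z \<in> tangent_space A p \<Longrightarrow>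
    curvature A D p x y z = - curvature A D p y x z"
  unfolding curvature_def by (intro R_antisym extension)

lemma curvature_add_1:
  assumes "x \<in> tangent_space A p" "x' \<in> tangent_space A p" "y \<in> tangent_space A p" "z \<in> tangent_space A p"
  shows "curvature A D p (x + x') y z = curvature A D p x y z + curvature A D p x' y z"
  using curvature_eq[OF field_near_add, of p "extension A p x" "extension A p x'" "extension A p y" "extension A p z"]
    R_add_1[of p "extension A p x" "extension A p x'" "extension A p y" "extension A p z"] assms
  by (simp add: extension) (simp add: curvature_def)

lemma curvature_scaleR_1:
  assumes "x \<in> tangent_space A p" "y \<in> tangent_space A p" "z \<in> tangent_space A p"
  shows "curvature A D p (c *\<^sub>R x) y z = c *\<^sub>R curvature A D p x y z"
proof -
  have c: "smooth_near A p (\<lambda>q. c)" by (rule smooth_near_const[OF tangent_points[OF assms(1)]])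
  show ?thesis
    using curvature_eq[OF field_near_scaleR[OF c], of "extension A p x" "extension A p y" "extension A p z"]
      R_scaleR_1[OF c, of "extension A p x" "extension A p y" "extension A p z"] assms
    by (simp add: extension) (simp add: curvature_def)
qed

lemma curvature_add_3:
  assumes "x \<in> tangent_space A p" "y \<in> tangent_space A p" "z \<in> tangent_space A p" "z' \<in> tangent_space A p"
  shows "curvature A D p x y (z + z') = curvature A D p x y z + curvature A D p x y z'"
  using curvature_eq[OF _ _ field_near_add, of p "extension A p x" "extension A p y" "extension A p z" "extension A p z'"]
    R_add_3[of p "extension A p x" "extension A p y" "extension A p z" "extension A p z'"] assms
  by (simp add: extension) (simp add: curvature_def)

lemma curvature_scaleR_3:
  assumes "x \<in> tangent_space A p" "y \<in> tangent_space A p" "z \<in> tangent_space A p"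
  shows "curvature A D p x y (c *\<^sub>R z) = c *\<^sub>R curvature A D p x y z"
proof -
  have c: "smooth_near A p (\<lambda>q. c)" by (rule smooth_near_const[OF tangent_points[OF assms(1)]])
  show ?thesis
    using curvature_eq[OF _ _ field_near_scaleR[OF c], of "extension A p x" "extension A p y" "extension A p z"]
      R_scaleR_3[OF c, of "extension A p x" "extension A p y" "extension A p z"] assms
    by (simp add: extension) (simp add: curvature_def)
qed

lemma curvature_add_2:
  assumes "x \<in> tangent_space A p" "y \<in> tangent_space A p" "y' \<in> tangent_space A p" "z \<in> tangent_space A p"
  shows "curvature A D p x (y + y') z = curvature A D p x y z + curvature A D p x y' z"
  using assms by (simp add: curvature_antisym[of x] curvature_add_1)

lemma curvature_scaleR_2:
  assumes "x \<in> tangent_space A p" "y \<in> tangent_space A p" "z \<in> tangent_space A p"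
  shows "curvature A D p x (c *\<^sub>R y) z = c *\<^sub>R curvature A D p x y z"
  using assms by (simp add: curvature_antisym[of x] curvature_scaleR_1)

end

section \<open>The cone over a manifold\<close>

context manifold
begin

lemma cone_atlas_iff:
  "(W, \<Phi>) \<in> cone_atlas A \<longleftrightarrow> (\<exists>U \<phi>. (U, \<phi>) \<in> A \<and> W = {0<..} \<times> U \<and> \<Phi> = map_prod id \<phi>)"
  unfolding cone_atlas_def by force

lemma points_cone: "points (cone_atlas A) = {0<..} \<times> points A"
  unfolding points_def cone_atlas_def by force

lemma inv_cone_chart:
  assumes "(U, \<phi>) \<in> A" "s > 0" "y \<in> \<phi> ` U"
  shows "inv_into ({0<..} \<times> U) (map_prod id \<phi>) (s, y) = (s, inv_into U \<phi> y)"
proof -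
  obtain p where p: "p \<in> U" "y = \<phi> p" using assms(3) by auto
  have "inj_on (map_prod id \<phi>) ({0<..} \<times> U)"
    using chart(3)[OF assms(1)] by (auto simp: inj_on_def)
  then show ?thesis
    using p assms by (intro inv_into_f_eq) auto
qed

lemma cone_chart_image: "map_prod id \<phi> ` ({0<..} \<times> U) = {0<..} \<times> \<phi> ` U"
  by force

lemma smooth_atlas_cone: "smooth_atlas (cone_atlas A)"
  unfolding smooth_atlas_def
proof (intro conjI ballI)
  fix c assume "c \<in> cone_atlas A"
  then obtain U \<phi> where c: "(U, \<phi>) \<in> A" and c': "c = ({0::real<..} \<times> U, map_prod id \<phi>)"
    by (metis cone_atlas_iff surj_pair)
  have "continuous_on ({0<..} \<times> \<phi> ` U) (\<lambda>z. (fst z, inv_into U \<phi> (snd z)))"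
    by (intro continuous_intros continuous_on_compose2[OF chart(4)[OF c] continuous_on_snd]) auto
  then have "continuous_on ({0<..} \<times> \<phi> ` U) (inv_into ({0<..} \<times> U) (map_prod id \<phi>))"
    by (rule continuous_on_eq) (auto simp: inv_cone_chart[OF c])
  moreover have "continuous_on ({0<..} \<times> U) (\<lambda>z. (fst z, \<phi> (snd z)))"
    by (intro continuous_intros continuous_on_compose2[OF chart(5)[OF c] continuous_on_snd]) auto
  then have "continuous_on ({0<..} \<times> U) (map_prod id \<phi>)"
    by (rule continuous_on_eq) auto
  moreover have "inj_on (map_prod id \<phi>) ({0<..} \<times> U)"
    using chart(3)[OF c] by (auto simp: inj_on_def)
  ultimately show "is_chart c"
    unfolding is_chart_def c' using chart(1,2)[OF c] by (simp add: cone_chart_image open_Times)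
next
  have "smooth_on (map_prod id \<phi> ` ({0<..} \<times> U \<inter> {0<..} \<times> V))
      (map_prod id \<psi> \<circ> inv_into ({0::real<..} \<times> U) (map_prod id \<phi>))"
    if c: "(U, \<phi>) \<in> A" and d: "(V, \<psi>) \<in> A" for U V and \<phi> \<psi> :: "'a \<Rightarrow> 'e"
  proof -
    have S: "map_prod id \<phi> ` ({0<..} \<times> U \<inter> {0<..} \<times> V) = {0::real<..} \<times> \<phi> ` (U \<inter> V)"
      by force
    have op: "open (\<phi> ` (U \<inter> V))" "open ({0::real<..} \<times> \<phi> ` (U \<inter> V))"
      using open_chart_image[OF c chart(1)[OF d]] by (auto intro: open_Times)
    have "smooth_on ({0::real<..} \<times> \<phi> ` (U \<inter> V)) (\<lambda>z. (fst z, (\<psi> \<circ> inv_into U \<phi>) (snd z)))"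
      by (intro smooth_on_Pair op smooth_on_linear bounded_linear_fst bounded_linear_snd
          smooth_on_compose[OF op(2) op(1) _ _ transition[OF c d]]) auto
    then show ?thesis
      unfolding S by (subst smooth_on_cong[OF op(2)]) (use c in \<open>auto simp: inv_cone_chart\<close>)
  qed
  then show "case c of (U, \<phi>) \<Rightarrow> \<forall>(V, \<psi>)\<in>cone_atlas A. smooth_on (\<phi> ` (U \<inter> V)) (\<psi> \<circ> inv_into U \<phi>)"
    if "c \<in> cone_atlas A" for c
    using that by (cases c) (auto simp: cone_atlas_iff simp del: comp_apply)
qed

end

locale manifold_cone = manifold A
  for A :: "('a::topological_space, 'e::euclidean_space) atlas"
begin

abbreviation C :: "(real \<times> 'a, real \<times> 'e) atlas" where "C \<equiv> cone_atlas A"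

end

sublocale manifold_cone \<subseteq> C: manifold "cone_atlas A"
  by standard (rule smooth_atlas_cone)

context manifold_cone
begin

lemma cone_chart: "(U, \<phi>) \<in> A \<Longrightarrow> ({0<..} \<times> U, map_prod id \<phi>) \<in> C"
  by (auto simp: cone_atlas_iff)

lemma smooth_fun_snd:
  assumes f: "smooth_fun A V f" and V: "open V" and W: "open W" "W \<subseteq> UNIV \<times> V"
  shows "smooth_fun C W (\<lambda>z. f (snd z))"
proof (rule C.smooth_funI)
  fix U' \<Phi> assume "(U', \<Phi>) \<in> C"
  then obtain U \<phi> where c: "(U, \<phi>) \<in> A" and U': "U' = {0<..} \<times> U" and \<Phi>: "\<Phi> = map_prod id \<phi>"
    by (auto simp: cone_atlas_iff)
  have op: "open (map_prod id \<phi> ` ({0<..} \<times> U \<inter> W))"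
    by (rule C.open_chart_image[OF cone_chart[OF c] W(1)])
  have "smooth_on (map_prod id \<phi> ` ({0<..} \<times> U \<inter> W)) (\<lambda>z. (f \<circ> inv_into U \<phi>) (snd z))"
    by (rule smooth_on_compose[OF op open_chart_image[OF c V] _ smooth_on_linear[OF bounded_linear_snd]
          smooth_funD[OF f c]]) (use W in auto)
  then show "smooth_on (\<Phi> ` (U' \<inter> W)) ((\<lambda>z. f (snd z)) \<circ> inv_into U' \<Phi>)"
    unfolding U' \<Phi> by (subst smooth_on_cong[OF op]) (auto simp: inv_cone_chart[OF c])
qed

lemma smooth_fun_fst:
  assumes W: "open W"
  shows "smooth_fun C W fst"
proof (rule C.smooth_funI)
  fix U' \<Phi> assume "(U', \<Phi>) \<in> C"
  then obtain U \<phi> where c: "(U, \<phi>) \<in> A" and U': "U' = {0<..} \<times> U" and \<Phi>: "\<Phi> = map_prod id \<phi>"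
    by (auto simp: cone_atlas_iff)
  have op: "open (map_prod id \<phi> ` ({0<..} \<times> U \<inter> W))"
    by (rule C.open_chart_image[OF cone_chart[OF c] W])
  show "smooth_on (\<Phi> ` (U' \<inter> W)) (fst \<circ> inv_into U' \<Phi>)"
    unfolding U' \<Phi>
    by (subst smooth_on_cong[OF op, of _ fst])
      (auto simp: inv_cone_chart[OF c] intro: smooth_on_linear[OF bounded_linear_fst])
qed

lemma open_slice: "open W \<Longrightarrow> open {q. (t, q) \<in> W}"
  using open_vimage[of W "Pair t"] by (simp add: vimage_def continuous_on_Pair)

lemma smooth_fun_slice:
  assumes f: "smooth_fun C W f" and W: "open W" and t: "t > 0"
  shows "smooth_fun A {q. (t, q) \<in> W} (\<lambda>q. f (t, q))"
proof (rule smooth_funI)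
  fix U \<phi> assume c: "(U, \<phi>) \<in> A"
  let ?S = "\<phi> ` (U \<inter> {q. (t, q) \<in> W})"
  have op: "open ?S" by (rule open_chart_image[OF c open_slice[OF W]])
  have "smooth_on ?S (\<lambda>y. (f \<circ> inv_into ({0<..} \<times> U) (map_prod id \<phi>)) (t, y))"
  proof (rule smooth_on_compose[OF op C.open_chart_image[OF cone_chart[OF c] W]
        _ _ C.smooth_funD[OF f cone_chart[OF c]]])
    show "smooth_on ?S (Pair t)"
      by (rule smooth_on_Pair[OF op smooth_on_const smooth_on_linear[OF bounded_linear_ident]])
    show "Pair t ` ?S \<subseteq> map_prod id \<phi> ` ({0<..} \<times> U \<inter> W)"
      using t by force
  qed
  then show "smooth_on ?S ((\<lambda>q. f (t, q)) \<circ> inv_into U \<phi>)"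
    by (subst smooth_on_cong[OF op]) (use t in \<open>auto simp: inv_cone_chart[OF c]\<close>)
qed

lemma smooth_near_fst: "z \<in> points C \<Longrightarrow> smooth_near C z fst"
  by (rule C.smooth_nearI[OF C.open_points order_refl]) (auto intro: smooth_fun_fst C.open_points)

lemma smooth_near_slice:
  assumes "smooth_near C (t, p) f"
  shows "smooth_near A p (\<lambda>q. f (t, q))"
proof -
  obtain W where W: "open W" "W \<subseteq> points C" "(t, p) \<in> W" "smooth_fun C W f"
    by (rule C.smooth_nearE[OF assms])
  then have "t > 0" by (auto simp: points_cone)
  with W show ?thesis
    by (intro smooth_nearI[of "{q. (t, q) \<in> W}"] smooth_fun_slice open_slice) (auto simp: points_cone)
qed

lemma smooth_near_snd:
  assumes "t > 0"
  shows "smooth_near C (t, p) (\<lambda>z. f (snd z)) \<longleftrightarrow> smooth_near A p f"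
proof
  assume "smooth_near A p f"
  then obtain V where V: "open V" "V \<subseteq> points A" "p \<in> V" "smooth_fun A V f"
    by (rule smooth_nearE)
  then show "smooth_near C (t, p) (\<lambda>z. f (snd z))"
    using assms by (intro C.smooth_nearI[of "{0<..} \<times> V"] smooth_fun_snd[OF V(4)])
      (auto simp: points_cone open_Times)
next
  assume "smooth_near C (t, p) (\<lambda>z. f (snd z))"
  from smooth_near_slice[OF this] show "smooth_near A p f" by simp
qed

text \<open>The derivative of \<open>f\<close> in direction \<open>(a, w)\<close>
  splits into the derivatives of the slices \<open>f(t, \<cdot>)\<close> and \<open>f(\<cdot>, p)\<close>.\<close>

lemma coord_vec_cone:
  assumes c: "(U, \<phi>) \<in> A" and p: "p \<in> U" and t: "t > 0"
  shows "coord_vec C (t, p) ({0<..} \<times> U, map_prod id \<phi>) (a, w) = cone_vec A (t, p) (coord_vec A p (U, \<phi>) w) a"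
proof (rule tvec_eqI)
  fix f
  let ?W = "{0<..} \<times> U" and ?\<Phi> = "map_prod id \<phi> :: real \<times> 'a \<Rightarrow> real \<times> 'e"
  show "act (coord_vec C (t, p) (?W, ?\<Phi>) (a, w)) f = act (cone_vec A (t, p) (coord_vec A p (U, \<phi>) w) a) f"
  proof (cases "smooth_near C (t, p) f")
    case f: True
    define F where "F = f \<circ> inv_into ?W ?\<Phi>"
    define F' where "F' = frechet_derivative F (at (?\<Phi> (t, p)))"
    have F: "(F has_derivative F') (at (t, \<phi> p))"
      using C.smooth_near_has_derivative[OF f cone_chart[OF c]] p t unfolding F_def F'_def by simp
    have "((\<lambda>y. F (t, y)) has_derivative (\<lambda>w. F' (0, w))) (at (\<phi> p))"
      by (rule has_derivative_compose[of "\<lambda>y. (t, y)" _ _ _ F, OF _ F])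
        (intro has_derivative_Pair has_derivative_const has_derivative_ident)
    then have "((\<lambda>q. f (t, q)) \<circ> inv_into U \<phi> has_derivative (\<lambda>w. F' (0, w))) (at (\<phi> p))"
      by (rule has_derivative_transform_within_open[OF _ chart(2)[OF c]])
        (use p t in \<open>auto simp: F_def inv_cone_chart[OF c]\<close>)
    from frechet_derivative_at[OF this, symmetric]
    have 1: "act (coord_vec A p (U, \<phi>) w) (\<lambda>q. f (t, q)) = F' (0, w)"
      by (simp add: act_coord_vec smooth_near_slice[OF f])
    have "((\<lambda>s. F (s, \<phi> p)) has_derivative (\<lambda>s. F' (s, 0))) (at t)"
      by (rule has_derivative_compose[of "\<lambda>s. (s, \<phi> p)" _ _ _ F, OF _ F])
        (intro has_derivative_Pair has_derivative_const has_derivative_ident)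
    then have "((\<lambda>s. f (s, p)) has_derivative (\<lambda>s. F' (s, 0))) (at t)"
      by (rule has_derivative_transform_within_open[OF _ open_greaterThan[of 0]])
        (use p t c in \<open>auto simp: F_def inv_cone_chart[OF c]\<close>)
    moreover have "(\<lambda>s. F' (s, 0)) = (*) (F' (1, 0))"
    proof
      show "F' (s, 0) = F' (1, 0) * s" for s
        using linear_cmul[OF has_derivative_linear[OF F], of s "(1, 0)"] by (simp add: mult.commute)
    qed
    ultimately have "((\<lambda>s. f (s, p)) has_field_derivative F' (1, 0)) (at t)"
      by (simp add: has_field_derivative_def)
    then have 2: "deriv (\<lambda>s. f (s, p)) t = F' (1, 0)"
      by (rule DERIV_imp_deriv)
    have "F' (a, w) = a * F' (1, 0) + F' (0, w)"
      using linear_add[OF has_derivative_linear[OF F], of "a *\<^sub>R (1, 0)" "(0, w)"]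
        linear_cmul[OF has_derivative_linear[OF F], of a "(1, 0)"] by simp
    then show ?thesis
      by (simp add: C.act_coord_vec f cone_vec_def 1 2) (simp add: F'_def F_def)
  qed (simp add: coord_vec_def cone_vec_def)
qed

lemma cone_vec_tangent [simp]:
  assumes "x \<in> tangent_space A p" "t > 0"
  shows "cone_vec A (t, p) x a \<in> tangent_space C (t, p)"
proof -
  obtain U \<phi> w where "(U, \<phi>) \<in> A" "p \<in> U" "x = coord_vec A p (U, \<phi>) w"
    by (rule tangentE[OF assms(1)])
  then show ?thesis
    using C.coord_vec_tangent[OF cone_chart, of U \<phi> "(t, p)" "(a, w)"] assms(2) by (simp add: coord_vec_cone)
qed

lemma tangent_coneE:
  assumes "v \<in> tangent_space C (t, p)"
  obtains x a where "x \<in> tangent_space A p" "v = cone_vec A (t, p) x a"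
proof -
  obtain W \<Phi> w where "(W, \<Phi>) \<in> C" and z: "(t, p) \<in> W" and v: "v = coord_vec C (t, p) (W, \<Phi>) w"
    by (rule C.tangentE[OF assms])
  then obtain U \<phi> where c: "(U, \<phi>) \<in> A" and W: "W = {0<..} \<times> U" "\<Phi> = map_prod id \<phi>"
    by (auto simp: cone_atlas_iff)
  have "v = cone_vec A (t, p) (coord_vec A p (U, \<phi>) (snd w)) (fst w)"
    using coord_vec_cone[OF c, of p t "fst w" "snd w"] z by (simp add: v W)
  then show ?thesis
    using that coord_vec_tangent[OF c] z W(1) by blast
qed

lemma act_horizontal: "act (horizontal v) f = act v (\<lambda>z. f (snd z))"
  by (simp add: horizontal_def comp_def)

lemma horizontal_cone_vec [simp]:
  assumes "x \<in> tangent_space A p" "t > 0"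
  shows "horizontal (cone_vec A (t, p) x a) = x"
proof (rule tvec_eqI)
  fix f show "act (horizontal (cone_vec A (t, p) x a)) f = act x f"
    using act_not_smooth[OF assms(1), of f] by (simp add: act_horizontal cone_vec_def smooth_near_snd assms(2))
qed

lemma radial_cone_vec [simp]:
  assumes "x \<in> tangent_space A p" "t > 0"
  shows "radial (cone_vec A (t, p) x a) = a"
  using smooth_near_fst[of "(t, p)"] tangent_points[OF assms(1)] assms(2)
  by (simp add: radial_def cone_vec_def act_const[OF assms(1)] points_cone)

lemma horizontal_simps [simp]:
  "horizontal (v + w) = horizontal v + horizontal w" "horizontal (v - w) = horizontal v - horizontal w"
  "horizontal (r *\<^sub>R v) = r *\<^sub>R horizontal v" "horizontal 0 = 0"
  by (rule tvec_eqI, simp add: act_horizontal)+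

lemma radial_simps [simp]:
  "radial (v + w) = radial v + radial w" "radial (v - w) = radial v - radial w"
  "radial (r *\<^sub>R v) = r * radial v" "radial 0 = 0"
  by (simp_all add: radial_def)

lemma tangent_cone_pos: "v \<in> tangent_space C z \<Longrightarrow> fst z > 0"
  using C.tangent_points[of v z] by (auto simp: points_cone mem_Times_iff)

lemma horizontal_tangent [simp]:
  assumes "v \<in> tangent_space C z"
  shows "horizontal v \<in> tangent_space A (snd z)"
  using assms tangent_cone_pos[OF assms] by (cases z) (auto elim!: tangent_coneE)

lemma cone_vec_collapse:
  assumes "v \<in> tangent_space C z"
  shows "cone_vec A z (horizontal v) (radial v) = v"
  using assms tangent_cone_pos[OF assms] by (cases z) (auto elim!: tangent_coneE)

lemma tangent_cone_eqI:
  assumes "v \<in> tangent_space C z" "w \<in> tangent_space C z" "horizontal v = horizontal w" "radial v = radial w"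
  shows "v = w"
  using cone_vec_collapse assms by metis

lemma cone_vec_add:
  assumes "x \<in> tangent_space A p" "y \<in> tangent_space A p" "t > 0"
  shows "cone_vec A (t, p) (x + y) (a + b) = cone_vec A (t, p) x a + cone_vec A (t, p) y b"
  by (rule tangent_cone_eqI[of _ "(t, p)"]) (simp_all add: assms)

lemma cone_vec_scaleR:
  assumes "x \<in> tangent_space A p" "t > 0"
  shows "cone_vec A (t, p) (c *\<^sub>R x) (c * a) = c *\<^sub>R cone_vec A (t, p) x a"
  by (rule tangent_cone_eqI[of _ "(t, p)"]) (simp_all add: assms)

text \<open>In the product chart of \<open>\<phi>\<close> the components of \<open>Z\<close> are its radial part and the \<open>\<phi>\<close>-coordinates of its
  horizontal part.\<close>

lemma smooth_field_coneI:
  assumes W: "open W"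
    and Z: "\<And>z. z \<in> W \<Longrightarrow> Z z \<in> tangent_space C z"
    and radial: "smooth_fun C W (\<lambda>z. radial (Z z))"
    and horizontal: "\<And>U \<phi> b. (U, \<phi>) \<in> A \<Longrightarrow>
      smooth_fun C (W \<inter> {0<..} \<times> U) (\<lambda>z. act (horizontal (Z z)) (\<lambda>q. \<phi> q \<bullet> b))"
  shows "smooth_field C W Z"
proof (rule C.smooth_field_local)
  fix z assume z: "z \<in> W"
  then have "z \<in> points C" using C.tangent_points[OF Z] by blast
  then obtain U \<phi> where c: "(U, \<phi>) \<in> A" and zU: "z \<in> {0<..} \<times> U"
    using point_in_chart[of "snd z"] by (cases z) (auto simp: points_cone)
  have op: "open (W \<inter> {0<..} \<times> U)"
    using W chart(1)[OF c] by (intro open_Int open_Times) auto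
  have "smooth_field C (W \<inter> {0<..} \<times> U) Z"
  proof (rule C.smooth_field_chartI[OF cone_chart[OF c] _ op])
    fix b :: "real \<times> 'e" assume "b \<in> Basis"
    then consider "b = (1, 0)" | b' where "b = (0, b')" by (auto simp: Basis_prod_def)
    then show "smooth_fun C (W \<inter> {0<..} \<times> U) (\<lambda>z. act (Z z) (\<lambda>q. map_prod id \<phi> q \<bullet> b))"
    proof cases
      case 1
      then have "(\<lambda>z. act (Z z) (\<lambda>q. map_prod id \<phi> q \<bullet> b)) = (\<lambda>z. radial (Z z))"
        by (simp add: radial_def inner_prod_def)
      then show ?thesis using C.smooth_fun_subset[OF radial] by simp
    next
      case 2
      then have "(\<lambda>z. act (Z z) (\<lambda>q. map_prod id \<phi> q \<bullet> b)) = (\<lambda>z. act (horizontal (Z z)) (\<lambda>q. \<phi> q \<bullet> b'))"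
        by (simp add: act_horizontal inner_prod_def)
      then show ?thesis using horizontal[OF c] by simp
    qed
  qed (use Z in auto)
  then show "\<exists>W. open W \<and> z \<in> W \<and> smooth_field C W Z" using op z zU by blast
qed

lemma smooth_fun_radial:
  assumes "smooth_field C W Z" "open W"
  shows "smooth_fun C W (\<lambda>z. radial (Z z))"
  unfolding radial_def by (rule C.smooth_field_act[OF assms order_refl smooth_fun_fst[OF assms(2)]])

lemma smooth_fun_horizontal:
  assumes c: "(U, \<phi>) \<in> A" and Z: "smooth_field C W Z" and W: "open W" "W \<subseteq> UNIV \<times> U"
  shows "smooth_fun C W (\<lambda>z. act (horizontal (Z z)) (\<lambda>q. \<phi> q \<bullet> b))"
  unfolding act_horizontal
  by (rule C.smooth_field_act[OF Z W(1) order_refl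
        smooth_fun_snd[OF smooth_fun_coordinate[OF c order_refl chart(1)[OF c]] chart(1)[OF c] W]])

definition lift :: "'a vfield \<Rightarrow> (real \<times> 'a) vfield" where
  "lift X z = cone_vec A z (X (snd z)) 0"

lemma field_near_lift:
  assumes X: "field_near A p X" and t: "t > 0"
  shows "field_near C (t, p) (lift X)"
proof -
  obtain V where V: "open V" "p \<in> V" "smooth_field A V X" by (rule field_nearE[OF X])
  have op: "open ({0::real<..} \<times> V)" using V by (simp add: open_Times)
  have "smooth_field C ({0<..} \<times> V) (lift X)"
  proof (rule smooth_field_coneI[OF op])
    show "lift X z \<in> tangent_space C z" if "z \<in> {0<..} \<times> V" for z
      using that smooth_field_tangent[OF V(3)] by (auto simp: lift_def)
    have "smooth_fun C ({0<..} \<times> V) (\<lambda>z. radial (lift X z)) = smooth_fun C ({0<..} \<times> V) (\<lambda>z. 0)"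
      by (rule C.smooth_fun_cong[OF op]) (use smooth_field_tangent[OF V(3)] in \<open>auto simp: lift_def\<close>)
    then show "smooth_fun C ({0<..} \<times> V) (\<lambda>z. radial (lift X z))"
      by (simp add: C.smooth_fun_const)
    fix U \<phi> b assume c: "(U, \<phi>) \<in> A"
    let ?W = "{0::real<..} \<times> V \<inter> {0<..} \<times> U"
    have VU: "open (V \<inter> U)" and opW: "open ?W" using V chart(1)[OF c] op by (auto intro!: open_Int open_Times)
    have "smooth_fun A (V \<inter> U) (\<lambda>q. act (X q) (\<lambda>q. \<phi> q \<bullet> b))"
      using V c VU by (intro smooth_field_act[OF V(3)] smooth_fun_coordinate) auto
    then have "smooth_fun C ?W (\<lambda>z. act (X (snd z)) (\<lambda>q. \<phi> q \<bullet> b))"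
      by (rule smooth_fun_snd[OF _ VU opW]) auto
    then show "smooth_fun C ?W (\<lambda>z. act (horizontal (lift X z)) (\<lambda>q. \<phi> q \<bullet> b))"
      by (subst C.smooth_fun_cong[OF opW])
        (use smooth_field_tangent[OF V(3)] in \<open>auto simp: lift_def\<close>)
  qed
  then show ?thesis using V t by (intro C.field_nearI[OF op]) auto
qed

lemma xi_tangent [simp]: "z \<in> points C \<Longrightarrow> cone_xi A z \<in> tangent_space C z"
  by (cases z) (simp add: cone_xi_def points_cone)

lemma cone_xi_simps [simp]:
  "z \<in> points C \<Longrightarrow> horizontal (cone_xi A z) = 0" "z \<in> points C \<Longrightarrow> radial (cone_xi A z) = 1"
  by (cases z; simp add: cone_xi_def points_cone)+

lemma smooth_field_xi: "smooth_field C (points C) (cone_xi A)"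
proof (rule smooth_field_coneI[OF C.open_points xi_tangent])
  show "smooth_fun C (points C) (\<lambda>z. radial (cone_xi A z))"
    using C.smooth_fun_cong[OF C.open_points, of "\<lambda>z. radial (cone_xi A z)" "\<lambda>z. 1"]
    by (simp add: C.smooth_fun_const)
  fix U \<phi> b assume c: "(U, \<phi>) \<in> A"
  have "open (points C \<inter> {0<..} \<times> U)" using C.open_points chart(1)[OF c] by (intro open_Int open_Times) auto
  then show "smooth_fun C (points C \<inter> {0<..} \<times> U) (\<lambda>z. act (horizontal (cone_xi A z)) (\<lambda>q. \<phi> q \<bullet> b))"
    using C.smooth_fun_cong[of "points C \<inter> {0<..} \<times> U" "\<lambda>z. act (horizontal (cone_xi A z)) (\<lambda>q. \<phi> q \<bullet> b)" "\<lambda>z. 0"]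
    by (simp add: C.smooth_fun_const)
qed

lemma field_near_xi: "z \<in> points C \<Longrightarrow> field_near C z (cone_xi A)"
  by (rule C.field_nearI[OF C.open_points _ smooth_field_xi])

lemma smooth_one_form_eta: "smooth_one_form C cone_eta"
  unfolding smooth_one_form_def cone_eta_def
  by (auto simp: open_in_def intro: smooth_fun_radial)

end

section \<open>The metric and the structure tensors of the cone\<close>

locale riemannian_manifold = manifold A
  for A :: "('a::topological_space, 'e::euclidean_space) atlas" +
  fixes g :: "'a metric"
  assumes riemannian_metric: "riemannian_metric A g"
begin

lemma metric_sym: "x \<in> tangent_space A p \<Longrightarrow> y \<in> tangent_space A p \<Longrightarrow> g p x y = g p y x"
  and metric_add_left: "x \<in> tangent_space A p \<Longrightarrow> y \<in> tangent_space A p \<Longrightarrow> z \<in> tangent_space A p \<Longrightarrow>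
    g p (x + y) z = g p x z + g p y z"
  and metric_scaleR_left: "x \<in> tangent_space A p \<Longrightarrow> y \<in> tangent_space A p \<Longrightarrow> g p (a *\<^sub>R x) y = a * g p x y"
  and metric_pos: "x \<in> tangent_space A p \<Longrightarrow> x \<noteq> 0 \<Longrightarrow> g p x x > 0"
  using riemannian_metric tangent_points unfolding riemannian_metric_def by blast+

lemma metric_add_right: "x \<in> tangent_space A p \<Longrightarrow> y \<in> tangent_space A p \<Longrightarrow> z \<in> tangent_space A p \<Longrightarrow>
    g p z (x + y) = g p z x + g p z y"
  using metric_add_left[of x p y z] metric_sym[of z p] by simp

lemma metric_scaleR_right: "x \<in> tangent_space A p \<Longrightarrow> y \<in> tangent_space A p \<Longrightarrow> g p y (a *\<^sub>R x) = a * g p y x"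
  using metric_scaleR_left[of x p y a] metric_sym[of y p] by simp

lemma metric_diff_left: "x \<in> tangent_space A p \<Longrightarrow> y \<in> tangent_space A p \<Longrightarrow> z \<in> tangent_space A p \<Longrightarrow>
    g p (x - y) z = g p x z - g p y z"
  using metric_add_left[of "x - y" p y z] by simp

lemma metric_diff_right: "x \<in> tangent_space A p \<Longrightarrow> y \<in> tangent_space A p \<Longrightarrow> z \<in> tangent_space A p \<Longrightarrow>
    g p z (x - y) = g p z x - g p z y"
  using metric_add_right[of "x - y" p y z] by simp

lemma metric_zero_left [simp]: "x \<in> tangent_space A p \<Longrightarrow> g p 0 x = 0"
  using metric_scaleR_left[of x p x 0] by simp

lemma metric_zero_right [simp]: "x \<in> tangent_space A p \<Longrightarrow> g p x 0 = 0"
  using metric_scaleR_right[of x p x 0] by simp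

lemma metric_sum_left:
  assumes "\<And>i. i \<in> I \<Longrightarrow> x i \<in> tangent_space A p" "y \<in> tangent_space A p"
  shows "g p (\<Sum>i\<in>I. x i) y = (\<Sum>i\<in>I. g p (x i) y)"
  using assms
proof (induction I rule: infinite_finite_induct)
  case (insert i I)
  then show ?case by (simp add: metric_add_left tangent_sum tangent_points[OF assms(2)])
qed auto

lemma metric_sum_right:
  assumes "\<And>i. i \<in> I \<Longrightarrow> x i \<in> tangent_space A p" "y \<in> tangent_space A p"
  shows "g p y (\<Sum>i\<in>I. x i) = (\<Sum>i\<in>I. g p y (x i))"
  using metric_sum_left[OF assms] assms tangent_sum[OF tangent_points[OF assms(2)], of I x]
  by (simp add: metric_sym[of y] cong: sum.cong)

lemma metric_nonneg: "x \<in> tangent_space A p \<Longrightarrow> g p x x \<ge> 0"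
  using metric_pos[of x p] by (cases "x = 0") auto

lemma metric_eqI:
  assumes "x \<in> tangent_space A p" "y \<in> tangent_space A p"
    "\<And>z. z \<in> tangent_space A p \<Longrightarrow> g p x z = g p y z"
  shows "x = y"
proof (rule ccontr)
  assume "x \<noteq> y"
  then have "g p (x - y) (x - y) > 0" using assms by (intro metric_pos) auto
  then show False using assms by (simp add: metric_diff_left)
qed

lemma smooth_fun_metric:
  "open V \<Longrightarrow> smooth_field A V X \<Longrightarrow> smooth_field A V Y \<Longrightarrow> smooth_fun A V (\<lambda>p. g p (X p) (Y p))"
  using riemannian_metric smooth_field_tangent tangent_points
  unfolding riemannian_metric_def open_in_def by (meson subsetI)

lemma smooth_near_metric:
  assumes "field_near A p X" "field_near A p Y"
  shows "smooth_near A p (\<lambda>p. g p (X p) (Y p))"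
proof -
  obtain V where V: "open V" "p \<in> V" "smooth_field A V X" by (rule field_nearE[OF assms(1)])
  obtain W where W: "open W" "p \<in> W" "smooth_field A W Y" by (rule field_nearE[OF assms(2)])
  have "smooth_fun A (V \<inter> W) (\<lambda>p. g p (X p) (Y p))"
    using V W by (intro smooth_fun_metric) (auto intro: smooth_field_subset)
  moreover have "V \<inter> W \<subseteq> points A" using smooth_field_tangent[OF V(3)] tangent_points by blast
  ultimately show ?thesis using V W by (intro smooth_nearI[of "V \<inter> W"]) auto
qed

end

locale riemannian_cone = manifold_cone A + riemannian_manifold A h
  for A :: "('a::topological_space, 'e::euclidean_space) atlas" and h
begin

abbreviation g :: "(real \<times> 'a) metric" where "g \<equiv> cone_metric h"

lemma horizontal_expand:
  assumes c: "(U, \<phi>) \<in> A" and z: "snd z \<in> U" and v: "v \<in> tangent_space C z"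
  shows "horizontal v = (\<Sum>b\<in>Basis. act (horizontal v) (\<lambda>q. \<phi> q \<bullet> b) *\<^sub>R coord_vec A (snd z) (U, \<phi>) b)"
  by (rule tangent_expand[OF c z horizontal_tangent[OF v]])

text \<open>The horizontal part of a field of the cone depends on \<open>t\<close> and so is not a field of the base. Expanding it in
  coordinate fields \<open>E\<^sub>b\<close> of the base writes the metric through the functions \<open>h(E\<^sub>b, E\<^sub>d)\<close>, which are smooth by
  hypothesis, and the components of the field. The same device serves for the endomorphism.\<close>

lemma smooth_fun_cone_metric:
  assumes W: "open W" and Z: "smooth_field C W Z" and Z': "smooth_field C W Z'"
  shows "smooth_fun C W (\<lambda>z. g z (Z z) (Z' z))"
proof (rule C.smooth_fun_local)
  fix z assume z: "z \<in> W"
  then have "z \<in> points C" using C.tangent_points[OF C.smooth_field_tangent[OF Z]] by blast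
  then obtain U \<phi> where c: "(U, \<phi>) \<in> A" and zU: "z \<in> {0<..} \<times> U"
    using point_in_chart[of "snd z"] by (cases z) (auto simp: points_cone)
  let ?W = "W \<inter> {0<..} \<times> U"
  have op: "open ?W" and WU: "?W \<subseteq> UNIV \<times> U" using W chart(1)[OF c] by (auto intro!: open_Int open_Times)
  have ZW: "smooth_field C ?W Z" "smooth_field C ?W Z'"
    using Z Z' by (auto intro: C.smooth_field_subset)
  let ?E = "\<lambda>b q. coord_vec A q (U, \<phi>) b"
  let ?S = "\<lambda>z. fst z * fst z * (\<Sum>b\<in>Basis. \<Sum>d\<in>Basis. act (horizontal (Z z)) (\<lambda>q. \<phi> q \<bullet> b) *
      act (horizontal (Z' z)) (\<lambda>q. \<phi> q \<bullet> d) * h (snd z) (?E b (snd z)) (?E d (snd z)))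
      + radial (Z z) * radial (Z' z)"
  have "smooth_fun C ?W (\<lambda>z. h (snd z) (?E b (snd z)) (?E d (snd z)))" for b d
    by (rule smooth_fun_snd[OF smooth_fun_metric[OF chart(1)[OF c] smooth_field_coord_vec[OF c]
            smooth_field_coord_vec[OF c]] chart(1)[OF c] op WU])
  then have "smooth_fun C ?W ?S"
    by (intro C.smooth_fun_add C.smooth_fun_mult C.smooth_fun_sum op smooth_fun_fst
        smooth_fun_radial ZW smooth_fun_horizontal[OF c _ op WU])
  moreover have "?S z = g z (Z z) (Z' z)" if "z \<in> ?W" for z
  proof -
    have t: "Z z \<in> tangent_space C z" "Z' z \<in> tangent_space C z" and zU: "snd z \<in> U"
      using that C.smooth_field_tangent[OF Z] C.smooth_field_tangent[OF Z'] by auto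
    note E = coord_vec_tangent[OF c zU]
    have "h (snd z) (horizontal (Z z)) (horizontal (Z' z)) =
        h (snd z) (\<Sum>b\<in>Basis. act (horizontal (Z z)) (\<lambda>q. \<phi> q \<bullet> b) *\<^sub>R ?E b (snd z))
          (\<Sum>b\<in>Basis. act (horizontal (Z' z)) (\<lambda>q. \<phi> q \<bullet> b) *\<^sub>R ?E b (snd z))"
      using horizontal_expand[OF c zU t(1)] horizontal_expand[OF c zU t(2)] by (rule arg_cong2)
    also have "\<dots> = (\<Sum>b\<in>Basis. \<Sum>d\<in>Basis. act (horizontal (Z z)) (\<lambda>q. \<phi> q \<bullet> b) *
      act (horizontal (Z' z)) (\<lambda>q. \<phi> q \<bullet> d) * h (snd z) (?E b (snd z)) (?E d (snd z)))"
      by (simp add: metric_sum_left metric_sum_right metric_scaleR_left metric_scaleR_right E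
          tangent_sum tangent_points[OF E] sum_distrib_left mult.assoc)
        (subst sum.swap, simp add: mult_ac)
    finally show ?thesis by (simp add: cone_metric_def power2_eq_square)
  qed
  ultimately have "smooth_fun C ?W (\<lambda>z. g z (Z z) (Z' z))"
    using C.smooth_fun_cong[OF op, of ?S "\<lambda>z. g z (Z z) (Z' z)"] by blast
  then show "\<exists>W. open W \<and> z \<in> W \<and> smooth_fun C W (\<lambda>z. g z (Z z) (Z' z))" using op z zU by blast
qed

lemma riemannian_metric_cone: "riemannian_metric C g"
  unfolding riemannian_metric_def
proof (intro conjI ballI allI impI)
  fix z x y assume x: "x \<in> tangent_space C z" and y: "y \<in> tangent_space C z"
  note t = horizontal_tangent[OF x] horizontal_tangent[OF y]
  show "g z x y = g z y x"
    using metric_sym[OF t] by (simp add: cone_metric_def mult.commute)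
  show "g z (x + y) w = g z x w + g z y w" if "w \<in> tangent_space C z" for w
    using metric_add_left[OF t horizontal_tangent[OF that]] by (simp add: cone_metric_def algebra_simps)
  show "g z (a *\<^sub>R x) y = a * g z x y" for a
    using metric_scaleR_left[OF t, of a] by (simp add: cone_metric_def algebra_simps)
  show "g z x x > 0" if "x \<noteq> 0"
  proof (cases "horizontal x = 0")
    case True
    then have "radial x \<noteq> 0"
      using tangent_cone_eqI[OF x, of 0] C.tangent_points[OF x] that by auto
    then show ?thesis
      using metric_nonneg[OF t(1)] unfolding cone_metric_def
      by (intro add_nonneg_pos mult_nonneg_nonneg) (auto simp: zero_less_mult_iff linorder_neq_iff)
  next
    case False
    then have "(fst z)\<^sup>2 * h (snd z) (horizontal x) (horizontal x) > 0"
      using metric_pos[OF t(1)] tangent_cone_pos[OF x] by simp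
    then show ?thesis by (simp add: cone_metric_def add_pos_nonneg)
  qed
next
  fix W Z Z' assume "open_in C W \<and> smooth_field C W Z \<and> smooth_field C W Z'"
  then show "smooth_fun C W (\<lambda>z. g z (Z z) (Z' z))"
    by (auto simp: open_in_def intro: smooth_fun_cone_metric)
qed

lemma cone_metric_cone_vec:
  assumes "x \<in> tangent_space A p" "y \<in> tangent_space A p" "t > 0"
  shows "g (t, p) (cone_vec A (t, p) x a) (cone_vec A (t, p) y b) = t\<^sup>2 * h p x y + a * b"
  using assms by (simp add: cone_metric_def)

lemma smooth_endo_cone:
  assumes P: "smooth_endo A P"
  shows "smooth_endo C (cone_endo A P)"
proof -
  have Pt: "P p x \<in> tangent_space A p"
    and Padd: "y \<in> tangent_space A p \<Longrightarrow> P p (x + y) = P p x + P p y"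
    and Pscale: "P p (a *\<^sub>R x) = a *\<^sub>R P p x" if "x \<in> tangent_space A p" for p x y a
    using P that tangent_points[OF that] unfolding smooth_endo_def by auto
  have Pzero: "P p 0 = 0" if "p \<in> points A" for p
    using Pscale[of 0 p 0] that by simp
  have Psum: "P p (\<Sum>i\<in>I. x i) = (\<Sum>i\<in>I. P p (x i))"
    if "p \<in> points A" "\<And>i. i \<in> I \<Longrightarrow> x i \<in> tangent_space A p" for p x and I :: "'e set"
    using that(2)
    by (induction I rule: infinite_finite_induct) (auto simp: Pzero Padd tangent_sum that(1))
  have Ft: "cone_endo A P z x \<in> tangent_space C z" if "x \<in> tangent_space C z" for z x
    using Pt[OF horizontal_tangent[OF that]] tangent_cone_pos[OF that]
    by (cases z) (simp add: cone_endo_def)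
  show ?thesis
    unfolding smooth_endo_def
  proof (intro conjI ballI allI impI)
    fix z x assume x: "x \<in> tangent_space C z"
    note hx = Pt[OF horizontal_tangent[OF x]]
    show "cone_endo A P z x \<in> tangent_space C z" by (rule Ft[OF x])
    show "cone_endo A P z (x + y) = cone_endo A P z x + cone_endo A P z y" if y: "y \<in> tangent_space C z" for y
      using cone_vec_add[OF hx Pt[OF horizontal_tangent[OF y]] tangent_cone_pos[OF x], of 0 0]
      by (simp add: cone_endo_def Padd x y)
    show "cone_endo A P z (a *\<^sub>R x) = a *\<^sub>R cone_endo A P z x" for a
      using cone_vec_scaleR[OF hx tangent_cone_pos[OF x], of a 0] by (simp add: cone_endo_def Pscale x)
  next
    fix W Z assume "open_in C W \<and> smooth_field C W Z"
    then have W: "open W" and Z: "smooth_field C W Z" by (auto simp: open_in_def)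
    have Zt: "Z z \<in> tangent_space C z" if "z \<in> W" for z by (rule C.smooth_field_tangent[OF Z that])
    have hF: "horizontal (cone_endo A P z (Z z)) = P (snd z) (horizontal (Z z))"
      and rF: "radial (cone_endo A P z (Z z)) = 0" if "z \<in> W" for z
      using Pt[OF horizontal_tangent[OF Zt[OF that]]] tangent_cone_pos[OF Zt[OF that]]
      by (cases z; simp add: cone_endo_def)+
    show "smooth_field C W (\<lambda>z. cone_endo A P z (Z z))"
    proof (rule smooth_field_coneI[OF W])
      show "cone_endo A P z (Z z) \<in> tangent_space C z" if "z \<in> W" for z by (rule Ft[OF Zt[OF that]])
      show "smooth_fun C W (\<lambda>z. radial (cone_endo A P z (Z z)))"
        using C.smooth_fun_cong[OF W, of "\<lambda>z. radial (cone_endo A P z (Z z))" "\<lambda>z. 0"]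
        by (simp add: rF C.smooth_fun_const)
      fix U \<phi> b assume c: "(U, \<phi>) \<in> A"
      let ?W = "W \<inter> {0<..} \<times> U" and ?E = "\<lambda>d q. coord_vec A q (U, \<phi>) d"
      have op: "open ?W" and WU: "?W \<subseteq> UNIV \<times> U"
        using W chart(1)[OF c] by (auto intro!: open_Int open_Times)
      have ZW: "smooth_field C ?W Z" by (rule C.smooth_field_subset[OF Z]) auto
      have PE: "smooth_field A U (\<lambda>q. P q (?E d q))" for d
        using P smooth_field_coord_vec[OF c] chart(1)[OF c] chart_subset_points[OF c]
        unfolding smooth_endo_def open_in_def by blast
      have "smooth_fun C ?W (\<lambda>z. \<Sum>d\<in>Basis. act (horizontal (Z z)) (\<lambda>q. \<phi> q \<bullet> d) *
          act (P (snd z) (?E d (snd z))) (\<lambda>q. \<phi> q \<bullet> b))"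
        by (intro C.smooth_fun_sum C.smooth_fun_mult op smooth_fun_horizontal[OF c ZW op WU]
            smooth_fun_snd[OF smooth_field_act[OF PE] _ op WU] smooth_fun_coordinate[OF c] chart(1)[OF c] order_refl)
      moreover have "(\<Sum>d\<in>Basis. act (horizontal (Z z)) (\<lambda>q. \<phi> q \<bullet> d) *
          act (P (snd z) (?E d (snd z))) (\<lambda>q. \<phi> q \<bullet> b)) =
          act (horizontal (cone_endo A P z (Z z))) (\<lambda>q. \<phi> q \<bullet> b)" if "z \<in> ?W" for z
      proof -
        have zU: "snd z \<in> U" and zW: "z \<in> W" using that by auto
        note E = coord_vec_tangent[OF c zU]
        have "P (snd z) (horizontal (Z z)) =
            P (snd z) (\<Sum>d\<in>Basis. act (horizontal (Z z)) (\<lambda>q. \<phi> q \<bullet> d) *\<^sub>R ?E d (snd z))"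
          using horizontal_expand[OF c zU Zt[OF zW]] by (rule arg_cong)
        also have "\<dots> = (\<Sum>d\<in>Basis. act (horizontal (Z z)) (\<lambda>q. \<phi> q \<bullet> d) *\<^sub>R P (snd z) (?E d (snd z)))"
          by (simp add: Psum Pscale E tangent_points[OF E])
        finally show ?thesis by (simp add: hF zW)
      qed
      ultimately show "smooth_fun C ?W (\<lambda>z. act (horizontal (cone_endo A P z (Z z))) (\<lambda>q. \<phi> q \<bullet> b))"
        using C.smooth_fun_cong[OF op] by (metis (no_types, lifting))
    qed
  qed
qed

end

sublocale riemannian_cone \<subseteq> C: riemannian_manifold "cone_atlas A" "cone_metric h"
  by standard (rule riemannian_metric_cone)

section \<open>The curvature of the cone\<close>

locale riemannian_connection = riemannian_manifold A g + levi_civita_connection A g D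
  for A :: "('a::topological_space, 'e::euclidean_space) atlas" and g D
begin

text \<open>The right-hand side involves only the metric and brackets, so it can be compared between the cone and its base.\<close>

lemma koszul:
  assumes X: "field_near A p X" and Y: "field_near A p Y" and Z: "field_near A p Z"
  shows "2 * g p (D p (X p) Y) (Z p) =
    act (X p) (\<lambda>q. g q (Y q) (Z q)) + act (Y p) (\<lambda>q. g q (X q) (Z q)) - act (Z p) (\<lambda>q. g q (X q) (Y q))
    + g p (lie_bracket A X Y p) (Z p) - g p (lie_bracket A X Z p) (Y p) - g p (lie_bracket A Y Z p) (X p)"
proof -
  note t = field_near_tangent[OF X] field_near_tangent[OF Y] field_near_tangent[OF Z]
  note D = D_tangent[OF t(1)] D_tangent[OF t(2)] D_tangent[OF t(3)]
  note m = metric_compatible[OF t(1) Y Z] metric_compatible[OF t(2) X Z] metric_compatible[OF t(3) X Y]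
  have "g p (Y p) (D p (X p) Z) = g p (D p (X p) Z) (Y p)" "g p (X p) (D p (Y p) Z) = g p (D p (Y p) Z) (X p)"
    "g p (X p) (D p (Z p) Y) = g p (D p (Z p) Y) (X p)"
    using metric_sym t D X Y Z by auto
  then show ?thesis
    unfolding m by (simp add: lie_bracket_eq metric_diff_left X Y Z t D)
qed

end

locale cone_connection = riemannian_cone A h + riemannian_connection A h D' +
    CD: riemannian_connection "cone_atlas A" "cone_metric h" D
  for A :: "('a::topological_space, 'e::euclidean_space) atlas" and h D' D
begin

lemma act_lift_snd:
  "X p \<in> tangent_space A p \<Longrightarrow> t > 0 \<Longrightarrow> act (lift X (t, p)) (\<lambda>z. f (snd z)) = act (X p) f"
  unfolding act_horizontal[symmetric] by (simp add: lift_def)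

lemma act_lift_fst: "X p \<in> tangent_space A p \<Longrightarrow> t > 0 \<Longrightarrow> act (lift X (t, p)) fst = 0"
  unfolding radial_def[symmetric] by (simp add: lift_def)

lemma act_xi_snd: "z \<in> points C \<Longrightarrow> act (cone_xi A z) (\<lambda>z. f (snd z)) = 0"
  unfolding act_horizontal[symmetric] by simp

lemma act_xi_fst: "z \<in> points C \<Longrightarrow> act (cone_xi A z) fst = 1"
  unfolding radial_def[symmetric] by simp

lemma near_base:
  fixes t :: real
  assumes "\<forall>\<^sub>F q in nhds p. Q q" "t > 0"
  shows "\<forall>\<^sub>F z in nhds (t, p). fst z > 0 \<and> Q (snd z)"
proof -
  have "((\<lambda>z. snd z) \<longlongrightarrow> p) (nhds (t, p))" "((\<lambda>z. fst z) \<longlongrightarrow> t) (nhds (t, p))"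
    by (auto intro!: tendsto_eq_intros filterlim_ident)
  with assms show ?thesis
    by (auto simp: filterlim_iff intro!: eventually_conj order_tendstoD(1)[where y=t])
qed

lemma lift_near:
  fixes t :: real
  assumes X: "field_near A p X" and t: "t > 0"
  shows "\<forall>\<^sub>F z in nhds (t, p). fst z > 0 \<and> X (snd z) \<in> tangent_space A (snd z)"
proof (rule near_base[OF _ t])
  show "\<forall>\<^sub>F q in nhds p. X q \<in> tangent_space A q"
    using field_near_nearby[OF X] by eventually_elim (rule field_near_tangent)
qed

lemma act_locally_const:
  "v \<in> tangent_space C z \<Longrightarrow> \<forall>\<^sub>F z' in nhds z. f z' = c \<Longrightarrow> act v f = 0"
  using C.act_cong[of v z f "\<lambda>_. c"] C.act_const[of v z c] by simp

text \<open>A bracket is a difference of covariant derivatives, hence tangent, and a tangent vector of the cone is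
  determined by its derivatives of \<open>t\<close> and of functions pulled back from the base. So it suffices to evaluate brackets
  on such functions.\<close>

lemma lie_bracket_lift:
  assumes X: "field_near A p X" and Y: "field_near A p Y" and t: "t > 0"
  shows "lie_bracket C (lift X) (lift Y) (t, p) = lift (lie_bracket A X Y) (t, p)"
proof (rule tangent_cone_eqI)
  note lX = field_near_lift[OF X t] and lY = field_near_lift[OF Y t]
  note XY = lie_bracket_tangent[OF X Y]
  show "lie_bracket C (lift X) (lift Y) (t, p) \<in> tangent_space C (t, p)"
    by (rule CD.lie_bracket_tangent[OF lX lY])
  show "lift (lie_bracket A X Y) (t, p) \<in> tangent_space C (t, p)"
    using XY t by (simp add: lift_def)
  have pts: "(t, p) \<in> points C" using field_near_tangent[OF X] tangent_points t by (auto simp: points_cone)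
  have *: "act (lift X (t, p)) (\<lambda>z. act (lift Y z) (\<lambda>z. f (snd z))) = act (X p) (\<lambda>q. act (Y q) f)"
    if X: "field_near A p X" and Y: "field_near A p Y" for X Y f
  proof -
    have "\<forall>\<^sub>F z in nhds (t, p). act (lift Y z) (\<lambda>z. f (snd z)) = act (Y (snd z)) f"
      using lift_near[OF Y t] by eventually_elim (use act_lift_snd in force)
    from C.act_cong[OF C.field_near_tangent[OF field_near_lift[OF X t]] this]
    show ?thesis
      using act_lift_snd[of X p t "\<lambda>q. act (Y q) f"] field_near_tangent[OF X] t by simp
  qed
  show "horizontal (lie_bracket C (lift X) (lift Y) (t, p)) = horizontal (lift (lie_bracket A X Y) (t, p))"
  proof (rule tvec_eqI)
    fix f
    show "act (horizontal (lie_bracket C (lift X) (lift Y) (t, p))) f =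
        act (horizontal (lift (lie_bracket A X Y) (t, p))) f"
      using XY t by (simp add: act_horizontal act_lift_snd)
        (simp add: lie_bracket_def smooth_near_snd *[OF X Y] *[OF Y X])
  qed
  have **: "act (lift X (t, p)) (\<lambda>z. act (lift Y z) fst) = 0"
    if X: "field_near A p X" and Y: "field_near A p Y" for X Y
  proof (rule act_locally_const[OF C.field_near_tangent[OF field_near_lift[OF X t]]])
    show "\<forall>\<^sub>F z in nhds (t, p). act (lift Y z) fst = 0"
      using lift_near[OF Y t] by eventually_elim (use act_lift_fst in force)
  qed
  show "radial (lie_bracket C (lift X) (lift Y) (t, p)) = radial (lift (lie_bracket A X Y) (t, p))"
    using XY t by (simp add: radial_def act_lift_fst)
      (simp add: lie_bracket_def smooth_near_fst[OF pts] **[OF X Y] **[OF Y X])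
qed

lemma points_near: "z \<in> points C \<Longrightarrow> \<forall>\<^sub>F z' in nhds z. z' \<in> points C"
  using C.open_points by (rule eventually_nhds_in_open)

lemma lie_bracket_xi_lift:
  assumes X: "field_near A p X" and t: "t > 0"
  shows "lie_bracket C (cone_xi A) (lift X) (t, p) = 0"
proof (rule tangent_cone_eqI)
  have pts: "(t, p) \<in> points C" using field_near_tangent[OF X] tangent_points t by (auto simp: points_cone)
  note lX = field_near_lift[OF X t] and xi = field_near_xi[OF pts]
  note lXt = C.field_near_tangent[OF lX]
  show "lie_bracket C (cone_xi A) (lift X) (t, p) \<in> tangent_space C (t, p)"
    by (rule CD.lie_bracket_tangent[OF xi lX])
  show "0 \<in> tangent_space C (t, p)" using pts by simp
  show "horizontal (lie_bracket C (cone_xi A) (lift X) (t, p)) = horizontal 0"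
  proof (rule tvec_eqI)
    fix f
    have "\<forall>\<^sub>F z in nhds (t, p). act (lift X z) (\<lambda>z. f (snd z)) = act (X (snd z)) f"
      using lift_near[OF X t] by eventually_elim (use act_lift_snd in force)
    from C.act_cong[OF xi_tangent[OF pts] this]
    have "act (cone_xi A (t, p)) (\<lambda>z. act (lift X z) (\<lambda>z. f (snd z))) = 0"
      using act_xi_snd[OF pts, of "\<lambda>q. act (X q) f"] by simp
    moreover have "\<forall>\<^sub>F z in nhds (t, p). act (cone_xi A z) (\<lambda>z. f (snd z)) = 0"
      using points_near[OF pts] by eventually_elim (rule act_xi_snd)
    then have "act (lift X (t, p)) (\<lambda>z. act (cone_xi A z) (\<lambda>z. f (snd z))) = 0"
      by (rule act_locally_const[OF lXt])
    ultimately show "act (horizontal (lie_bracket C (cone_xi A) (lift X) (t, p))) f = act (horizontal 0) f"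
      by (simp add: act_horizontal lie_bracket_def)
  qed
  have "\<forall>\<^sub>F z in nhds (t, p). act (lift X z) fst = 0"
    using lift_near[OF X t] by eventually_elim (use act_lift_fst in force)
  then have "act (cone_xi A (t, p)) (\<lambda>z. act (lift X z) fst) = 0"
    by (rule act_locally_const[OF xi_tangent[OF pts]])
  moreover have "\<forall>\<^sub>F z in nhds (t, p). act (cone_xi A z) fst = 1"
    using points_near[OF pts] by eventually_elim (rule act_xi_fst)
  then have "act (lift X (t, p)) (\<lambda>z. act (cone_xi A z) fst) = 0"
    by (rule act_locally_const[OF lXt])
  ultimately show "radial (lie_bracket C (cone_xi A) (lift X) (t, p)) = radial 0"
    by (simp add: radial_def lie_bracket_def)
qed

lemma lie_bracket_lift_xi:
  assumes X: "field_near A p X" and t: "t > 0"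
  shows "lie_bracket C (lift X) (cone_xi A) (t, p) = 0"
proof -
  have pts: "(t, p) \<in> points C" using field_near_tangent[OF X] tangent_points t by (auto simp: points_cone)
  show ?thesis
    using lie_bracket_xi_lift[OF X t]
      CD.lie_bracket_eq[OF field_near_lift[OF X t] field_near_xi[OF pts]]
      CD.lie_bracket_eq[OF field_near_xi[OF pts] field_near_lift[OF X t]]
    by simp
qed

text \<open>Lifts and \<open>\<xi>\<close> span every tangent space of the cone.\<close>

lemma cone_eqI:
  assumes v: "v \<in> tangent_space C (t, p)" and w: "w \<in> tangent_space C (t, p)"
    and lift: "\<And>Z. field_near A p Z \<Longrightarrow> g (t, p) v (lift Z (t, p)) = g (t, p) w (lift Z (t, p))"
    and xi: "g (t, p) v (cone_xi A (t, p)) = g (t, p) w (cone_xi A (t, p))"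
  shows "v = w"
proof (rule tangent_cone_eqI[OF v w])
  have pts: "(t, p) \<in> points C" by (rule C.tangent_points[OF v])
  then have t: "t > 0" by (simp add: points_cone)
  note hv = horizontal_tangent[OF v] horizontal_tangent[OF w]
  show "radial v = radial w"
    using xi pts hv by (simp add: cone_metric_def)
  show "horizontal v = horizontal w"
  proof (rule metric_eqI[of _ p])
    fix x assume x: "x \<in> tangent_space A p"
    show "h p (horizontal v) x = h p (horizontal w) x"
      using lift[OF extension(1)[OF x]] x t by (simp add: cone_metric_def lift_def extension(2))
  qed (use hv in auto)
qed

lemma smooth_near_snd': "smooth_near A p f \<Longrightarrow> t > 0 \<Longrightarrow> smooth_near C (t, p) (\<lambda>z. f (snd z))"
  by (simp add: smooth_near_snd)

lemma act_fst_mult_snd: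
  assumes v: "v \<in> tangent_space C (t, p)" and f: "smooth_near A p f"
  shows "act v (\<lambda>z. fst z * f (snd z)) = radial v * f p + t * act (horizontal v) f"
    "act v (\<lambda>z. fst z * (fst z * f (snd z))) = 2 * t * radial v * f p + t\<^sup>2 * act (horizontal v) f"
proof -
  have pts: "(t, p) \<in> points C" by (rule C.tangent_points[OF v])
  then have t: "t > 0" by (simp add: points_cone)
  note s = smooth_near_fst[OF pts] smooth_near_snd'[OF f t]
  show 1: "act v (\<lambda>z. fst z * f (snd z)) = radial v * f p + t * act (horizontal v) f"
    using C.act_mult[OF v s] by (simp add: radial_def act_horizontal)
  show "act v (\<lambda>z. fst z * (fst z * f (snd z))) = 2 * t * radial v * f p + t\<^sup>2 * act (horizontal v) f"
    using C.act_mult[OF v s(1) C.smooth_near_mult[OF s]] 1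
    by (simp add: radial_def power2_eq_square algebra_simps)
qed

lemma metric_lift_lift_near:
  assumes X: "field_near A p X" and Y: "field_near A p Y" and t: "t > 0"
  shows "\<forall>\<^sub>F z in nhds (t, p). g z (lift X z) (lift Y z) = fst z * (fst z * h (snd z) (X (snd z)) (Y (snd z)))"
  using lift_near[OF X t] lift_near[OF Y t]
  by eventually_elim (auto simp: cone_metric_def lift_def power2_eq_square split: prod.splits)

lemma metric_lift_xi_near:
  assumes X: "field_near A p X" and t: "t > 0"
  shows "\<forall>\<^sub>F z in nhds (t, p). g z (lift X z) (cone_xi A z) = 0"
    "\<forall>\<^sub>F z in nhds (t, p). g z (cone_xi A z) (lift X z) = 0"
proof -
  have pts: "(t, p) \<in> points C" using field_near_tangent[OF X] tangent_points t by (auto simp: points_cone)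
  show "\<forall>\<^sub>F z in nhds (t, p). g z (lift X z) (cone_xi A z) = 0"
    using lift_near[OF X t] points_near[OF pts]
    by eventually_elim (auto simp: cone_metric_def lift_def split: prod.splits)
  show "\<forall>\<^sub>F z in nhds (t, p). g z (cone_xi A z) (lift X z) = 0"
    using lift_near[OF X t] points_near[OF pts]
    by eventually_elim (auto simp: cone_metric_def lift_def split: prod.splits)
qed

lemma metric_xi_xi_near:
  "z \<in> points C \<Longrightarrow> \<forall>\<^sub>F z in nhds z. g z (cone_xi A z) (cone_xi A z) = 1"
  by (rule eventually_mono[OF points_near]) (auto simp: cone_metric_def points_cone)

context
 fixes t :: real and p :: 'a assumes t: "t > 0" and p: "p \<in> points A"
begin

lemma pts: "(t, p) \<in> points C"
  using t p by (simp add: points_cone)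

lemma act_metric_lift_lift:
  assumes v: "v \<in> tangent_space C (t, p)" and X: "field_near A p X" and Y: "field_near A p Y"
  shows "act v (\<lambda>z. g z (lift X z) (lift Y z)) =
    2 * t * radial v * h p (X p) (Y p) + t\<^sup>2 * act (horizontal v) (\<lambda>q. h q (X q) (Y q))"
  using C.act_cong[OF v metric_lift_lift_near[OF X Y t]] act_fst_mult_snd(2)[OF v smooth_near_metric[OF X Y]]
  by simp

lemma act_metric_xi:
  assumes v: "v \<in> tangent_space C (t, p)" and X: "field_near A p X"
  shows "act v (\<lambda>z. g z (lift X z) (cone_xi A z)) = 0" "act v (\<lambda>z. g z (cone_xi A z) (lift X z)) = 0"
  by (rule act_locally_const[OF v metric_lift_xi_near(1)[OF X t]]
      act_locally_const[OF v metric_lift_xi_near(2)[OF X t]])+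

lemma act_metric_xi_xi: "v \<in> tangent_space C (t, p) \<Longrightarrow> act v (\<lambda>z. g z (cone_xi A z) (cone_xi A z)) = 0"
  using act_locally_const[OF _ metric_xi_xi_near[OF pts]] by blast

lemma lift_simps:
  assumes "field_near A p X"
  shows "lift X (t, p) \<in> tangent_space C (t, p)" "horizontal (lift X (t, p)) = X p" "radial (lift X (t, p)) = 0"
    "field_near C (t, p) (lift X)"
  using assms t by (simp_all add: lift_def field_near_tangent field_near_lift)

lemma metric_lift:
  assumes "field_near A p X"
  shows "g (t, p) v (lift X (t, p)) = t\<^sup>2 * h p (horizontal v) (X p)"
  using assms by (simp add: cone_metric_def lift_simps)

lemma metric_xi:
  assumes "v \<in> tangent_space C (t, p)"
  shows "g (t, p) v (cone_xi A (t, p)) = radial v"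
  using horizontal_tangent[OF assms] pts by (simp add: cone_metric_def)

text \<open>In the Koszul formula for \<open>g(D\<^sub>X Y, Z)\<close> every term is \<open>t\<^sup>2\<close> times the corresponding term for \<open>h\<close>, and in that for
  \<open>g(D\<^sub>X Y, \<xi>)\<close> only \<open>- \<xi> (g(X,Y)) = - 2 t h(X,Y)\<close> survives.\<close>

lemma D_lift_lift:
  assumes X: "field_near A p X" and Y: "field_near A p Y"
  shows "D (t, p) (lift X (t, p)) (lift Y) = cone_vec A (t, p) (D' p (X p) Y) (- t * h p (X p) (Y p))"
    (is "?L = ?R")
proof -
  note xi = field_near_xi[OF pts] and lX = lift_simps[OF X] and lY = lift_simps[OF Y]
  have L: "?L \<in> tangent_space C (t, p)" by (rule CD.D_tangent[OF lX(1) lY(4)])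
  have DXY: "D' p (X p) Y \<in> tangent_space A p" by (rule D_tangent[OF field_near_tangent[OF X] Y])
  have R: "?R \<in> tangent_space C (t, p)" using DXY t by simp
  show ?thesis
  proof (rule cone_eqI[OF L R])
    fix Z assume Z: "field_near A p Z"
    note lZ = lift_simps[OF Z]
    have "2 * g (t, p) ?L (lift Z (t, p)) = t\<^sup>2 * (2 * h p (D' p (X p) Y) (Z p))"
      unfolding CD.koszul[OF lX(4) lY(4) lZ(4)] koszul[OF X Y Z]
      by (simp add: act_metric_lift_lift lX lY lZ X Y Z lie_bracket_lift t)
        (simp add: metric_lift X Y Z lift_simps field_near_lie_bracket algebra_simps)
    then show "g (t, p) ?L (lift Z (t, p)) = g (t, p) ?R (lift Z (t, p))"
      using DXY t by (simp add: metric_lift Z)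
  next
    have "2 * g (t, p) ?L (cone_xi A (t, p)) = - (2 * t * h p (X p) (Y p))"
      unfolding CD.koszul[OF lX(4) lY(4) xi]
      by (simp add: act_metric_xi act_metric_lift_lift lX lY X Y lie_bracket_lift lie_bracket_lift_xi
          xi_tangent pts t act_const)
        (simp add: metric_xi X Y lift_simps field_near_lie_bracket C.metric_zero_left pts field_near_tangent)
    then show "g (t, p) ?L (cone_xi A (t, p)) = g (t, p) ?R (cone_xi A (t, p))"
      using DXY R t by (simp add: metric_xi)
  qed
qed

lemma D_lift_xi:
  assumes X: "field_near A p X"
  shows "D (t, p) (lift X (t, p)) (cone_xi A) = (1 / t) *\<^sub>R lift X (t, p)" (is "?L = ?R")
proof -
  note xi = field_near_xi[OF pts] and lX = lift_simps[OF X]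
  have L: "?L \<in> tangent_space C (t, p)" by (rule CD.D_tangent[OF lX(1) xi])
  have R: "?R \<in> tangent_space C (t, p)" using lX by simp
  show ?thesis
  proof (rule cone_eqI[OF L R])
    fix Z assume Z: "field_near A p Z"
    note lZ = lift_simps[OF Z]
    have "2 * g (t, p) ?L (lift Z (t, p)) = 2 * t * h p (X p) (Z p)"
      unfolding CD.koszul[OF lX(4) xi lZ(4)]
      by (simp add: act_metric_xi act_metric_lift_lift lX lZ X Z lie_bracket_lift lie_bracket_lift_xi
          lie_bracket_xi_lift xi_tangent pts t)
        (simp add: metric_xi X Z lift_simps field_near_lie_bracket pts)
    then show "g (t, p) ?L (lift Z (t, p)) = g (t, p) ?R (lift Z (t, p))"
      using t by (simp add: metric_lift Z lX metric_scaleR_left X field_near_tangent power2_eq_square)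
  next
    have "2 * g (t, p) ?L (cone_xi A (t, p)) = 0"
      unfolding CD.koszul[OF lX(4) xi xi]
      by (simp add: act_metric_xi act_metric_xi_xi lX X lie_bracket_lift_xi pts t CD.lie_bracket_eq[OF xi xi])
    then show "g (t, p) ?L (cone_xi A (t, p)) = g (t, p) ?R (cone_xi A (t, p))"
      using R by (simp add: metric_xi lX)
  qed
qed

lemma D_xi_lift:
  assumes X: "field_near A p X"
  shows "D (t, p) (cone_xi A (t, p)) (lift X) = (1 / t) *\<^sub>R lift X (t, p)"
  using CD.lie_bracket_eq[OF field_near_xi[OF pts] lift_simps(4)[OF X]] lie_bracket_xi_lift[OF X t] D_lift_xi[OF X]
  by simp

lemma D_xi_xi: "D (t, p) (cone_xi A (t, p)) (cone_xi A) = 0"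
proof (rule cone_eqI)
  note xi = field_near_xi[OF pts]
  show L: "D (t, p) (cone_xi A (t, p)) (cone_xi A) \<in> tangent_space C (t, p)"
    by (rule CD.D_tangent[OF xi_tangent[OF pts] xi])
  show "0 \<in> tangent_space C (t, p)" using pts by simp
  have brk: "lie_bracket C (cone_xi A) (cone_xi A) (t, p) = 0" by (simp add: CD.lie_bracket_eq[OF xi xi])
  fix Z assume Z: "field_near A p Z"
  note lZ = lift_simps[OF Z]
  have "2 * g (t, p) (D (t, p) (cone_xi A (t, p)) (cone_xi A)) (lift Z (t, p)) = 0"
    unfolding CD.koszul[OF xi xi lZ(4)]
    by (simp add: act_metric_xi act_metric_xi_xi lZ Z lie_bracket_xi_lift pts t brk)
  then show "g (t, p) (D (t, p) (cone_xi A (t, p)) (cone_xi A)) (lift Z (t, p)) = g (t, p) 0 (lift Z (t, p))"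
    by (simp add: lZ)
next
  note xi = field_near_xi[OF pts]
  have brk: "lie_bracket C (cone_xi A) (cone_xi A) (t, p) = 0" by (simp add: CD.lie_bracket_eq[OF xi xi])
  have "2 * g (t, p) (D (t, p) (cone_xi A (t, p)) (cone_xi A)) (cone_xi A (t, p)) = 0"
    unfolding CD.koszul[OF xi xi xi] by (simp add: act_metric_xi_xi pts brk)
  then show "g (t, p) (D (t, p) (cone_xi A (t, p)) (cone_xi A)) (cone_xi A (t, p)) = g (t, p) 0 (cone_xi A (t, p))"
    using pts by simp
qed

end

end

context cone_connection
begin

lemma D_lift_lift_near:
  assumes X: "field_near A p X" and Y: "field_near A p Y" and t: "t > 0"
  shows "\<forall>\<^sub>F z in nhds (t, p). D z (lift X z) (lift Y) =
    lift (\<lambda>q. D' q (X q) Y) z - (fst z * h (snd z) (X (snd z)) (Y (snd z))) *\<^sub>R cone_xi A z"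
proof -
  have "\<forall>\<^sub>F q in nhds p. field_near A q X \<and> field_near A q Y"
    using field_near_nearby[OF X] field_near_nearby[OF Y] by (rule eventually_conj)
  from near_base[OF this t] show ?thesis
  proof (rule eventually_mono)
    fix z :: "real \<times> 'a"
    assume "0 < fst z \<and> field_near A (snd z) X \<and> field_near A (snd z) Y"
    moreover obtain s q where z: "z = (s, q)" by fastforce
    ultimately have s: "s > 0" and X: "field_near A q X" and Y: "field_near A q Y" by auto
    have q: "q \<in> points A" using tangent_points[OF field_near_tangent[OF X]] .
    have "D' q (X q) Y \<in> tangent_space A q" using X Y by (simp add: field_near_tangent)
    then have "cone_vec A (s, q) (D' q (X q) Y) (- s * h q (X q) (Y q)) =
        lift (\<lambda>q. D' q (X q) Y) (s, q) - (s * h q (X q) (Y q)) *\<^sub>R cone_xi A (s, q)"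
      using s q by (intro tangent_cone_eqI[of _ "(s, q)"]) (simp_all add: lift_def points_cone)
    then show "D z (lift X z) (lift Y) =
        lift (\<lambda>q. D' q (X q) Y) z - (fst z * h (snd z) (X (snd z)) (Y (snd z))) *\<^sub>R cone_xi A z"
      using D_lift_lift[OF s q X Y] by (simp add: z)
  qed
qed

text \<open>If \<open>L = t W\<close>, then \<open>D\<^sub>v L = dt(v) W + t D\<^sub>v W\<close>. Solving for \<open>D\<^sub>v W\<close> gives the second derivatives
  involving \<open>\<xi>\<close>, where \<open>W = D\<^sub>X \<xi> = X / t\<close>.\<close>

lemma D_fst_scaleR:
  assumes v: "v \<in> tangent_space C z" and W: "field_near C z W" and L: "field_near C z L"
    and eq: "\<forall>\<^sub>F z in nhds z. W z = (1 / fst z) *\<^sub>R L z"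
  shows "fst z *\<^sub>R D z v W = D z v L - (radial v / fst z) *\<^sub>R L z"
proof -
  have pts: "z \<in> points C" by (rule C.tangent_points[OF v])
  have f: "smooth_near C z fst" by (rule smooth_near_fst[OF pts])
  have "\<forall>\<^sub>F z in nhds z. L z = fst z *\<^sub>R W z"
    using eq points_near[OF pts] by eventually_elim (auto simp: points_cone)
  then have "D z v L = D z v (\<lambda>z. fst z *\<^sub>R W z)"
    by (intro CD.D_local[OF v L] C.field_near_scaleR f W)
  also have "\<dots> = radial v *\<^sub>R W z + fst z *\<^sub>R D z v W"
    using CD.D_scaleR[OF v W f] by (simp add: radial_def)
  finally show ?thesis using eventually_nhds_x_imp_x[OF eq] by simp
qed

context
  fixes t :: real and p :: 'a
  assumes t: "t > 0" and p: "p \<in> points A"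
begin

lemmas pt = pts[OF t p]

lemmas xi = field_near_xi[OF pt]

lemmas lifts = lift_simps[OF t p]

lemma D_D_lift_lift:
  assumes v: "v \<in> tangent_space C (t, p)" and X: "field_near A p X" and Y: "field_near A p Y"
  shows "D (t, p) v (\<lambda>z. D z (lift X z) (lift Y)) =
    D (t, p) v (lift (\<lambda>q. D' q (X q) Y)) -
    ((radial v * h p (X p) (Y p) + t * act (horizontal v) (\<lambda>q. h q (X q) (Y q))) *\<^sub>R cone_xi A (t, p)
      + (t * h p (X p) (Y p)) *\<^sub>R D (t, p) v (cone_xi A))"
proof -
  have DXY: "field_near A p (\<lambda>q. D' q (X q) Y)" by (rule field_near_D[OF X Y])
  have f: "smooth_near C (t, p) (\<lambda>z. fst z * h (snd z) (X (snd z)) (Y (snd z)))"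
    using C.smooth_near_mult[OF smooth_near_fst[OF pt] smooth_near_snd'[OF smooth_near_metric[OF X Y] t]] .
  have fxi: "field_near C (t, p) (\<lambda>z. (fst z * h (snd z) (X (snd z)) (Y (snd z))) *\<^sub>R cone_xi A z)"
    by (rule C.field_near_scaleR[OF f xi])
  have "D (t, p) v (\<lambda>z. D z (lift X z) (lift Y)) = D (t, p) v
      (\<lambda>z. lift (\<lambda>q. D' q (X q) Y) z - (fst z * h (snd z) (X (snd z)) (Y (snd z))) *\<^sub>R cone_xi A z)"
    by (intro CD.D_local[OF v] CD.field_near_D C.field_near_diff fxi lifts X Y DXY D_lift_lift_near t)
  also have "\<dots> = D (t, p) v (lift (\<lambda>q. D' q (X q) Y)) -
      D (t, p) v (\<lambda>z. (fst z * h (snd z) (X (snd z)) (Y (snd z))) *\<^sub>R cone_xi A z)"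
    by (intro CD.D_diff[OF v] fxi lifts DXY)
  also have "D (t, p) v (\<lambda>z. (fst z * h (snd z) (X (snd z)) (Y (snd z))) *\<^sub>R cone_xi A z) =
      (radial v * h p (X p) (Y p) + t * act (horizontal v) (\<lambda>q. h q (X q) (Y q))) *\<^sub>R cone_xi A (t, p)
      + (t * h p (X p) (Y p)) *\<^sub>R D (t, p) v (cone_xi A)"
    using CD.D_scaleR[OF v xi f] act_fst_mult_snd(1)[OF v smooth_near_metric[OF X Y]] by simp
  finally show ?thesis .
qed

text \<open>The terms \<open>h(Y,Z) X - h(X,Z) Y\<close> come from differentiating \<open>- t h(Y,Z) \<xi>\<close>, because \<open>t D\<^sub>X \<xi> = X\<close>. The radial terms
  cancel since \<open>D'\<close> is metric and torsion-free.\<close>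

lemma R_lift_lift_lift:
  assumes X: "field_near A p X" and Y: "field_near A p Y" and Z: "field_near A p Z"
  shows "CD.R (lift X) (lift Y) (lift Z) (t, p) =
    cone_vec A (t, p) (R X Y Z p - (h p (Y p) (Z p) *\<^sub>R X p - h p (X p) (Z p) *\<^sub>R Y p)) 0"
proof (rule tangent_cone_eqI)
  note f = X Y Z field_near_D[OF Y Z] field_near_D[OF X Z] field_near_lie_bracket[OF X Y]
  note tg = f[THEN field_near_tangent]
  have Rt: "R X Y Z p \<in> tangent_space A p" by (rule R_tangent[OF X Y Z])
  show "CD.R (lift X) (lift Y) (lift Z) (t, p) \<in> tangent_space C (t, p)"
    by (rule CD.R_tangent) (intro lifts f)+
  show "cone_vec A (t, p) (R X Y Z p - (h p (Y p) (Z p) *\<^sub>R X p - h p (X p) (Z p) *\<^sub>R Y p)) 0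
      \<in> tangent_space C (t, p)"
    using Rt tg t by simp
  note eqs = curvature_fields_def D_D_lift_lift lie_bracket_lift[OF X Y t] D_lift_lift[OF t p]
    D_lift_xi[OF t p] lifts f
  show "horizontal (CD.R (lift X) (lift Y) (lift Z) (t, p)) = horizontal
      (cone_vec A (t, p) (R X Y Z p - (h p (Y p) (Z p) *\<^sub>R X p - h p (X p) (Z p) *\<^sub>R Y p)) 0)"
    using Rt tg t by (simp add: eqs pt algebra_simps)
  have sym: "h p (X p) (D' p (Y p) Z) = h p (D' p (Y p) Z) (X p)" "h p (Y p) (D' p (X p) Z) = h p (D' p (X p) Z) (Y p)"
    using metric_sym tg by auto
  show "radial (CD.R (lift X) (lift Y) (lift Z) (t, p)) = radial
      (cone_vec A (t, p) (R X Y Z p - (h p (Y p) (Z p) *\<^sub>R X p - h p (X p) (Z p) *\<^sub>R Y p)) 0)"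
    using Rt tg t
    by (simp add: eqs pt metric_compatible[OF tg(1) Y Z] metric_compatible[OF tg(2) X Z])
      (simp add: lie_bracket_eq X Y metric_diff_left D_tangent tg sym algebra_simps)
qed

lemma D_lift_xi_near: "field_near A p X \<Longrightarrow>
    \<forall>\<^sub>F z in nhds (t, p). D z (lift X z) (cone_xi A) = (1 / fst z) *\<^sub>R lift X z"
  using near_base[OF field_near_nearby t, of p X]
  by (auto elim!: eventually_mono intro!: D_lift_xi intro: field_near_points)

lemma D_xi_lift_near: "field_near A p X \<Longrightarrow>
    \<forall>\<^sub>F z in nhds (t, p). D z (cone_xi A z) (lift X) = (1 / fst z) *\<^sub>R lift X z"
  using near_base[OF field_near_nearby t, of p X]
  by (auto elim!: eventually_mono intro!: D_xi_lift intro: field_near_points)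

text \<open>In this lemma and the next two, second derivatives of the form \<open>D\<^sub>v (X / t)\<close> are multiplied by \<open>t\<close>, which reduces them
  to derivatives of lifts.\<close>

lemma R_lift_lift_xi:
  assumes X: "field_near A p X" and Y: "field_near A p Y"
  shows "CD.R (lift X) (lift Y) (cone_xi A) (t, p) = 0"
proof -
  have *: "t *\<^sub>R D (t, p) (lift X (t, p)) (\<lambda>z. D z (lift Y z) (cone_xi A)) = D (t, p) (lift X (t, p)) (lift Y)"
    if X: "field_near A p X" and Y: "field_near A p Y" for X Y
    using D_fst_scaleR[OF lifts(1)[OF X] CD.field_near_D[OF lifts(4)[OF Y] xi] lifts(4)[OF Y]
        D_lift_xi_near[OF Y]] by (simp add: lifts X)
  have "t *\<^sub>R CD.R (lift X) (lift Y) (cone_xi A) (t, p) =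
      lie_bracket C (lift X) (lift Y) (t, p) - t *\<^sub>R D (t, p) (lie_bracket C (lift X) (lift Y) (t, p)) (cone_xi A)"
    by (simp add: curvature_fields_def scaleR_diff_right * X Y CD.lie_bracket_eq lifts)
  also have "\<dots> = 0"
    using t by (simp add: lie_bracket_lift X Y D_lift_xi[OF t p] field_near_lie_bracket)
  finally show ?thesis using t by simp
qed

lemma R_xi_lift_lift:
  assumes Y: "field_near A p Y" and Z: "field_near A p Z"
  shows "CD.R (cone_xi A) (lift Y) (lift Z) (t, p) = 0"
proof -
  have W: "field_near A p (\<lambda>q. D' q (Y q) Z)" by (rule field_near_D[OF Y Z])
  have brk: "D (t, p) (lie_bracket C (cone_xi A) (lift Y) (t, p)) (lift Z) = 0"
    using CD.D_scaleR_vec[OF xi_tangent[OF pt] lifts(4)[OF Z], of 0] by (simp add: lie_bracket_xi_lift Y t)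
  have 1: "t *\<^sub>R D (t, p) (lift Y (t, p)) (\<lambda>z. D z (cone_xi A z) (lift Z)) = D (t, p) (lift Y (t, p)) (lift Z)"
    using D_fst_scaleR[OF lifts(1)[OF Y] CD.field_near_D[OF xi lifts(4)[OF Z]] lifts(4)[OF Z]
        D_xi_lift_near[OF Z]] by (simp add: lifts Y)
  have 2: "D (t, p) (lift Y (t, p)) (lift Z) =
      lift (\<lambda>q. D' q (Y q) Z) (t, p) - (t * h p (Y p) (Z p)) *\<^sub>R cone_xi A (t, p)"
    using eventually_nhds_x_imp_x[OF D_lift_lift_near[OF Y Z t]] by simp
  have "t *\<^sub>R CD.R (cone_xi A) (lift Y) (lift Z) (t, p) =
      t *\<^sub>R D (t, p) (cone_xi A (t, p)) (\<lambda>z. D z (lift Y z) (lift Z)) - D (t, p) (lift Y (t, p)) (lift Z)"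
    by (simp add: curvature_fields_def scaleR_diff_right 1 brk)
  also have "\<dots> = 0"
    using t by (simp add: D_D_lift_lift[OF xi_tangent[OF pt] Y Z] 2 D_xi_lift[OF t p W] D_xi_xi[OF t p] pt
        act_const scaleR_diff_right)
  finally show ?thesis using t by simp
qed

lemma R_xi_lift_xi:
  assumes Y: "field_near A p Y"
  shows "CD.R (cone_xi A) (lift Y) (cone_xi A) (t, p) = 0"
proof -
  have brk: "D (t, p) (lie_bracket C (cone_xi A) (lift Y) (t, p)) (cone_xi A) = 0"
    using CD.D_scaleR_vec[OF xi_tangent[OF pt] xi, of 0] by (simp add: lie_bracket_xi_lift Y t)
  have "t *\<^sub>R D (t, p) (cone_xi A (t, p)) (\<lambda>z. D z (lift Y z) (cone_xi A)) = 0"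
    using D_fst_scaleR[OF xi_tangent[OF pt] CD.field_near_D[OF lifts(4)[OF Y] xi] lifts(4)[OF Y]
        D_lift_xi_near[OF Y]] pt by (simp add: D_xi_lift[OF t p Y])
  moreover have "D (t, p) (lift Y (t, p)) (\<lambda>z. D z (cone_xi A z) (cone_xi A)) = 0"
  proof -
    have "\<forall>\<^sub>F z in nhds (t, p). D z (cone_xi A z) (cone_xi A) = 0 *\<^sub>R cone_xi A z"
      using points_near[OF pt] by eventually_elim (auto simp: points_cone D_xi_xi)
    then have "D (t, p) (lift Y (t, p)) (\<lambda>z. D z (cone_xi A z) (cone_xi A)) =
        D (t, p) (lift Y (t, p)) (\<lambda>z. 0 *\<^sub>R cone_xi A z)"
      by (intro CD.D_local[OF lifts(1)[OF Y]] CD.field_near_D xi C.field_near_scaleR C.smooth_near_const pt)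
    then show ?thesis using CD.D_scaleR_const[OF lifts(1)[OF Y] xi, of 0] by simp
  qed
  ultimately show ?thesis using t by (simp add: curvature_fields_def brk)
qed

text \<open>Every vector \<open>(x, a)\<close> is the value of a lift plus \<open>a \<xi>\<close>. Of the eight terms obtained by trilinearity only the one
  without \<open>\<xi>\<close> survives.\<close>

lemma curvature_cone_vec:
  assumes x: "x \<in> tangent_space A p" and y: "y \<in> tangent_space A p" and z: "z \<in> tangent_space A p"
  shows "curvature C D (t, p) (cone_vec A (t, p) x a) (cone_vec A (t, p) y b) (cone_vec A (t, p) z c) =
    cone_vec A (t, p) (curvature A D' p x y z - (h p y z *\<^sub>R x - h p x z *\<^sub>R y)) 0"
proof -
  let ?K = "curvature C D (t, p)"
  define X Y Z where "X = extension A p x" and "Y = extension A p y" and "Z = extension A p z"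
  have X: "field_near A p X" "X p = x" and Y: "field_near A p Y" "Y p = y" and Z: "field_near A p Z" "Z p = z"
    unfolding X_def Y_def Z_def using x y z by (simp_all add: extension)
  define \<xi> lx ly lz where "\<xi> = cone_xi A (t, p)" and "lx = lift X (t, p)" and "ly = lift Y (t, p)"
    and "lz = lift Z (t, p)"
  note l = lift_simps[OF t p X(1)] lift_simps[OF t p Y(1)] lift_simps[OF t p Z(1)]
  have T: "\<xi> \<in> tangent_space C (t, p)" "lx \<in> tangent_space C (t, p)" "ly \<in> tangent_space C (t, p)"
    "lz \<in> tangent_space C (t, p)"
    unfolding \<xi>_def lx_def ly_def lz_def using l xi_tangent[OF pt] by simp_all
  have split: "cone_vec A (t, p) w a = lift W (t, p) + a *\<^sub>R \<xi>"
    if "w \<in> tangent_space A p" "W p = w" for w W a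
    unfolding \<xi>_def using that pt t by (intro tangent_cone_eqI[of _ "(t, p)"]) (auto simp: lift_def)
  have K: "?K lx ly lz = cone_vec A (t, p) (curvature A D' p x y z - (h p y z *\<^sub>R x - h p x z *\<^sub>R y)) 0"
    unfolding lx_def ly_def lz_def
    using CD.curvature_eq[OF l(4,8,12)] R_lift_lift_lift[OF X(1) Y(1) Z(1)]
      curvature_eq[OF X(1) Y(1) Z(1)] X Y Z by simp
  have K0: "?K lx ly \<xi> = 0" "?K \<xi> ly lz = 0" "?K \<xi> ly \<xi> = 0" "?K \<xi> lx lz = 0" "?K \<xi> lx \<xi> = 0"
    unfolding lx_def ly_def lz_def \<xi>_def
    using CD.curvature_eq[OF l(4,8) xi] R_lift_lift_xi[OF X(1) Y(1)]
      CD.curvature_eq[OF xi l(8,12)] R_xi_lift_lift[OF Y(1) Z(1)]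
      CD.curvature_eq[OF xi l(8) xi] R_xi_lift_xi[OF Y(1)]
      CD.curvature_eq[OF xi l(4,12)] R_xi_lift_lift[OF X(1) Z(1)]
      CD.curvature_eq[OF xi l(4) xi] R_xi_lift_xi[OF X(1)] by simp_all
  have K1: "?K lx \<xi> lz = 0" "?K lx \<xi> \<xi> = 0"
    using CD.curvature_antisym[OF T(2,1,4)] CD.curvature_antisym[OF T(2,1,1)] K0 by simp_all
  have K2: "?K \<xi> \<xi> w = 0" if "w \<in> tangent_space C (t, p)" for w
  proof (rule tvec_eqI)
    fix f
    have "act (?K \<xi> \<xi> w) f = act (- ?K \<xi> \<xi> w) f" by (rule arg_cong[OF CD.curvature_antisym[OF T(1,1) that]])
    then show "act (?K \<xi> \<xi> w) f = act 0 f" by simp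
  qed
  show ?thesis
    unfolding split[of x X, OF x X(2)] split[of y Y, OF y Y(2)] split[of z Z, OF z Z(2)]
      lx_def[symmetric] ly_def[symmetric] lz_def[symmetric]
    by (simp add: CD.curvature_add_1 CD.curvature_add_2 CD.curvature_add_3 CD.curvature_scaleR_1
        CD.curvature_scaleR_2 CD.curvature_scaleR_3 T K K0 K1 K2)
qed

end

lemma curvature4_cone_vec:
  assumes t: "t > 0" and "x \<in> tangent_space A p" "y \<in> tangent_space A p" "z \<in> tangent_space A p" "w \<in> tangent_space A p"
  shows "curvature4 C g D (t, p) (cone_vec A (t, p) x a) (cone_vec A (t, p) y b) (cone_vec A (t, p) z c)
      (cone_vec A (t, p) w d) =
    t\<^sup>2 * (curvature4 A h D' p x y z w - (h p y z * h p x w - h p x z * h p y w))"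
  using assms tangent_points[OF assms(2)]
  by (simp add: curvature4_def curvature_cone_vec cone_metric_cone_vec curvature_tangent metric_diff_left
      metric_scaleR_left)

end

section \<open>Traces in orthonormal frames\<close>

definition bilinear_on :: "'v::real_vector set \<Rightarrow> ('v \<Rightarrow> 'v \<Rightarrow> real) \<Rightarrow> bool" where
  "bilinear_on S T \<longleftrightarrow> (\<forall>x\<in>S. \<forall>y\<in>S. \<forall>z\<in>S. T (x + y) z = T x z + T y z \<and> T z (x + y) = T z x + T z y) \<and>
    (\<forall>x\<in>S. \<forall>y\<in>S. \<forall>c. T (c *\<^sub>R x) y = c * T x y \<and> T x (c *\<^sub>R y) = c * T x y)"

lemma bilinear_on_cong:
  assumes "subspace S" "bilinear_on S T" "\<And>x y. x \<in> S \<Longrightarrow> y \<in> S \<Longrightarrow> T' x y = T x y"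
  shows "bilinear_on S T'"
  using assms unfolding bilinear_on_def by (simp add: subspace_add subspace_scale)

lemma bilinear_on_sum:
  "(\<And>i. i \<in> I \<Longrightarrow> bilinear_on S (T i)) \<Longrightarrow> bilinear_on S (\<lambda>x y. \<Sum>i\<in>I. T i x y)"
  unfolding bilinear_on_def by (simp add: sum.distrib sum_distrib_left)

lemma bilinear_on_sum_left:
  assumes S: "subspace S" and T: "bilinear_on S T" and "\<And>i. i \<in> I \<Longrightarrow> x i \<in> S" "y \<in> S"
  shows "T (\<Sum>i\<in>I. c i *\<^sub>R x i) y = (\<Sum>i\<in>I. c i * T (x i) y)"
proof -
  have zero: "T 0 y = 0"
    using T assms(4) subspace_0[OF S] unfolding bilinear_on_def by (metis mult_zero_left scaleR_zero_left)
  show ?thesis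
    using assms(3)
  proof (induction I rule: infinite_finite_induct)
    case (insert i I)
    then have "(\<Sum>i\<in>I. c i *\<^sub>R x i) \<in> S" "c i *\<^sub>R x i \<in> S" "x i \<in> S"
      by (auto intro!: subspace_sum subspace_scale S)
    with insert T assms(4) show ?case unfolding bilinear_on_def by simp
  qed (auto simp: zero)
qed

lemma bilinear_on_swap: "bilinear_on S T \<Longrightarrow> bilinear_on S (\<lambda>x y. T y x)"
  unfolding bilinear_on_def by simp

lemma bilinear_on_sum_right:
  assumes "subspace S" "bilinear_on S T" "\<And>i. i \<in> I \<Longrightarrow> x i \<in> S" "y \<in> S"
  shows "T y (\<Sum>i\<in>I. c i *\<^sub>R x i) = (\<Sum>i\<in>I. c i * T y (x i))"
  using bilinear_on_sum_left[OF assms(1) bilinear_on_swap[OF assms(2)] assms(3,4)] .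

locale orthonormal_frame =
  fixes S :: "'v::real_vector set" and g :: "'v \<Rightarrow> 'v \<Rightarrow> real" and E :: "'v set"
  assumes subspace: "subspace S" and bilinear: "bilinear_on S g"
    and sym: "x \<in> S \<Longrightarrow> y \<in> S \<Longrightarrow> g x y = g y x"
    and finite_frame: "finite E" and frame_subset: "E \<subseteq> S"
    and orthonormal: "e \<in> E \<Longrightarrow> f \<in> E \<Longrightarrow> g e f = (if e = f then 1 else 0)"
    and expand: "x \<in> S \<Longrightarrow> x = (\<Sum>e\<in>E. g x e *\<^sub>R e)"
begin

abbreviation B :: "'v set" where "B \<equiv> some_basis S"
abbreviation coeff :: "'v \<Rightarrow> 'v \<Rightarrow> real" where "coeff \<equiv> representation B"

lemma basis: "independent B" "span B = S" "finite B"
proof -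
  have "\<exists>B. independent B \<and> span B = S"
    using basis_exists[of S] subspace by (metis span_subspace)
  then have "independent B \<and> span B = S"
    unfolding some_basis_def by (rule someI_ex)
  then show *: "independent B" "span B = S" by auto
  have "S \<subseteq> span E"
    using expand by (metis (no_types, lifting) span_base span_scale span_sum subsetI)
  then show "finite B"
    using independent_span_bound[OF finite_frame *(1)] *(2) span_superset by blast
qed

lemma basis_in: "b \<in> B \<Longrightarrow> b \<in> S"
  using basis(2) span_base by blast

lemma frame_in: "e \<in> E \<Longrightarrow> e \<in> S"
  using frame_subset by blast

lemma coeff_expand: "x \<in> S \<Longrightarrow> (\<Sum>b\<in>B. coeff x b *\<^sub>R b) = x"
  using basis by (intro sum_representation_eq) auto

lemma coeff_sum:
  "(\<And>i. i \<in> I \<Longrightarrow> x i \<in> S) \<Longrightarrow> coeff (\<Sum>i\<in>I. c i *\<^sub>R x i) b = (\<Sum>i\<in>I. c i * coeff (x i) b)"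
  using representation_sum[OF basis(1), of I "\<lambda>i. c i *\<^sub>R x i"] representation_scale[OF basis(1)]
  by (simp add: basis(2) subspace_scale subspace)

lemma endo_trace_eq:
  assumes L: "\<And>x. x \<in> S \<Longrightarrow> L x \<in> S"
    and sum: "\<And>c. L (\<Sum>e\<in>E. c e *\<^sub>R e) = (\<Sum>e\<in>E. c e *\<^sub>R L e)"
  shows "endo_trace S L = (\<Sum>e\<in>E. g (L e) e)"
proof -
  have "coeff (L b) b = (\<Sum>e\<in>E. g b e * coeff (L e) b)" if "b \<in> B" for b
    by (subst expand[OF basis_in[OF that]]) (simp add: sum coeff_sum L frame_in)
  then have "endo_trace S L = (\<Sum>b\<in>B. \<Sum>e\<in>E. g b e * coeff (L e) b)"
    by (simp add: endo_trace_def)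
  also have "\<dots> = (\<Sum>e\<in>E. \<Sum>b\<in>B. coeff (L e) b * g b e)"
    by (subst sum.swap) (simp add: mult.commute)
  also have "\<dots> = (\<Sum>e\<in>E. g (\<Sum>b\<in>B. coeff (L e) b *\<^sub>R b) e)"
    by (simp add: bilinear_on_sum_left[OF subspace bilinear] basis_in frame_in)
  also have "\<dots> = (\<Sum>e\<in>E. g (L e) e)"
    by (simp add: coeff_expand L frame_in)
  finally show ?thesis .
qed

text \<open>The Gram matrix of \<open>B\<close> is invertible: the coefficient functional of \<open>b\<close> is represented by the vector
  \<open>\<Sum>\<^sub>e coeff e b \<cdot> e\<close>, whose own coefficients form row \<open>b\<close> of the inverse.\<close>

lemma inverse_gram:
  assumes b: "b \<in> B" and x: "x \<in> S"
  shows "(\<Sum>d\<in>B. inverse_gram g B b d * g d x) = coeff x b"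
proof -
  let ?r = "\<lambda>b. \<Sum>e\<in>E. coeff e b *\<^sub>R e"
  have r: "?r b \<in> S" for b
    by (intro subspace_sum subspace_scale subspace frame_in)
  have "(\<Sum>d\<in>B. coeff (?r b) d * g d c) = (if b = c then 1 else 0)" if "b \<in> B" "c \<in> B" for b c
  proof -
    have "(\<Sum>d\<in>B. coeff (?r b) d * g d c) = g (\<Sum>d\<in>B. coeff (?r b) d *\<^sub>R d) c"
      by (simp add: bilinear_on_sum_left[OF subspace bilinear] basis_in that)
    also have "\<dots> = g (?r b) c"
      by (simp add: coeff_expand r)
    also have "\<dots> = (\<Sum>e\<in>E. g c e * coeff e b)"
      by (simp add: bilinear_on_sum_left[OF subspace bilinear] basis_in frame_in that sym mult.commute)
    also have "\<dots> = coeff (\<Sum>e\<in>E. g c e *\<^sub>R e) b"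
      by (simp add: coeff_sum frame_in)
    also have "\<dots> = (if b = c then 1 else 0)"
      unfolding expand[OF basis_in[OF that(2)], symmetric] using representation_basis[OF basis(1) that(2)] by auto
    finally show ?thesis .
  qed
  then have "\<exists>H. \<forall>b\<in>B. \<forall>c\<in>B. (\<Sum>d\<in>B. H b d * g d c) = (if b = c then 1 else 0)"
    by (intro exI[of _ "\<lambda>b. coeff (?r b)"]) simp
  then have H: "\<forall>b\<in>B. \<forall>c\<in>B. (\<Sum>d\<in>B. inverse_gram g B b d * g d c) = (if b = c then 1 else 0)"
    unfolding inverse_gram_def by (rule someI_ex)
  have "(\<Sum>d\<in>B. inverse_gram g B b d * g d x) =
      (\<Sum>d\<in>B. inverse_gram g B b d * g d (\<Sum>c\<in>B. coeff x c *\<^sub>R c))"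
    by (simp add: coeff_expand x)
  also have "\<dots> = (\<Sum>d\<in>B. \<Sum>c\<in>B. coeff x c * (inverse_gram g B b d * g d c))"
    by (simp add: bilinear_on_sum_right[OF subspace bilinear] basis_in sum_distrib_left mult_ac)
  also have "\<dots> = (\<Sum>c\<in>B. coeff x c * (\<Sum>d\<in>B. inverse_gram g B b d * g d c))"
    by (subst sum.swap) (simp add: sum_distrib_left)
  also have "\<dots> = (\<Sum>c\<in>B. if b = c then coeff x c else 0)"
    by (rule sum.cong) (use b H in auto)
  also have "\<dots> = coeff x b"
    using b basis(3) by simp
  finally show ?thesis .
qed

text \<open>Both basis vectors in \<open>T b c\<close> are expanded in the frame. Summing over \<open>c\<close> and then over \<open>b\<close> turns the inverse Gram
  matrix into coefficients and these into \<open>g f e\<close>.\<close>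

lemma metric_trace_eq:
  assumes T: "bilinear_on S T"
  shows "metric_trace g S T = (\<Sum>e\<in>E. T e e)"
proof -
  let ?H = "inverse_gram g B"
  have "T b c = (\<Sum>e\<in>E. \<Sum>f\<in>E. g b e * g c f * T e f)" if "b \<in> B" "c \<in> B" for b c
  proof -
    have "T b c = T (\<Sum>e\<in>E. g b e *\<^sub>R e) (\<Sum>f\<in>E. g c f *\<^sub>R f)"
      by (rule arg_cong2[OF expand[OF basis_in[OF that(1)]] expand[OF basis_in[OF that(2)]]])
    also have "\<dots> = (\<Sum>e\<in>E. g b e * T e (\<Sum>f\<in>E. g c f *\<^sub>R f))"
      by (intro bilinear_on_sum_left[OF subspace T] frame_in subspace_sum subspace_scale subspace)
    also have "\<dots> = (\<Sum>e\<in>E. \<Sum>f\<in>E. g b e * g c f * T e f)"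
      by (simp add: bilinear_on_sum_right[OF subspace T] frame_in sum_distrib_left mult.assoc)
    finally show ?thesis .
  qed
  then have "metric_trace g S T = (\<Sum>b\<in>B. \<Sum>c\<in>B. ?H b c * (\<Sum>e\<in>E. \<Sum>f\<in>E. g b e * g c f * T e f))"
    by (simp add: metric_trace_def)
  also have "\<dots> = (\<Sum>b\<in>B. \<Sum>c\<in>B. \<Sum>e\<in>E. \<Sum>f\<in>E. T e f * (g b e * (?H b c * g c f)))"
    by (simp add: sum_distrib_left mult_ac)
  also have "\<dots> = (\<Sum>b\<in>B. \<Sum>e\<in>E. \<Sum>f\<in>E. \<Sum>c\<in>B. T e f * (g b e * (?H b c * g c f)))"
    by (subst sum.swap, subst (2) sum.swap) simp
  also have "\<dots> = (\<Sum>b\<in>B. \<Sum>e\<in>E. \<Sum>f\<in>E. T e f * (g b e * coeff f b))"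
    by (simp add: inverse_gram frame_in flip: sum_distrib_left)
  also have "\<dots> = (\<Sum>e\<in>E. \<Sum>f\<in>E. \<Sum>b\<in>B. T e f * (g b e * coeff f b))"
    by (subst sum.swap, subst (2) sum.swap) simp
  also have "\<dots> = (\<Sum>e\<in>E. \<Sum>f\<in>E. T e f * g (\<Sum>b\<in>B. coeff f b *\<^sub>R b) e)"
    by (simp add: bilinear_on_sum_left[OF subspace bilinear] basis_in frame_in sum_distrib_left mult_ac)
  also have "\<dots> = (\<Sum>e\<in>E. \<Sum>f\<in>E. T e f * (if f = e then 1 else 0))"
    by (simp add: coeff_expand frame_in orthonormal)
  also have "\<dots> = (\<Sum>e\<in>E. T e e)"
    using finite_frame by (simp add: if_distrib cong: if_cong)
  finally show ?thesis .
qed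

lemma metric_trace_metric_trace_eq:
  assumes inner: "\<And>y z. y \<in> S \<Longrightarrow> z \<in> S \<Longrightarrow> bilinear_on S (\<lambda>u v. Q u y z v)"
    and outer: "\<And>u. u \<in> E \<Longrightarrow> bilinear_on S (\<lambda>y z. Q u y z u)"
  shows "metric_trace g S (\<lambda>y z. metric_trace g S (\<lambda>u v. Q u y z v)) = (\<Sum>y\<in>E. \<Sum>u\<in>E. Q u y y u)"
proof -
  have *: "metric_trace g S (\<lambda>u v. Q u y z v) = (\<Sum>u\<in>E. Q u y z u)" if "y \<in> S" "z \<in> S" for y z
    by (rule metric_trace_eq[OF inner[OF that]])
  have "bilinear_on S (\<lambda>y z. metric_trace g S (\<lambda>u v. Q u y z v))"
    by (rule bilinear_on_cong[OF subspace bilinear_on_sum[of E S "\<lambda>u y z. Q u y z u"]]) (auto intro: outer *)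
  from metric_trace_eq[OF this] show ?thesis
    by (simp add: * frame_in)
qed

end

section \<open>Cones over surfaces\<close>

context riemannian_connection
begin

lemma bilinear_on_curvature4_outer:
  assumes "y \<in> tangent_space A p" "z \<in> tangent_space A p"
    and F: "\<And>x. x \<in> tangent_space A p \<Longrightarrow> F x \<in> tangent_space A p"
      "\<And>x y. x \<in> tangent_space A p \<Longrightarrow> y \<in> tangent_space A p \<Longrightarrow> F (x + y) = F x + F y"
      "\<And>c x. x \<in> tangent_space A p \<Longrightarrow> F (c *\<^sub>R x) = c *\<^sub>R F x"
  shows "bilinear_on (tangent_space A p) (\<lambda>u v. curvature4 A g D p u y z (F v))"
  using assms unfolding bilinear_on_def curvature4_def
  by (simp add: curvature_add_1 curvature_scaleR_1 metric_add_left metric_add_right metric_scaleR_left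
      metric_scaleR_right curvature_tangent)

lemma bilinear_on_curvature4_inner:
  assumes "u \<in> tangent_space A p" "v \<in> tangent_space A p"
  shows "bilinear_on (tangent_space A p) (\<lambda>y z. curvature4 A g D p u y z v)"
  using assms unfolding bilinear_on_def curvature4_def
  by (simp add: curvature_add_2 curvature_scaleR_2 curvature_add_3 curvature_scaleR_3 metric_add_left
      metric_scaleR_left curvature_tangent)

lemma curvature_self:
  assumes "x \<in> tangent_space A p" "z \<in> tangent_space A p"
  shows "curvature A D p x x z = 0"
proof (rule tvec_eqI)
  fix f
  have "act (curvature A D p x x z) f = act (- curvature A D p x x z) f"
    by (rule arg_cong[OF curvature_antisym[OF assms(1,1,2)]])
  then show "act (curvature A D p x x z) f = act 0 f" by simp
qed

text \<open>This covers the pairs that span no plane: \<open>R(x, y)\<close> is bilinear and antisymmetric in \<open>x\<close> and \<open>y\<close>.\<close>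

lemma curvature4_collinear:
  assumes "x \<in> tangent_space A p" "y \<in> tangent_space A p" "x = c *\<^sub>R y \<or> y = c *\<^sub>R x"
  shows "curvature4 A g D p x y y x = 0" "g p y y * g p x x = g p x y * g p x y"
  using assms
  by (auto simp: curvature4_def curvature_scaleR_1 curvature_scaleR_2 curvature_self metric_scaleR_left
      metric_scaleR_right)

lemma gram_pos:
  assumes plane: "is_plane_basis A p x y"
  shows "g p x x * g p y y - (g p x y)\<^sup>2 > 0"
proof -
  have x: "x \<in> tangent_space A p" and y: "y \<in> tangent_space A p" and "x \<noteq> y" and ind: "independent {x, y}"
    using plane by (auto simp: is_plane_basis_def)
  have "x \<notin> span {y}" "y \<noteq> 0"
    using ind \<open>x \<noteq> y\<close> independent_insert[of x "{y}"] dependent_zero[of "{x, y}"] by auto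
  \<comment> \<open>The part of \<open>x\<close> orthogonal to \<open>y\<close>, scaled by \<open>g(y,y)\<close>; its square is \<open>g(y,y)\<close> times the Gram determinant.\<close>
  define w where "w = g p y y *\<^sub>R x - g p x y *\<^sub>R y"
  have pos: "g p y y > 0" using metric_pos[OF y \<open>y \<noteq> 0\<close>] .
  have "w \<noteq> 0"
  proof
    assume "w = 0"
    then have "g p y y *\<^sub>R x = g p x y *\<^sub>R y" by (simp add: w_def)
    then have "x = (g p x y / g p y y) *\<^sub>R y"
      using pos by (metis (no_types, opaque_lifting) divide_inverse_commute less_irrefl scaleR_left_imp_eq scaleR_scaleR
          right_inverse mult.assoc mult_1)
    then show False using \<open>x \<notin> span {y}\<close> by (metis span_base span_scale singletonI)
  qed
  have "w \<in> tangent_space A p" unfolding w_def using x y by simp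
  then have "0 < g p w w" using \<open>w \<noteq> 0\<close> by (rule metric_pos)
  also have "g p w w = g p y y * (g p x x * g p y y - (g p x y)\<^sup>2)"
    unfolding w_def using x y metric_sym[OF y x]
    by (simp add: metric_diff_left metric_diff_right metric_scaleR_left metric_scaleR_right
        power2_eq_square algebra_simps)
  finally show ?thesis using pos by (simp add: zero_less_mult_iff)
qed

lemma curvature4_pointwise_constant:
  assumes k: "pointwise_sectional_curvature A g D k" and plane: "is_plane_basis A p x y"
  shows "curvature4 A g D p x y y x = k p * (g p x x * g p y y - (g p x y)\<^sup>2)"
proof -
  have "p \<in> points A" using plane tangent_points by (auto simp: is_plane_basis_def)
  then have "sectional_curvature A g D p x y = k p"
    using k plane unfolding pointwise_sectional_curvature_def by blast
  then show ?thesis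
    using gram_pos[OF plane] by (simp add: sectional_curvature_def field_simps)
qed

end

context riemannian_manifold
begin

lemma bilinear_on_metric: "bilinear_on (tangent_space A p) (g p)"
  unfolding bilinear_on_def
  by (simp add: metric_add_left metric_add_right metric_scaleR_left metric_scaleR_right)

lemma independent_orthogonal:
  assumes F: "finite F" "F \<subseteq> tangent_space A p" "0 \<notin> F"
    and orth: "\<And>x y. x \<in> F \<Longrightarrow> y \<in> F \<Longrightarrow> x \<noteq> y \<Longrightarrow> g p x y = 0"
  shows "independent F"
proof (rule independent_if_scalars_zero[OF F(1)])
  fix f x assume sum: "(\<Sum>x\<in>F. f x *\<^sub>R x) = 0" and x: "x \<in> F"
  then have xt: "x \<in> tangent_space A p" using F by blast
  have "0 = g p (\<Sum>y\<in>F. f y *\<^sub>R y) x" using sum xt by simp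
  also have "\<dots> = (\<Sum>y\<in>F. f y * g p y x)"
    using F(2) xt by (subst metric_sum_left) (auto simp: metric_scaleR_left subset_iff intro!: sum.cong)
  also have "\<dots> = (\<Sum>y\<in>F. if y = x then f x * g p x x else 0)"
    by (rule sum.cong) (use orth x in auto)
  also have "\<dots> = f x * g p x x" using F(1) x by simp
  finally show "f x = 0" using metric_pos[OF xt] x F(3) by (metis less_irrefl mult_eq_0_iff)
qed

lemma card_independent_le:
  assumes "p \<in> points A" "independent F" "F \<subseteq> tangent_space A p"
  shows "finite F \<and> card F \<le> DIM('e)"
proof -
  obtain U \<phi> where c: "(U, \<phi>) \<in> A" "p \<in> U" using assms(1) by (rule point_in_chart)
  let ?G = "coord_vec A p (U, \<phi>) ` Basis"
  have "tangent_space A p \<subseteq> span ?G"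
  proof
    fix v assume v: "v \<in> tangent_space A p"
    show "v \<in> span ?G"
      by (subst tangent_expand[OF c v]) (intro span_sum span_scale span_base imageI)
  qed
  then have "finite F \<and> card F \<le> card ?G"
    using assms by (intro independent_span_bound) auto
  then show ?thesis using card_image_le[OF finite_Basis, of "coord_vec A p (U, \<phi>)"] by auto
qed

text \<open>An isometric involution has orthogonal eigenspaces for \<open>1\<close> and \<open>-1\<close>. On a plane the conditions
  \<open>P \<noteq> I\<close> and \<open>tr P = 0\<close> make both of them lines: \<open>x - P x\<close> and \<open>y + P y\<close> are eigenvectors, nonzero for
  suitable \<open>x\<close> and \<open>y\<close>, since \<open>P = -I\<close> would have trace \<open>-2\<close>.\<close>

lemma paracomplex_frame:
  assumes dim: "DIM('e) = 2" and p: "p \<in> points A"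
    and P: "\<And>x. x \<in> tangent_space A p \<Longrightarrow> P x \<in> tangent_space A p"
      "\<And>x y. x \<in> tangent_space A p \<Longrightarrow> y \<in> tangent_space A p \<Longrightarrow> P (x + y) = P x + P y"
      "\<And>c x. x \<in> tangent_space A p \<Longrightarrow> P (c *\<^sub>R x) = c *\<^sub>R P x"
    and involution: "\<And>x. x \<in> tangent_space A p \<Longrightarrow> P (P x) = x"
    and isometry: "\<And>x y. x \<in> tangent_space A p \<Longrightarrow> y \<in> tangent_space A p \<Longrightarrow> g p (P x) (P y) = g p x y"
    and nontrivial: "\<exists>x\<in>tangent_space A p. P x \<noteq> x"
    and trace: "endo_trace (tangent_space A p) P = 0"
  obtains e\<^sub>1 e\<^sub>2 where "e\<^sub>1 \<in> tangent_space A p" "e\<^sub>2 \<in> tangent_space A p" "P e\<^sub>1 = e\<^sub>1" "P e\<^sub>2 = - e\<^sub>2"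
    "g p e\<^sub>1 e\<^sub>1 = 1" "g p e\<^sub>2 e\<^sub>2 = 1" "g p e\<^sub>1 e\<^sub>2 = 0"
    "\<And>x. x \<in> tangent_space A p \<Longrightarrow> x = g p x e\<^sub>1 *\<^sub>R e\<^sub>1 + g p x e\<^sub>2 *\<^sub>R e\<^sub>2"
proof -
  let ?T = "tangent_space A p" and ?B = "some_basis (tangent_space A p)"
  have neg: "P (- x) = - P x" "- x \<in> ?T" if "x \<in> ?T" for x
    using P(3)[OF that, of "-1"] tangent_closed(4)[OF that, of "-1"] by simp_all
  have diff: "P (x - y) = P x - P y" if "x \<in> ?T" "y \<in> ?T" for x y
    using P(2)[OF that(1) neg(2)[OF that(2)]] neg(1)[OF that(2)] by simp
  obtain x where x: "x \<in> ?T" "P x \<noteq> x" using nontrivial by blast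
  have "\<exists>y\<in>?T. P y \<noteq> - y"
  proof (rule ccontr)
    assume "\<not> ?thesis"
    then have P': "P y = - y" if "y \<in> ?T" for y using that by blast
    have "\<exists>B. independent B \<and> span B = ?T"
      using basis_exists[of ?T] subspace_tangent_space[OF p] by (metis span_subspace)
    then have "independent ?B \<and> span ?B = ?T"
      unfolding some_basis_def by (rule someI_ex)
    then have B: "independent ?B" "span ?B = ?T" by auto
    have "finite ?B" using card_independent_le[OF p B(1)] B(2) span_superset by blast
    moreover have "?B \<noteq> {}"
    proof
      assume "?B = {}"
      then have "?T = {0}" using B(2) by simp
      then show False using x P(1)[OF x(1)] by simp
    qed
    moreover have "representation ?B (P b) b = - 1" if "b \<in> ?B" for b
    proof -
      have b: "b \<in> ?T" using B(2) that span_base by blast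
      show ?thesis
        using representation_basis[OF B(1) that] representation_scale[OF B(1), of b "-1"] b B(2)
        by (simp add: P'[OF b])
    qed
    then have "endo_trace ?T P = - real (card ?B)" by (simp add: endo_trace_def)
    ultimately show False using trace by simp
  qed
  then obtain y where y: "y \<in> ?T" "P y \<noteq> - y" by blast
  define u v where "u = y + P y" and "v = x - P x"
  have u: "u \<in> ?T" "u \<noteq> 0" "P u = u"
    unfolding u_def using y P involution by (auto simp: add.commute eq_neg_iff_add_eq_0)
  have v: "v \<in> ?T" "v \<noteq> 0" "P v = - v"
    unfolding v_def using x P involution by (auto simp: diff)
  have "g p u v = g p u (- v)" using isometry[OF u(1) v(1)] u v by simp
  then have uv: "g p u v = 0" using metric_scaleR_right[OF v(1) u(1), of "-1"] by simp
  define e\<^sub>1 e\<^sub>2 where "e\<^sub>1 = (1 / sqrt (g p u u)) *\<^sub>R u" and "e\<^sub>2 = (1 / sqrt (g p v v)) *\<^sub>R v"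
  have pos: "g p u u > 0" "g p v v > 0" using metric_pos u v by auto
  have e: "e\<^sub>1 \<in> ?T" "e\<^sub>2 \<in> ?T" unfolding e\<^sub>1_def e\<^sub>2_def using u v by auto
  have Pe: "P e\<^sub>1 = e\<^sub>1" "P e\<^sub>2 = - e\<^sub>2" unfolding e\<^sub>1_def e\<^sub>2_def using u v P(3) by auto
  have ee: "g p e\<^sub>1 e\<^sub>1 = 1" "g p e\<^sub>2 e\<^sub>2 = 1" "g p e\<^sub>1 e\<^sub>2 = 0"
    unfolding e\<^sub>1_def e\<^sub>2_def using u v pos uv
    by (simp_all add: metric_scaleR_left metric_scaleR_right)
  have ee': "g p e\<^sub>2 e\<^sub>1 = 0" using metric_sym[OF e] ee(3) by simp
  have "z = g p z e\<^sub>1 *\<^sub>R e\<^sub>1 + g p z e\<^sub>2 *\<^sub>R e\<^sub>2" if z: "z \<in> ?T" for z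
  proof (rule ccontr)
    assume ne: "z \<noteq> g p z e\<^sub>1 *\<^sub>R e\<^sub>1 + g p z e\<^sub>2 *\<^sub>R e\<^sub>2"
    define w where "w = z - (g p z e\<^sub>1 *\<^sub>R e\<^sub>1 + g p z e\<^sub>2 *\<^sub>R e\<^sub>2)"
    have w: "w \<in> ?T" "w \<noteq> 0" unfolding w_def using z e ne by auto
    have we: "g p w e\<^sub>1 = 0" "g p w e\<^sub>2 = 0"
      unfolding w_def using z e ee ee' by (simp_all add: metric_diff_left metric_add_left metric_scaleR_left)
    have ew: "g p e\<^sub>1 w = 0" "g p e\<^sub>2 w = 0" using we metric_sym w e by auto
    have e0: "e\<^sub>1 \<noteq> 0" "e\<^sub>2 \<noteq> 0" using ee e by auto
    have ne: "e\<^sub>1 \<noteq> e\<^sub>2" "w \<noteq> e\<^sub>1" "w \<noteq> e\<^sub>2" using ee we by auto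
    have "independent {w, e\<^sub>1, e\<^sub>2}"
      by (rule independent_orthogonal[of _ p]) (use w e e0 we ew ee ee' in auto)
    from card_independent_le[OF p this] show False using w e ne dim by auto
  qed
  with that e Pe ee show ?thesis by blast
qed

end

context cone_connection
begin

text \<open>Writing \<open>\<xi> = a x + b y\<close> and taking horizontal parts gives a linear relation between those of \<open>x\<close> and \<open>y\<close>.\<close>

lemma sectional_curvature_xi:
  assumes plane: "is_plane_basis C z x y" and span: "cone_xi A z \<in> span {x, y}"
  shows "sectional_curvature C g D z x y = 0"
proof -
  obtain t p where z: "z = (t, p)" by fastforce
  have x: "x \<in> tangent_space C (t, p)" and y: "y \<in> tangent_space C (t, p)"
    using plane by (auto simp: is_plane_basis_def z)
  have pts: "(t, p) \<in> points C" by (rule C.tangent_points[OF x])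
  then have t: "t > 0" by (simp add: points_cone)
  note hx = horizontal_tangent[OF x, simplified] and hy = horizontal_tangent[OF y, simplified]
  obtain a where "cone_xi A (t, p) - a *\<^sub>R x \<in> span {y}"
    using span by (auto simp: span_insert z)
  then obtain b where "cone_xi A (t, p) - a *\<^sub>R x = b *\<^sub>R y"
    by (auto simp: span_singleton)
  then have xi: "cone_xi A (t, p) = a *\<^sub>R x + b *\<^sub>R y" by (simp add: algebra_simps)
  have h0: "a *\<^sub>R horizontal x + b *\<^sub>R horizontal y = 0"
    using arg_cong[OF xi, of horizontal] pts by simp
  have "a \<noteq> 0 \<or> b \<noteq> 0"
    using arg_cong[OF xi, of radial] pts by auto
  then obtain c where c: "horizontal x = c *\<^sub>R horizontal y \<or> horizontal y = c *\<^sub>R horizontal x"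
  proof
    assume "a \<noteq> 0"
    have "a *\<^sub>R horizontal x = a *\<^sub>R (- b / a) *\<^sub>R horizontal y"
      using h0 \<open>a \<noteq> 0\<close> by (simp add: eq_neg_iff_add_eq_0)
    then show ?thesis using that[of "- b / a"] \<open>a \<noteq> 0\<close> by (blast dest: scaleR_left_imp_eq)
  next
    assume "b \<noteq> 0"
    have "b *\<^sub>R horizontal y = b *\<^sub>R (- a / b) *\<^sub>R horizontal x"
      using h0 \<open>b \<noteq> 0\<close> by (simp add: eq_neg_iff_add_eq_0 add.commute)
    then show ?thesis using that[of "- a / b"] \<open>b \<noteq> 0\<close> by (blast dest: scaleR_left_imp_eq)
  qed
  have "curvature4 C g D (t, p) x y y x = 0"
    using curvature4_cone_vec[OF t hx hy hy hx, of "radial x" "radial y" "radial y" "radial x"]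
      curvature4_collinear[OF hx hy c] metric_sym[OF hx hy]
    by (simp add: cone_vec_collapse x y)
  then show ?thesis by (simp add: sectional_curvature_def z)
qed

end

context riemannian_cone
begin

lemma cone_frame:
  assumes t: "t > 0" and e: "e\<^sub>1 \<in> tangent_space A p" "e\<^sub>2 \<in> tangent_space A p"
    "h p e\<^sub>1 e\<^sub>1 = 1" "h p e\<^sub>2 e\<^sub>2 = 1" "h p e\<^sub>1 e\<^sub>2 = 0"
    and expand: "\<And>x. x \<in> tangent_space A p \<Longrightarrow> x = h p x e\<^sub>1 *\<^sub>R e\<^sub>1 + h p x e\<^sub>2 *\<^sub>R e\<^sub>2"
  defines "f\<^sub>1 \<equiv> cone_vec A (t, p) ((1 / t) *\<^sub>R e\<^sub>1) 0" and "f\<^sub>2 \<equiv> cone_vec A (t, p) ((1 / t) *\<^sub>R e\<^sub>2) 0"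
    and "\<xi> \<equiv> cone_xi A (t, p)"
  shows "orthonormal_frame (tangent_space C (t, p)) (g (t, p)) {\<xi>, f\<^sub>1, f\<^sub>2}"
    and "\<xi> \<noteq> f\<^sub>1" "\<xi> \<noteq> f\<^sub>2" "f\<^sub>1 \<noteq> f\<^sub>2"
proof -
  have pts: "(t, p) \<in> points C" using t tangent_points[OF e(1)] by (simp add: points_cone)
  have e': "h p e\<^sub>2 e\<^sub>1 = 0" using metric_sym[OF e(1,2)] e(5) by simp
  have f: "\<xi> \<in> tangent_space C (t, p)" "f\<^sub>1 \<in> tangent_space C (t, p)" "f\<^sub>2 \<in> tangent_space C (t, p)"
    using t e pts by (simp_all add: f\<^sub>1_def f\<^sub>2_def \<xi>_def)
  have hr: "horizontal \<xi> = 0" "radial \<xi> = 1" "horizontal f\<^sub>1 = (1 / t) *\<^sub>R e\<^sub>1" "radial f\<^sub>1 = 0"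
    "horizontal f\<^sub>2 = (1 / t) *\<^sub>R e\<^sub>2" "radial f\<^sub>2 = 0"
    using t e pts by (simp_all add: f\<^sub>1_def f\<^sub>2_def \<xi>_def)
  have ortho: "g (t, p) \<xi> \<xi> = 1" "g (t, p) f\<^sub>1 f\<^sub>1 = 1" "g (t, p) f\<^sub>2 f\<^sub>2 = 1"
    "g (t, p) \<xi> f\<^sub>1 = 0" "g (t, p) \<xi> f\<^sub>2 = 0" "g (t, p) f\<^sub>1 f\<^sub>2 = 0"
    "g (t, p) f\<^sub>1 \<xi> = 0" "g (t, p) f\<^sub>2 \<xi> = 0" "g (t, p) f\<^sub>2 f\<^sub>1 = 0"
    using t e e' tangent_points[OF e(1)]
    by (simp_all add: cone_metric_def hr metric_scaleR_left metric_scaleR_right power2_eq_square)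
  show ne: "\<xi> \<noteq> f\<^sub>1" "\<xi> \<noteq> f\<^sub>2" "f\<^sub>1 \<noteq> f\<^sub>2" using ortho by auto
  show "orthonormal_frame (tangent_space C (t, p)) (g (t, p)) {\<xi>, f\<^sub>1, f\<^sub>2}"
  proof
    show "subspace (tangent_space C (t, p))" by (rule C.subspace_tangent_space[OF pts])
    show "bilinear_on (tangent_space C (t, p)) (g (t, p))" by (rule C.bilinear_on_metric)
    show "g (t, p) x y = g (t, p) y x" if "x \<in> tangent_space C (t, p)" "y \<in> tangent_space C (t, p)" for x y
      using C.metric_sym that .
    show "{\<xi>, f\<^sub>1, f\<^sub>2} \<subseteq> tangent_space C (t, p)" using f by simp
    show "g (t, p) a b = (if a = b then 1 else 0)" if "a \<in> {\<xi>, f\<^sub>1, f\<^sub>2}" "b \<in> {\<xi>, f\<^sub>1, f\<^sub>2}" for a b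
      using that ortho ne by auto
    show "x = (\<Sum>a\<in>{\<xi>, f\<^sub>1, f\<^sub>2}. g (t, p) x a *\<^sub>R a)" if x: "x \<in> tangent_space C (t, p)" for x
    proof (rule tangent_cone_eqI[OF x])
      show "(\<Sum>a\<in>{\<xi>, f\<^sub>1, f\<^sub>2}. g (t, p) x a *\<^sub>R a) \<in> tangent_space C (t, p)"
        using f by (intro C.tangent_sum[OF pts]) auto
      have hx: "horizontal x \<in> tangent_space A p" using horizontal_tangent[OF x] by simp
      have g: "g (t, p) x f\<^sub>1 = t * h p (horizontal x) e\<^sub>1" "g (t, p) x f\<^sub>2 = t * h p (horizontal x) e\<^sub>2"
        "g (t, p) x \<xi> = radial x"
        using t e hx by (simp_all add: cone_metric_def hr metric_scaleR_right power2_eq_square)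
      show "horizontal x = horizontal (\<Sum>a\<in>{\<xi>, f\<^sub>1, f\<^sub>2}. g (t, p) x a *\<^sub>R a)"
        using ne t expand[OF hx] by (simp add: hr g)
      show "radial x = radial (\<Sum>a\<in>{\<xi>, f\<^sub>1, f\<^sub>2}. g (t, p) x a *\<^sub>R a)"
        using ne by (simp add: hr g)
    qed
  qed simp
qed

end

context riemannian_connection
begin

lemma collinear_or_plane:
  assumes "x \<in> tangent_space A p" "y \<in> tangent_space A p"
  obtains c where "x = c *\<^sub>R y \<or> y = c *\<^sub>R x" | "is_plane_basis A p x y"
proof (cases "is_plane_basis A p x y")
  case False
  then consider "x = y" | "x \<noteq> y" "dependent {x, y}" using assms by (auto simp: is_plane_basis_def)
  then show ?thesis
  proof cases
    case 1
    then show ?thesis using that(1)[of 1] by simp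
  next
    case 2
    then have "dependent {y} \<or> x \<in> span {y}"
      using independent_insert[of x "{y}"] by auto
    then show ?thesis
    proof
      assume "dependent {y}"
      then show ?thesis using that(1)[of 0] by (simp add: independent_insert)
    next
      assume "x \<in> span {y}"
      then show ?thesis using that(1) by (auto simp: span_singleton)
    qed
  qed
qed (use that in blast)

lemma curvature4_gauss:
  assumes k: "pointwise_sectional_curvature A g D k"
    and x: "x \<in> tangent_space A p" and y: "y \<in> tangent_space A p"
  shows "curvature4 A g D p x y y x = k p * (g p x x * g p y y - (g p x y)\<^sup>2)"
proof -
  consider c where "x = c *\<^sub>R y \<or> y = c *\<^sub>R x" | "is_plane_basis A p x y"
    using collinear_or_plane[OF x y] .
  then show ?thesis
  proof cases
    case 1
    from curvature4_collinear[OF x y this] show ?thesis by (simp add: power2_eq_square mult.commute)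
  next
    case 2
    then show ?thesis by (rule curvature4_pointwise_constant[OF k])
  qed
qed

end

context cone_connection
begin

lemma curvature4_cone_gauss:
  assumes k: "pointwise_sectional_curvature A h D' k" and t: "t > 0"
    and x: "x \<in> tangent_space A p" and y: "y \<in> tangent_space A p"
  shows "curvature4 C g D (t, p) (cone_vec A (t, p) x a) (cone_vec A (t, p) y b) (cone_vec A (t, p) y b)
      (cone_vec A (t, p) x a) = t\<^sup>2 * (k p - 1) * (h p x x * h p y y - (h p x y)\<^sup>2)"
  using curvature4_cone_vec[OF t x y y x, of a b b a] curvature4_gauss[OF k x y] metric_sym[OF x y]
  by (simp add: power2_eq_square algebra_simps)

text \<open>In the frame \<open>\<xi>, e\<^sub>1/t, e\<^sub>2/t\<close> only the plane of the last two vectors is curved, with sectional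
  curvature \<open>(k - 1) / t\<^sup>2\<close>. The scalar curvature counts it twice; in \<open>\<tau>\<^sup>*\<close> it enters once with the eigenvalue \<open>1\<close>
  and once with the eigenvalue \<open>-1\<close> of \<open>\<phi>\<close>.\<close>

lemma scalar_curvatures_cone:
  assumes k: "pointwise_sectional_curvature A h D' k" and t: "t > 0"
    and e: "e\<^sub>1 \<in> tangent_space A p" "e\<^sub>2 \<in> tangent_space A p"
    "h p e\<^sub>1 e\<^sub>1 = 1" "h p e\<^sub>2 e\<^sub>2 = 1" "h p e\<^sub>1 e\<^sub>2 = 0"
    and expand: "\<And>x. x \<in> tangent_space A p \<Longrightarrow> x = h p x e\<^sub>1 *\<^sub>R e\<^sub>1 + h p x e\<^sub>2 *\<^sub>R e\<^sub>2"
  shows "scalar_curvature C g D (t, p) = 2 * (k p - 1) / t\<^sup>2"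
    and "smooth_endo A P \<Longrightarrow> P p e\<^sub>1 = e\<^sub>1 \<Longrightarrow> P p e\<^sub>2 = - e\<^sub>2 \<Longrightarrow>
      star_scalar_curvature C (cone_endo A P) g D (t, p) = 0"
proof -
  define f\<^sub>1 f\<^sub>2 \<xi> where "f\<^sub>1 = cone_vec A (t, p) ((1 / t) *\<^sub>R e\<^sub>1) 0" and "f\<^sub>2 = cone_vec A (t, p) ((1 / t) *\<^sub>R e\<^sub>2) 0"
    and "\<xi> = cone_xi A (t, p)"
  note frame = cone_frame[OF t e expand, folded f\<^sub>1_def f\<^sub>2_def \<xi>_def]
  interpret orthonormal_frame "tangent_space C (t, p)" "g (t, p)" "{\<xi>, f\<^sub>1, f\<^sub>2}" by (rule frame(1))
  have e': "h p e\<^sub>2 e\<^sub>1 = 0" using metric_sym[OF e(1,2)] e(5) by simp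
  have p: "p \<in> points A" by (rule tangent_points[OF e(1)])
  have xi: "\<xi> = cone_vec A (t, p) 0 1" by (simp add: \<xi>_def cone_xi_def)
  let ?K = "curvature4 C g D (t, p)"
  have flat: "?K \<xi> \<xi> \<xi> \<xi> = 0" "?K \<xi> f\<^sub>1 f\<^sub>1 \<xi> = 0" "?K \<xi> f\<^sub>2 f\<^sub>2 \<xi> = 0" "?K f\<^sub>1 \<xi> \<xi> f\<^sub>1 = 0" "?K f\<^sub>2 \<xi> \<xi> f\<^sub>2 = 0"
    "?K f\<^sub>1 f\<^sub>1 f\<^sub>1 f\<^sub>1 = 0" "?K f\<^sub>2 f\<^sub>2 f\<^sub>2 f\<^sub>2 = 0"
    unfolding xi f\<^sub>1_def f\<^sub>2_def using t e p
    by (simp_all add: curvature4_cone_gauss[OF k t] metric_scaleR_left metric_scaleR_right power2_eq_square)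
  have curved: "?K f\<^sub>1 f\<^sub>2 f\<^sub>2 f\<^sub>1 = (k p - 1) / t\<^sup>2" "?K f\<^sub>2 f\<^sub>1 f\<^sub>1 f\<^sub>2 = (k p - 1) / t\<^sup>2"
    unfolding f\<^sub>1_def f\<^sub>2_def using t e e'
    by (simp_all add: curvature4_cone_gauss[OF k t] metric_scaleR_left metric_scaleR_right power2_eq_square)
  have "scalar_curvature C g D (t, p) = (\<Sum>y\<in>{\<xi>, f\<^sub>1, f\<^sub>2}. \<Sum>u\<in>{\<xi>, f\<^sub>1, f\<^sub>2}. ?K u y y u)"
    unfolding scalar_curvature_def ricci_def[abs_def]
    by (rule metric_trace_metric_trace_eq)
      (auto intro!: CD.bilinear_on_curvature4_outer CD.bilinear_on_curvature4_inner frame_in)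
  then show "scalar_curvature C g D (t, p) = 2 * (k p - 1) / t\<^sup>2"
    using frame(2-4) by (simp add: flat curved)
  assume P: "smooth_endo A P" "P p e\<^sub>1 = e\<^sub>1" "P p e\<^sub>2 = - e\<^sub>2"
  let ?F = "cone_endo A P (t, p)"
  have F: "x \<in> tangent_space C (t, p) \<Longrightarrow> ?F x \<in> tangent_space C (t, p)"
    "x \<in> tangent_space C (t, p) \<Longrightarrow> y \<in> tangent_space C (t, p) \<Longrightarrow> ?F (x + y) = ?F x + ?F y"
    "x \<in> tangent_space C (t, p) \<Longrightarrow> ?F (c *\<^sub>R x) = c *\<^sub>R ?F x" for x y c
    using smooth_endo_cone[OF P(1)] C.tangent_points unfolding smooth_endo_def by blast+
  have Pe: "P p (c *\<^sub>R e\<^sub>1) = c *\<^sub>R e\<^sub>1" "P p (c *\<^sub>R e\<^sub>2) = - (c *\<^sub>R e\<^sub>2)" "P p 0 = 0" for c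
  proof -
    have scale: "P p (c *\<^sub>R x) = c *\<^sub>R P p x" if "x \<in> tangent_space A p" for c x
      using P(1) p that unfolding smooth_endo_def by blast
    show "P p (c *\<^sub>R e\<^sub>1) = c *\<^sub>R e\<^sub>1" "P p (c *\<^sub>R e\<^sub>2) = - (c *\<^sub>R e\<^sub>2)" "P p 0 = 0"
      using scale[of e\<^sub>1 c] scale[of e\<^sub>2 c] scale[of e\<^sub>1 0] e P by simp_all
  qed
  have f: "\<xi> \<in> tangent_space C (t, p)" "f\<^sub>1 \<in> tangent_space C (t, p)" "f\<^sub>2 \<in> tangent_space C (t, p)"
    by (auto intro: frame_in)
  have Ff: "?F \<xi> = 0" "?F f\<^sub>1 = f\<^sub>1" "?F f\<^sub>2 = (-1) *\<^sub>R f\<^sub>2"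
    unfolding xi f\<^sub>1_def f\<^sub>2_def using t e p cone_vec_scaleR[of 0 p t 0 0]
      cone_vec_scaleR[of "(1 / t) *\<^sub>R e\<^sub>2" p t "-1" 0]
    by (simp_all add: cone_endo_def Pe)
  have star: "?K u y y (?F \<xi>) = 0" "?K u y y (?F f\<^sub>1) = ?K u y y f\<^sub>1" "?K u y y (?F f\<^sub>2) = - ?K u y y f\<^sub>2"
    if "u \<in> tangent_space C (t, p)" "y \<in> tangent_space C (t, p)" for u y
    using C.metric_scaleR_right[OF f(3) CD.curvature_tangent[OF that that(2)], of "-1"]
      C.metric_zero_right[OF CD.curvature_tangent[OF that that(2)]]
    by (simp_all add: curvature4_def Ff)
  have "star_scalar_curvature C (cone_endo A P) g D (t, p) =
      (\<Sum>y\<in>{\<xi>, f\<^sub>1, f\<^sub>2}. \<Sum>u\<in>{\<xi>, f\<^sub>1, f\<^sub>2}. ?K u y y (?F u))"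
    unfolding star_scalar_curvature_def star_ricci_def[abs_def]
    by (rule metric_trace_metric_trace_eq)
      (auto intro!: CD.bilinear_on_curvature4_outer CD.bilinear_on_curvature4_inner frame_in F)
  then show "star_scalar_curvature C (cone_endo A P) g D (t, p) = 0"
    using frame(2-4) f by (simp add: star flat curved)
qed

end

theorem theorem2p4:
  fixes A :: "('a::{t2_space,second_countable_topology}, real^2) atlas"
    and P :: "'a endo" and h :: "'a metric" and k' :: "'a \<Rightarrow> real"
    and D' :: "'a connection" and D :: "(real \<times> 'a) connection"
  defines "C \<equiv> cone_atlas A" and "\<phi> \<equiv> cone_endo A P" and "\<xi> \<equiv> cone_xi A"
    and "\<eta> \<equiv> cone_eta" and "g \<equiv> cone_metric h"
  assumes "almost_paracomplex_riemannian A P h"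
    and "levi_civita A h D'"
    and "pointwise_sectional_curvature A h D' k'"
    and "levi_civita C g D"
  shows "apapR_manifold C \<phi> \<xi> \<eta> g
    \<and> (\<forall>z\<in>points C. \<forall>x y. is_plane_basis C z x y \<and> \<xi> z \<in> span {x, y} \<longrightarrow>
          sectional_curvature C g D z x y = 0)
    \<and> (\<forall>z\<in>points C. star_scalar_curvature C \<phi> g D z = 0)
    \<and> (\<forall>(t, p)\<in>points C. scalar_curvature C g D (t, p) < 0 \<longleftrightarrow> k' p < 1)
    \<and> (\<forall>(t, p)\<in>points C. scalar_curvature C g D (t, p) > 0 \<longleftrightarrow> k' p > 1)"
proof -
  note apc = assms(6)[unfolded almost_paracomplex_riemannian_def]
  have P: "smooth_endo A P" using apc by blast
  interpret riemannian_cone A h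
    by unfold_locales (use apc in blast)+
  interpret cone_connection A h D' D
    by unfold_locales (use assms(7,9) riemannian_metric_cone in \<open>simp_all add: C_def g_def\<close>)
  have Pt: "P p x \<in> tangent_space A p"
    and Padd: "y \<in> tangent_space A p \<Longrightarrow> P p (x + y) = P p x + P p y"
    and Pscale: "P p (a *\<^sub>R x) = a *\<^sub>R P p x"
    and PP: "P p (P p x) = x"
    and Piso: "y \<in> tangent_space A p \<Longrightarrow> h p (P p x) (P p y) = h p x y"
    if "x \<in> tangent_space A p" for p x y a
    using apc that tangent_points[OF that] unfolding smooth_endo_def by blast+
  have P0: "P p 0 = 0" if "p \<in> points A" for p
    using Pscale[of 0 p 0] that by simp
  have frame: thesis
    if p: "p \<in> points A" and *: "\<And>e\<^sub>1 e\<^sub>2. e\<^sub>1 \<in> tangent_space A p \<Longrightarrow> e\<^sub>2 \<in> tangent_space A p \<Longrightarrow> P p e\<^sub>1 = e\<^sub>1 \<Longrightarrow>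
      P p e\<^sub>2 = - e\<^sub>2 \<Longrightarrow> h p e\<^sub>1 e\<^sub>1 = 1 \<Longrightarrow> h p e\<^sub>2 e\<^sub>2 = 1 \<Longrightarrow> h p e\<^sub>1 e\<^sub>2 = 0 \<Longrightarrow>
      (\<And>x. x \<in> tangent_space A p \<Longrightarrow> x = h p x e\<^sub>1 *\<^sub>R e\<^sub>1 + h p x e\<^sub>2 *\<^sub>R e\<^sub>2) \<Longrightarrow> thesis" for p thesis
  proof (rule paracomplex_frame[of p "P p"])
    show "\<exists>x\<in>tangent_space A p. P p x \<noteq> x" "endo_trace (tangent_space A p) (P p) = 0" using apc p by blast+
  qed (use p Pt Padd Pscale PP Piso * in auto)
  have scalars: "star_scalar_curvature C \<phi> g D (t, p) = 0"
    "scalar_curvature C g D (t, p) = 2 * (k' p - 1) / t\<^sup>2"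
    if tp: "(t, p) \<in> points C" for t p
  proof -
    have t: "t > 0" and p: "p \<in> points A" using tp by (auto simp: C_def points_cone)
    show "star_scalar_curvature C \<phi> g D (t, p) = 0"
      by (rule frame[OF p]) (simp add: C_def g_def \<phi>_def scalar_curvatures_cone(2)[OF assms(8) t] P)
    show "scalar_curvature C g D (t, p) = 2 * (k' p - 1) / t\<^sup>2"
      unfolding C_def g_def
      by (rule frame[OF p]) (rule scalar_curvatures_cone(1)[OF assms(8) t])
  qed
  have "apapR_manifold (cone_atlas A) (cone_endo A P) (cone_xi A) cone_eta (cone_metric h)"
    unfolding apapR_manifold_def
  proof (intro conjI ballI)
    show "odd DIM(real \<times> (real^2))" by simp
  next
    fix z assume z: "z \<in> points (cone_atlas A)"
    obtain t p where tp: "z = (t, p)" by fastforce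
    have t: "t > 0" and p: "p \<in> points A" using z by (auto simp: tp points_cone)
    have hF: "horizontal (cone_endo A P z x) = P p (horizontal x)" "radial (cone_endo A P z x) = 0"
      "cone_endo A P z x \<in> tangent_space (cone_atlas A) z" if "x \<in> tangent_space (cone_atlas A) z" for x
      using Pt[OF horizontal_tangent[OF that]] t by (simp_all add: cone_endo_def tp)
    note hx = horizontal_tangent[of _ z, unfolded tp, simplified]
    show "cone_endo A P z (cone_endo A P z x) = x - cone_eta z x *\<^sub>R cone_xi A z"
      if x: "x \<in> tangent_space (cone_atlas A) z" for x
      by (rule tangent_cone_eqI[of _ z]) (use x z hx hF PP in \<open>auto simp: cone_eta_def tp\<close>)
    show "cone_eta z (cone_xi A z) = 1" using z by (simp add: cone_eta_def)
    show "cone_eta z (cone_endo A P z x) = 0" if "x \<in> tangent_space (cone_atlas A) z" for x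
      using hF[OF that] by (simp add: cone_eta_def)
    show F0: "cone_endo A P z (cone_xi A z) = 0"
      by (rule tangent_cone_eqI[of _ z]) (use z hF[OF xi_tangent[OF z]] P0[OF p] in simp_all)
    show "cone_metric h z (cone_endo A P z x) (cone_endo A P z y) =
        cone_metric h z x y - cone_eta z x * cone_eta z y"
      if "x \<in> tangent_space (cone_atlas A) z" "y \<in> tangent_space (cone_atlas A) z" for x y
      using that hF hx Piso by (simp add: cone_metric_def cone_eta_def tp)
    show "endo_trace (tangent_space (cone_atlas A) z) (cone_endo A P z) = 0"
    proof (rule frame[OF p])
      fix e\<^sub>1 e\<^sub>2
      assume e: "e\<^sub>1 \<in> tangent_space A p" "e\<^sub>2 \<in> tangent_space A p"
        and Pe: "P p e\<^sub>1 = e\<^sub>1" "P p e\<^sub>2 = - e\<^sub>2"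
        and he: "h p e\<^sub>1 e\<^sub>1 = 1" "h p e\<^sub>2 e\<^sub>2 = 1" "h p e\<^sub>1 e\<^sub>2 = 0"
        and expand: "\<And>x. x \<in> tangent_space A p \<Longrightarrow> x = h p x e\<^sub>1 *\<^sub>R e\<^sub>1 + h p x e\<^sub>2 *\<^sub>R e\<^sub>2"
      define f\<^sub>1 f\<^sub>2 where "f\<^sub>1 = cone_vec A (t, p) ((1 / t) *\<^sub>R e\<^sub>1) 0" and "f\<^sub>2 = cone_vec A (t, p) ((1 / t) *\<^sub>R e\<^sub>2) 0"
      note fr = cone_frame[OF t e he expand, folded f\<^sub>1_def f\<^sub>2_def tp]
      interpret orthonormal_frame "tangent_space (cone_atlas A) z" "cone_metric h z" "{cone_xi A z, f\<^sub>1, f\<^sub>2}"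
        by (rule fr(1))
      have Fadd: "cone_endo A P z (x + y) = cone_endo A P z x + cone_endo A P z y"
        and Fscale: "cone_endo A P z (c *\<^sub>R x) = c *\<^sub>R cone_endo A P z x"
        if "x \<in> tangent_space (cone_atlas A) z" "y \<in> tangent_space (cone_atlas A) z" for x y c
        using smooth_endo_cone[OF P] z that unfolding smooth_endo_def by blast+
      have f: "cone_xi A z \<in> tangent_space (cone_atlas A) z" "f\<^sub>1 \<in> tangent_space (cone_atlas A) z"
        "f\<^sub>2 \<in> tangent_space (cone_atlas A) z"
        by (auto intro: frame_in)
      have "cone_endo A P z (\<Sum>e\<in>{cone_xi A z, f\<^sub>1, f\<^sub>2}. c e *\<^sub>R e) =
          (\<Sum>e\<in>{cone_xi A z, f\<^sub>1, f\<^sub>2}. c e *\<^sub>R cone_endo A P z e)" for c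
        using fr(2-4) f by (simp add: Fadd Fscale)
      from endo_trace_eq[OF hF(3) this]
      have "endo_trace (tangent_space (cone_atlas A) z) (cone_endo A P z) =
          (\<Sum>e\<in>{cone_xi A z, f\<^sub>1, f\<^sub>2}. cone_metric h z (cone_endo A P z e) e)" .
      moreover have "cone_endo A P z f\<^sub>1 = f\<^sub>1"
        using t e Pe Pscale[OF e(1)] by (simp add: cone_endo_def f\<^sub>1_def tp)
      moreover have "cone_endo A P z f\<^sub>2 = (-1) *\<^sub>R f\<^sub>2"
        using t e Pe Pscale[OF e(2)] cone_vec_scaleR[of "(1 / t) *\<^sub>R e\<^sub>2" p t "-1" 0]
        by (simp add: cone_endo_def f\<^sub>2_def tp)
      moreover have "cone_metric h z ((-1) *\<^sub>R f\<^sub>2) f\<^sub>2 = - 1"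
        using C.metric_scaleR_left[OF f(3,3), of "-1"] orthonormal[of f\<^sub>2 f\<^sub>2] by simp
      ultimately show "endo_trace (tangent_space (cone_atlas A) z) (cone_endo A P z) = 0"
        using fr(2-4) f orthonormal[of f\<^sub>1 f\<^sub>1] F0 by (simp del: scaleR_minus1_left)
    qed
  qed (use smooth_atlas_cone smooth_endo_cone[OF P] smooth_field_xi smooth_one_form_eta
      riemannian_metric_cone in auto)
  moreover have "scalar_curvature C g D (t, p) < 0 \<longleftrightarrow> k' p < 1" "scalar_curvature C g D (t, p) > 0 \<longleftrightarrow> k' p > 1"
    if tp: "(t, p) \<in> points C" for t p
  proof -
    have "t > 0" using tp by (simp add: C_def points_cone)
    then show "scalar_curvature C g D (t, p) < 0 \<longleftrightarrow> k' p < 1" "scalar_curvature C g D (t, p) > 0 \<longleftrightarrow> k' p > 1"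
      unfolding scalars(2)[OF tp] by (auto simp: divide_less_0_iff zero_less_divide_iff)
  qed
  ultimately show ?thesis
    using scalars(1) sectional_curvature_xi
    by (auto simp: C_def g_def \<phi>_def \<xi>_def \<eta>_def)
qed

end
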